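(* Let $G$ be a finite simple co-chordal graph on the vertex set $[n]=\{1,\dots,n\}$ with at least one edge. Let $\mathbb K$ be an arbitrary field and let $I(G)\subseteq S=\mathbb K[x_1,\dots,x_n]$ be the edge ideal of $G$. Then \[ \operatorname{reg} I(G)^{(s)}=2s\qquad\text{for every integer } s\ge 1 . \]
   Context: $S=\mathbb K[x_1,\dots,x_n]$ is standard graded. A graph is chordal if it has no induced cycle of length at least $4$; $G$ is co-chordal if its complement $G^c$ is chordal. The edge ideal is $I(G)=(x_ix_j:\{i,j\}\in E(G))$. Its $s$-th symbolic power is $I(G)^{(s)}=\bigcap_{C}P_C^s$, where $C$ runs over the minimal vertex covers of $G$ and $P_C=(x_i:i\in C)$. For a nonzero finitely generated graded $S$-module $M$, $\beta_{i,j}(M)=\dim_{\mathbb K}\operatorname{Tor}_i^S(M,\mathbb K)_j$ and $\operatorname{reg}M=\max\{j-i:\beta_{i,j}(M)\neq 0\}$. *)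

theory Defs
  imports Complex_Main "HOL-Library.Poly_Mapping" "HOL-Library.Function_Algebras"
begin

section \<open>The standard graded polynomial ring\<close>

text \<open>
  The polynomial ring in the finitely many variables \<open>x\<^sub>i\<close>, \<open>i :: 'n\<close>, with coefficients in \<open>'k\<close>:
  finitely supported functions on exponent vectors, with convolution as product.
\<close>

type_synonym ('n, 'k) mpoly = "('n \<Rightarrow>\<^sub>0 nat) \<Rightarrow>\<^sub>0 'k"

definition const :: "'k \<Rightarrow> ('n, 'k::field) mpoly" where
  "const c = Poly_Mapping.single 0 c"

definition var :: "'n \<Rightarrow> ('n, 'k::field) mpoly" where
  "var i = Poly_Mapping.single (Poly_Mapping.single i 1) 1"

definition mdeg :: "('n::finite \<Rightarrow>\<^sub>0 nat) \<Rightarrow> nat" where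
  "mdeg m = (\<Sum>i\<in>UNIV. Poly_Mapping.lookup m i)"

definition homog :: "int \<Rightarrow> ('n::finite, 'k::field) mpoly set" where
  "homog d = {f. \<forall>m \<in> Poly_Mapping.keys f. int (mdeg m) = d}"

abbreviation ideal_gen :: "('n, 'k::field) mpoly set \<Rightarrow> ('n, 'k) mpoly set" where
  "ideal_gen \<equiv> module.span (*)"

fun ideal_power :: "('n, 'k::field) mpoly set \<Rightarrow> nat \<Rightarrow> ('n, 'k) mpoly set" where
  "ideal_power I 0 = UNIV"
| "ideal_power I (Suc s) = ideal_gen {f * g |f g. f \<in> I \<and> g \<in> ideal_power I s}"


section \<open>Graded modules, Tor and regularity\<close>

text \<open>
  A graded module \<open>M\<close> over the polynomial ring is given by its scalar multiplication \<open>sM\<close> on an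
  ambient abelian group and the family of its homogeneous components \<open>M :: int \<Rightarrow> 'b set\<close>.

  A complex \<open>F\<close> of graded free modules of finite rank, augmented towards a graded module \<open>N\<close>,
  is given in terms of homogeneous bases: \<open>F\<^sub>i\<close> has basis elements \<open>e\<^sub>k\<close>, \<open>k < rnk F i\<close>, in
  degrees \<open>shift F i k\<close>; the map from \<open>F\<^bsub>i+1\<^esub>\<close> to \<open>F\<^sub>i\<close> has the matrix \<open>mat F i\<close> (row index
  first), and the augmentation sends the \<open>k\<close>-th basis element of \<open>F\<^sub>0\<close> to \<open>aug F k\<close>.
\<close>

record (overloaded) ('n, 'k::zero, 'c) free_cx =
  rnk :: "nat \<Rightarrow> nat"
  shift :: "nat \<Rightarrow> nat \<Rightarrow> int"
  mat :: "nat \<Rightarrow> nat \<Rightarrow> nat \<Rightarrow> ('n, 'k) mpoly"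
  aug :: "nat \<Rightarrow> 'c"

text \<open>
  The complex obtained by tensoring \<open>M\<close> with \<open>F\<close>, in internal degree \<open>j\<close>: the product of \<open>M\<close>
  with a free module is a direct sum of shifted copies of \<open>M\<close>, one for each basis element.
\<close>

definition chains ::
  "(int \<Rightarrow> 'b::ab_group_add set) \<Rightarrow> ('n, 'k::field, 'c) free_cx \<Rightarrow> nat \<Rightarrow> int \<Rightarrow> (nat \<Rightarrow> 'b) set"
where
  "chains M F i j =
     {v. (\<forall>k < rnk F i. v k \<in> M (j - shift F i k)) \<and> (\<forall>k \<ge> rnk F i. v k = 0)}"

definition bdry ::
  "(('n, 'k::field) mpoly \<Rightarrow> 'b \<Rightarrow> 'b::ab_group_add) \<Rightarrow> ('n, 'k, 'c) free_cx \<Rightarrow> nat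
     \<Rightarrow> (nat \<Rightarrow> 'b) \<Rightarrow> (nat \<Rightarrow> 'b)" where
  "bdry sM F i v =
     (\<lambda>k. if k < rnk F i then \<Sum>l < rnk F (Suc i). sM (mat F i k l) (v l) else 0)"

fun cycles ::
  "(('n, 'k::field) mpoly \<Rightarrow> 'b \<Rightarrow> 'b::ab_group_add) \<Rightarrow> (int \<Rightarrow> 'b set)
     \<Rightarrow> ('n, 'k, 'c) free_cx \<Rightarrow> nat \<Rightarrow> int \<Rightarrow> (nat \<Rightarrow> 'b) set" where
  "cycles sM M F 0 j = chains M F 0 j"
| "cycles sM M F (Suc i) j = {v \<in> chains M F (Suc i) j. bdry sM F i v = 0}"

definition boundaries ::
  "(('n, 'k::field) mpoly \<Rightarrow> 'b \<Rightarrow> 'b::ab_group_add) \<Rightarrow> (int \<Rightarrow> 'b set)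
     \<Rightarrow> ('n, 'k, 'c) free_cx \<Rightarrow> nat \<Rightarrow> int \<Rightarrow> (nat \<Rightarrow> 'b) set" where
  "boundaries sM M F i j = bdry sM F i ` chains M F (Suc i) j"

definition augment ::
  "(('n, 'k::field) mpoly \<Rightarrow> 'c \<Rightarrow> 'c::ab_group_add) \<Rightarrow> ('n, 'k, 'c) free_cx
     \<Rightarrow> (nat \<Rightarrow> ('n, 'k) mpoly) \<Rightarrow> 'c" where
  "augment sN F v = (\<Sum>k < rnk F 0. sN (v k) (aug F k))"

text \<open>
  \<open>F\<close> is a graded free resolution of \<open>N\<close>. All maps have degree 0, so exactness can be required
  degree by degree; \<open>F\<close> itself is recovered as the tensor product with the ring.
\<close>

definition graded_free_resolution ::
  "(('n::finite, 'k::field) mpoly \<Rightarrow> 'c \<Rightarrow> 'c::ab_group_add) \<Rightarrow> (int \<Rightarrow> 'c set)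
     \<Rightarrow> ('n, 'k, 'c) free_cx \<Rightarrow> bool" where
  "graded_free_resolution sN N F \<longleftrightarrow>
     (\<forall>i. \<forall>k < rnk F i. \<forall>l < rnk F (Suc i).
        mat F i k l \<in> homog (shift F (Suc i) l - shift F i k)) \<and>
     (\<forall>k < rnk F 0. aug F k \<in> N (shift F 0 k)) \<and>
     (\<forall>i j. cycles (*) homog F (Suc i) j = boundaries (*) homog F (Suc i) j) \<and>
     (\<forall>j. {v \<in> chains homog F 0 j. augment sN F v = 0} = boundaries (*) homog F 0 j) \<and>
     (\<forall>j. augment sN F ` chains homog F 0 j = N j)"

text \<open>
  \<open>dim\<^sub>K Tor\<^sub>i(M,N)\<^sub>j\<close>, with \<open>Tor\<^sub>i(M,-)\<close> the \<open>i\<close>-th left derived functor of \<open>M \<otimes> -\<close>, i.e. the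
  homology of \<open>M \<otimes> F\<close> for a graded free resolution \<open>F\<close> of \<open>N\<close>. Both \<open>M\<close> and \<open>N\<close> are meant to be
  finitely generated: then a resolution by modules of finite rank exists, and the spaces of cycles
  and boundaries in a fixed degree are finite-dimensional, so that the dimension of the quotient
  is the difference of their dimensions.
\<close>

definition tor_dim ::
  "(('n::finite, 'k::field) mpoly \<Rightarrow> 'b \<Rightarrow> 'b::ab_group_add) \<Rightarrow> (int \<Rightarrow> 'b set)
     \<Rightarrow> (('n, 'k) mpoly \<Rightarrow> 'c \<Rightarrow> 'c::ab_group_add) \<Rightarrow> (int \<Rightarrow> 'c set) \<Rightarrow> nat \<Rightarrow> int \<Rightarrow> nat"
where
  "tor_dim sM M sN N i j =
     (let F = SOME F. graded_free_resolution sN N F;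
          dimK = vector_space.dim (\<lambda>(c::'k) (v::nat \<Rightarrow> 'b) k. sM (const c) (v k))
      in dimK (cycles sM M F i j) - dimK (boundaries sM M F i j))"

text \<open>
  The residue field \<open>K = S/(x\<^sub>1,\<dots>,x\<^sub>n)\<close>: a polynomial acts through its constant coefficient, and
  \<open>K\<close> is concentrated in degree 0.
\<close>

definition res_scale :: "('n, 'k::field) mpoly \<Rightarrow> 'k \<Rightarrow> 'k" where
  "res_scale f c = Poly_Mapping.lookup f 0 * c"

definition res_field :: "int \<Rightarrow> 'k::field set" where
  "res_field j = (if j = 0 then UNIV else {0})"

definition betti ::
  "(('n::finite, 'k::field) mpoly \<Rightarrow> 'b \<Rightarrow> 'b::ab_group_add) \<Rightarrow> (int \<Rightarrow> 'b set)
     \<Rightarrow> nat \<Rightarrow> int \<Rightarrow> nat" where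
  "betti sM M i j = tor_dim sM M (res_scale :: ('n, 'k) mpoly \<Rightarrow> 'k \<Rightarrow> 'k) res_field i j"

definition regularity ::
  "(('n::finite, 'k::field) mpoly \<Rightarrow> 'b \<Rightarrow> 'b::ab_group_add) \<Rightarrow> (int \<Rightarrow> 'b set) \<Rightarrow> int" where
  "regularity sM M = Max {j - int i |i j. betti sM M i j \<noteq> 0}"

text \<open>A homogeneous ideal, as a graded submodule of the ring.\<close>

definition ideal_reg :: "('n::finite, 'k::field) mpoly set \<Rightarrow> int" where
  "ideal_reg I = regularity (*) (\<lambda>d. I \<inter> homog d)"


section \<open>Graphs\<close>

text \<open>A simple graph on the vertex set \<open>UNIV :: 'n set\<close> is given by its set of edges.\<close>

definition simple_graph :: "'n set set \<Rightarrow> bool" where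
  "simple_graph E \<longleftrightarrow> (\<forall>e \<in> E. card e = 2)"

definition complement_graph :: "'n set set \<Rightarrow> 'n set set" where
  "complement_graph E = {e. card e = 2 \<and> e \<notin> E}"

definition induced_cycle :: "'n set set \<Rightarrow> 'n list \<Rightarrow> bool" where
  "induced_cycle E vs \<longleftrightarrow> 3 \<le> length vs \<and> distinct vs \<and>
     (\<forall>i j. i < j \<and> j < length vs \<longrightarrow>
        ({vs ! i, vs ! j} \<in> E \<longleftrightarrow> j = Suc i \<or> (i = 0 \<and> Suc j = length vs)))"

definition chordal :: "'n set set \<Rightarrow> bool" where
  "chordal E \<longleftrightarrow> \<not> (\<exists>vs. induced_cycle E vs \<and> 4 \<le> length vs)"

definition co_chordal :: "'n set set \<Rightarrow> bool" where
  "co_chordal E \<longleftrightarrow> chordal (complement_graph E)"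

definition vertex_cover :: "'n set set \<Rightarrow> 'n set \<Rightarrow> bool" where
  "vertex_cover E C \<longleftrightarrow> (\<forall>e \<in> E. e \<inter> C \<noteq> {})"

definition minimal_vertex_cover :: "'n set set \<Rightarrow> 'n set \<Rightarrow> bool" where
  "minimal_vertex_cover E C \<longleftrightarrow> vertex_cover E C \<and> (\<forall>D. D \<subset> C \<longrightarrow> \<not> vertex_cover E D)"

definition edge_ideal :: "'n set set \<Rightarrow> ('n, 'k::field) mpoly set" where
  "edge_ideal E = ideal_gen {var i * var j |i j. {i, j} \<in> E}"

text \<open>The symbolic powers of \<open>edge_ideal E\<close>.\<close>

definition symbolic_power :: "'n set set \<Rightarrow> nat \<Rightarrow> ('n, 'k::field) mpoly set" where
  "symbolic_power E s =
     (\<Inter>C \<in> {C. minimal_vertex_cover E C}. ideal_power (ideal_gen (var ` C)) s)"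

interpretation pm: module "(*) :: ('n, 'k::field) mpoly \<Rightarrow> _"
  by unfold_locales (auto simp: algebra_simps)

lemma mpoly_sum_monomials:
  fixes f :: "('n, 'k::field) mpoly"
  shows "f = (\<Sum>m \<in> Poly_Mapping.keys f. Poly_Mapping.single m (Poly_Mapping.lookup f m))"
proof (rule poly_mapping_eqI)
  fix k
  show "Poly_Mapping.lookup f k = Poly_Mapping.lookup
      (\<Sum>m \<in> Poly_Mapping.keys f. Poly_Mapping.single m (Poly_Mapping.lookup f m)) k"
    by (auto simp: lookup_sum lookup_single when_def in_keys_iff)
qed

text \<open>Membership in an ideal generated by monomials \<open>x\<^sup>a\<close>, \<open>a \<in> A\<close>.\<close>

lemma monomial_ideal_iff:
  fixes f :: "('n, 'k::field) mpoly"
  shows "f \<in> ideal_gen ((\<lambda>a. Poly_Mapping.single a 1) ` A) \<longleftrightarrow>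
    (\<forall>m \<in> Poly_Mapping.keys f. \<exists>a \<in> A. \<exists>b. m = a + b)"
proof
  assume "f \<in> ideal_gen ((\<lambda>a. Poly_Mapping.single a 1) ` A)"
  then show "\<forall>m \<in> Poly_Mapping.keys f. \<exists>a \<in> A. \<exists>b. m = a + b"
  proof (induction rule: pm.span_induct_alt)
    case base
    show ?case by simp
  next
    case (step c x y)
    then obtain a where a: "a \<in> A" "x = Poly_Mapping.single a 1" by auto
    have "Poly_Mapping.keys (c * x) \<subseteq> {p + q |p q. p \<in> Poly_Mapping.keys c \<and> q \<in> {a}}"
      using keys_mult[of c x] a(2) by auto
    then have "\<forall>m \<in> Poly_Mapping.keys (c * x). \<exists>b. m = a + b"
      by (auto simp: add.commute)
    with a(1) step.IH keys_add[of "c * x" y] show ?case by blast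
  qed
next
  assume H: "\<forall>m \<in> Poly_Mapping.keys f. \<exists>a \<in> A. \<exists>b. m = a + b"
  have "(\<Sum>m \<in> Poly_Mapping.keys f. Poly_Mapping.single m (Poly_Mapping.lookup f m))
    \<in> ideal_gen ((\<lambda>a. Poly_Mapping.single a 1) ` A)"
  proof (rule pm.span_sum)
    fix m assume "m \<in> Poly_Mapping.keys f"
    then obtain a b where ab: "a \<in> A" "m = a + b" using H by blast
    have "Poly_Mapping.single m (Poly_Mapping.lookup f m) =
        Poly_Mapping.single b (Poly_Mapping.lookup f m) * Poly_Mapping.single a 1"
      by (simp add: mult_single ab add.commute)
    then show "Poly_Mapping.single m (Poly_Mapping.lookup f m)
        \<in> ideal_gen ((\<lambda>a. Poly_Mapping.single a 1) ` A)"
      using ab(1) by (simp add: pm.span_scale pm.span_base)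
  qed
  then show "f \<in> ideal_gen ((\<lambda>a. Poly_Mapping.single a 1) ` A)"
    using mpoly_sum_monomials[of f] by simp
qed

lemma single_divides_iff:
  "(\<exists>b. m = Poly_Mapping.single i (1::nat) + b) \<longleftrightarrow> 0 < Poly_Mapping.lookup m i"
proof
  assume "0 < Poly_Mapping.lookup m i"
  then have "m = Poly_Mapping.single i 1 + (m - Poly_Mapping.single i 1)"
    by (intro poly_mapping_eqI) (auto simp: lookup_add lookup_minus lookup_single when_def)
  then show "\<exists>b. m = Poly_Mapping.single i 1 + b" by blast
qed (auto simp: lookup_add lookup_single)

lemma pair_divides_iff:
  assumes "i \<noteq> j"
  shows "(\<exists>b. m = Poly_Mapping.single i (1::nat) + Poly_Mapping.single j 1 + b) \<longleftrightarrow>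
    0 < Poly_Mapping.lookup m i \<and> 0 < Poly_Mapping.lookup m j"
proof
  assume "0 < Poly_Mapping.lookup m i \<and> 0 < Poly_Mapping.lookup m j"
  with assms have "m = Poly_Mapping.single i 1 + Poly_Mapping.single j 1
      + (m - (Poly_Mapping.single i 1 + Poly_Mapping.single j 1))"
    by (intro poly_mapping_eqI) (auto simp: lookup_add lookup_minus lookup_single when_def)
  then show "\<exists>b. m = Poly_Mapping.single i 1 + Poly_Mapping.single j 1 + b" by blast
qed (auto simp: lookup_add lookup_single)

lemma var_ideal_iff:
  fixes f :: "('n, 'k::field) mpoly"
  shows "f \<in> ideal_gen (var ` C) \<longleftrightarrow>
    (\<forall>m \<in> Poly_Mapping.keys f. \<exists>i \<in> C. 0 < Poly_Mapping.lookup m i)"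
proof -
  have "var ` C = (\<lambda>a. Poly_Mapping.single a (1::'k)) ` ((\<lambda>i. Poly_Mapping.single i (1::nat)) ` C)"
    by (simp add: image_image var_def)
  then show ?thesis
    by (simp only: monomial_ideal_iff bex_simps single_divides_iff)
qed

lemma edge_ideal_iff:
  fixes f :: "('n, 'k::field) mpoly"
  assumes "simple_graph E"
  shows "f \<in> edge_ideal E \<longleftrightarrow> (\<forall>m \<in> Poly_Mapping.keys f. \<exists>i j. {i, j} \<in> E \<and>
    0 < Poly_Mapping.lookup m i \<and> 0 < Poly_Mapping.lookup m j)"
proof -
  let ?A = "{Poly_Mapping.single i (1::nat) + Poly_Mapping.single j 1 |i j. {i, j} \<in> E}"
  have ne: "i \<noteq> j" if "{i, j} \<in> E" for i j
    using assms that by (auto simp: simple_graph_def)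
  have "{var i * var j |i j. {i, j} \<in> E} = (\<lambda>a. Poly_Mapping.single a (1::'k)) ` ?A"
    by (auto simp: var_def mult_single)
  then have "f \<in> edge_ideal E \<longleftrightarrow>
      (\<forall>m \<in> Poly_Mapping.keys f. \<exists>a \<in> ?A. \<exists>b. m = a + b)"
    unfolding edge_ideal_def by (simp only: monomial_ideal_iff)
  moreover have "(\<exists>a \<in> ?A. \<exists>b. m = a + b) \<longleftrightarrow> (\<exists>i j. {i, j} \<in> E \<and>
      0 < Poly_Mapping.lookup m i \<and> 0 < Poly_Mapping.lookup m j)" for m
  proof -
    have "(\<exists>a \<in> ?A. \<exists>b. m = a + b) \<longleftrightarrow> (\<exists>i j. {i, j} \<in> E \<and>
        (\<exists>b. m = Poly_Mapping.single i 1 + Poly_Mapping.single j 1 + b))"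
      by blast
    also have "\<dots> \<longleftrightarrow> (\<exists>i j. {i, j} \<in> E \<and>
        0 < Poly_Mapping.lookup m i \<and> 0 < Poly_Mapping.lookup m j)"
      using pair_divides_iff[OF ne, of _ _ m] by blast
    finally show ?thesis .
  qed
  ultimately show ?thesis by simp
qed

lemma ideal_power_1:
  fixes X :: "('n, 'k::field) mpoly set"
  shows "ideal_power (ideal_gen X) 1 = ideal_gen X"
proof -
  have "{f * g |f g. f \<in> ideal_gen X \<and> g \<in> (UNIV :: ('n, 'k) mpoly set)} = ideal_gen X"
  proof (intro equalityI subsetI)
    fix f assume "f \<in> ideal_gen X"
    then have "f = f * 1 \<and> f \<in> ideal_gen X" by simp
    then show "f \<in> {f * g |f g. f \<in> ideal_gen X \<and> g \<in> (UNIV :: ('n, 'k) mpoly set)}" by blast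
  next
    fix h :: "('n, 'k) mpoly"
    assume "h \<in> {f * g |f g. f \<in> ideal_gen X \<and> g \<in> (UNIV :: ('n, 'k) mpoly set)}"
    then obtain f g where "h = g * f" "f \<in> ideal_gen X" by (auto simp: mult.commute)
    then show "h \<in> ideal_gen X" by (simp add: pm.span_scale)
  qed
  then show ?thesis by (simp add: pm.span_span)
qed

lemma minimal_vertex_cover_exists:
  fixes C :: "'n::finite set"
  assumes "vertex_cover E C"
  shows "\<exists>D \<subseteq> C. minimal_vertex_cover E D"
  using assms
proof (induction "card C" arbitrary: C rule: less_induct)
  case less
  show ?case
  proof (cases "minimal_vertex_cover E C")
    case False
    with less.prems obtain D where D: "D \<subset> C" "vertex_cover E D"
      by (auto simp: minimal_vertex_cover_def)
    then have "card D < card C" by (simp add: psubset_card_mono)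
    with less.hyps[OF this D(2)] D(1) show ?thesis by blast
  qed auto
qed

lemma symbolic_power_1:
  fixes E :: "'n::finite set set"
  assumes "simple_graph E"
  shows "symbolic_power E 1 = (edge_ideal E :: ('n, 'k::field) mpoly set)"
proof (intro equalityI subsetI)
  fix f :: "('n, 'k) mpoly"
  assume f: "f \<in> symbolic_power E 1"
  have "\<exists>i j. {i, j} \<in> E \<and> 0 < Poly_Mapping.lookup m i \<and> 0 < Poly_Mapping.lookup m j"
    if m: "m \<in> Poly_Mapping.keys f" for m
  proof (rule ccontr)
    assume neg: "\<not> ?thesis"
    have "vertex_cover E {i. Poly_Mapping.lookup m i = 0}"
      unfolding vertex_cover_def
    proof
      fix e assume e: "e \<in> E"
      then obtain i j where "e = {i, j}"
        using assms by (auto simp: simple_graph_def card_2_iff)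
      with e neg show "e \<inter> {i. Poly_Mapping.lookup m i = 0} \<noteq> {}" by auto
    qed
    then obtain D where D: "D \<subseteq> {i. Poly_Mapping.lookup m i = 0}" "minimal_vertex_cover E D"
      using minimal_vertex_cover_exists by blast
    then have "f \<in> ideal_gen (var ` D)"
      using f unfolding symbolic_power_def by (auto simp del: One_nat_def simp: ideal_power_1)
    with m obtain i where "i \<in> D" "0 < Poly_Mapping.lookup m i"
      unfolding var_ideal_iff by blast
    with D(1) show False by auto
  qed
  then show "f \<in> edge_ideal E" by (simp add: edge_ideal_iff[OF assms])
next
  fix f :: "('n, 'k) mpoly"
  assume f: "f \<in> edge_ideal E"
  show "f \<in> symbolic_power E 1"
    unfolding symbolic_power_def
  proof (intro INT_I)
    fix C assume "C \<in> {C. minimal_vertex_cover E C}"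
    then have C: "vertex_cover E C" by (simp add: minimal_vertex_cover_def)
    have "f \<in> ideal_gen (var ` C)"
      unfolding var_ideal_iff
    proof
      fix m assume "m \<in> Poly_Mapping.keys f"
      then obtain i j where "{i, j} \<in> E"
        "0 < Poly_Mapping.lookup m i" "0 < Poly_Mapping.lookup m j"
        using f unfolding edge_ideal_iff[OF assms] by blast
      with C show "\<exists>i \<in> C. 0 < Poly_Mapping.lookup m i"
        by (auto simp: vertex_cover_def)
    qed
    then show "f \<in> ideal_power (ideal_gen (var ` C)) 1" by (simp only: ideal_power_1)
  qed
qed

end

theory Submission
  imports Defs
begin

text \<open>
  For a convex set \<open>D\<close> of exponents let \<open>M\<^sub>D\<close> be the monomial module with basis \<open>D\<close>. Short exact
  sequences of such modules, multiplication by monomials, and reduction modulo a variable give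
  vanishing of \<open>Tor\<close> for any graded free resolution of the residue field, without ever comparing
  resolutions.

  Let \<open>H\<close> be the chordal complement. The \<open>s\<close>-th symbolic power of the ideal consists of the monomials
  \<open>a\<close> that have degree at least \<open>s\<close> outside of every clique of \<open>H\<close>. Cutting along the exponent \<open>t\<close> of a
  simplicial vertex \<open>v\<close> leaves the ideal of \<open>H - v\<close> for \<open>s - t\<close>, with the degree outside of the clique
  \<open>K = N(v)\<close> raised from \<open>s - t\<close> to \<open>s\<close>. Raising it step by step has as quotients direct sums of shifted
  ideals in the variables of \<open>K\<close>; each of them is an intersection of powers of monomial primes that
  is organised by a clique tree rooted at \<open>K\<close>, and its regularity is at most \<open>s - t\<close>. The lower bound
  comes from the minimal generator \<open>(x\<^sub>i x\<^sub>j)\<^sup>s\<close> for an edge \<open>{i, j}\<close>.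
\<close>

section \<open>Monomial modules and vanishing of Tor\<close>

text \<open>The Betti numbers are read off a resolution picked by choice. So one resolution of the
  residue field has to be produced, and all else is proved for the chosen one from the clauses of
  \<open>graded_free_resolution\<close> alone. The maximum of \<open>j - i\<close> must moreover
  range over a finite set, so vanishing is needed below as well: \<open>Tor_i\<close> is zero in
  degrees \<open>j < i\<close>.

  The numbers fit as follows. The ideal of \<open>H - v\<close> for \<open>s - t\<close> has
  regularity at most \<open>2 (s - t)\<close>. Each of the \<open>t\<close> raising steps passes to
  a submodule whose quotient has regularity at most the previous bound, which costs one degree, so
  the slice ends at \<open>2 s - t\<close>. The factor \<open>x_v^t\<close> brings this back to
  \<open>2 s\<close>, and the slice for \<open>t + 1\<close> has just the one degree less that the
  quotient of consecutive slices requires.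

  The obstacle is the bound for the quotients in the raising steps. The sum of the exponents of all
  primes would be too weak. In the tree, siblings share the exponent of their parent, and the shared
  part is counted once.\<close>

definition restr :: "('n \<Rightarrow>\<^sub>0 nat) set \<Rightarrow> ('n, 'k::field) mpoly \<Rightarrow> ('n, 'k) mpoly" where
  "restr D f =
     (\<Sum>m \<in> Poly_Mapping.keys f \<inter> D. Poly_Mapping.single m (Poly_Mapping.lookup f m))"

lemma lookup_restr:
  "Poly_Mapping.lookup (restr D f) m = (if m \<in> D then Poly_Mapping.lookup f m else 0)"
  by (auto simp: restr_def lookup_sum lookup_single when_def in_keys_iff)

lemma keys_restr: "Poly_Mapping.keys (restr D f) = Poly_Mapping.keys f \<inter> D"
  by (auto simp: in_keys_iff lookup_restr split: if_splits)

lemma restr_add: "restr D (f + g) = restr D f + restr D g"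
  by (rule poly_mapping_eqI) (simp add: lookup_restr lookup_add)

lemma restr_diff: "restr D (f - g) = restr D f - restr D g"
  by (rule poly_mapping_eqI) (simp add: lookup_restr lookup_minus)

lemma restr_zero [simp]: "restr D 0 = 0"
  by (rule poly_mapping_eqI) (simp add: lookup_restr)

lemma restr_sum: "restr D (sum f A) = (\<Sum>x\<in>A. restr D (f x))"
  by (induction A rule: infinite_finite_induct) (simp_all add: restr_add)

lemma restr_id: "Poly_Mapping.keys f \<subseteq> D \<Longrightarrow> restr D f = f"
  by (rule poly_mapping_eqI) (auto simp: lookup_restr in_keys_iff)

lemma restr_eq_0: "restr D f = 0 \<longleftrightarrow> Poly_Mapping.keys f \<inter> D = {}"
  by (simp add: keys_restr flip: keys_eq_empty)

lemma restr_restr: "restr D (restr D' f) = restr (D \<inter> D') f"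
  by (rule poly_mapping_eqI) (simp add: lookup_restr)

text \<open>Monomials of \<open>g\<close> outside \<open>D\<close> never reach \<open>D\<close>
  after multiplication, so truncating \<open>g\<close> first loses nothing. This is why the
  truncated differential squares to zero.\<close>

lemma restr_mult:
  assumes "\<forall>m \<in> Poly_Mapping.keys g. m \<notin> D \<longrightarrow> (\<forall>c. m + c \<notin> D)"
  shows "restr D (f * restr D g) = restr D (f * g)"
proof -
  have "Poly_Mapping.keys (f * (g - restr D g)) \<inter> D = {}"
  proof (rule ccontr)
    assume "\<not> ?thesis"
    then obtain x where x: "x \<in> Poly_Mapping.keys (f * (g - restr D g))" "x \<in> D" by blast
    then obtain a b where ab: "x = a + b" "b \<in> Poly_Mapping.keys (g - restr D g)"
      using keys_mult[of f "g - restr D g"] by blast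
    then have "b \<in> Poly_Mapping.keys g" "b \<notin> D"
      by (auto simp: in_keys_iff lookup_minus lookup_restr split: if_splits)
    with assms x(2) ab(1) show False by (metis add.commute)
  qed
  then have "restr D (f * (g - restr D g)) = 0" by (simp add: restr_eq_0)
  then show ?thesis by (simp add: algebra_simps restr_diff)
qed

lemma single_mult_expand:
  fixes f :: "('n, 'k::field) mpoly"
  shows "Poly_Mapping.single g c * f =
    (\<Sum>m\<in>Poly_Mapping.keys f. Poly_Mapping.single (g + m) (c * Poly_Mapping.lookup f m))"
  by (subst (1) mpoly_sum_monomials[of f]) (simp add: sum_distrib_left mult_single)

lemma lookup_monom_mult:
  fixes f :: "('n, 'k::field) mpoly"
  shows "Poly_Mapping.lookup (Poly_Mapping.single g c * f) (g + m) = c * Poly_Mapping.lookup f m"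
  by (auto simp: single_mult_expand lookup_sum lookup_single when_def in_keys_iff
      intro: sum.neutral)

lemma keys_monom_mult:
  fixes f :: "('n, 'k::field) mpoly"
  shows "Poly_Mapping.keys (Poly_Mapping.single g 1 * f) = (+) g ` Poly_Mapping.keys f"
proof -
  have "Poly_Mapping.keys (Poly_Mapping.single g 1 * f) \<subseteq> (+) g ` Poly_Mapping.keys f"
    using keys_mult[of "Poly_Mapping.single g 1" f] by (auto split: if_splits)
  then show ?thesis by (auto simp: in_keys_iff lookup_monom_mult)
qed

lemma monom_divide:
  fixes f :: "('n, 'k::field) mpoly"
  assumes "Poly_Mapping.keys f \<subseteq> (+) g ` D"
  obtains f' where "f = Poly_Mapping.single g 1 * f'" "Poly_Mapping.keys f' \<subseteq> D"
proof
  let ?f = "Poly_Mapping.map_key ((+) g) f"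
  have l: "Poly_Mapping.lookup ?f m = Poly_Mapping.lookup f (g + m)" for m
    by (simp add: map_key.rep_eq)
  show "f = Poly_Mapping.single g 1 * ?f"
  proof (rule poly_mapping_eqI)
    fix m
    show "Poly_Mapping.lookup f m = Poly_Mapping.lookup (Poly_Mapping.single g 1 * ?f) m"
    proof (cases "\<exists>c. m = g + c")
      case True then show ?thesis by (auto simp: lookup_monom_mult l)
    next
      case False
      then have "m \<notin> Poly_Mapping.keys f" using assms by auto
      then show ?thesis using False keys_monom_mult[of g ?f] by (auto simp: in_keys_iff)
    qed
  qed
  show "Poly_Mapping.keys ?f \<subseteq> D"
  proof
    fix m assume "m \<in> Poly_Mapping.keys ?f"
    then have "g + m \<in> Poly_Mapping.keys f" by (simp add: in_keys_iff l)
    then show "m \<in> D" using assms by auto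
  qed
qed

lemma homog_zero [simp]: "0 \<in> homog d"
  by (simp add: homog_def)

lemma homog_add: "f \<in> homog d \<Longrightarrow> g \<in> homog d \<Longrightarrow> f + g \<in> homog d"
  using keys_add[of f g] by (auto simp: homog_def)

lemma homog_uminus: "f \<in> homog d \<Longrightarrow> - f \<in> homog d"
  by (simp add: homog_def)

lemma homog_diff: "f \<in> homog d \<Longrightarrow> g \<in> homog d \<Longrightarrow> f - g \<in> homog d"
  using homog_add[of f d "- g"] homog_uminus[of g d] by simp

lemma homog_sum: "(\<And>x. x \<in> A \<Longrightarrow> f x \<in> homog d) \<Longrightarrow> sum f A \<in> homog d"
  by (induction A rule: infinite_finite_induct) (simp_all add: homog_add)

lemma homog_restr: "f \<in> homog d \<Longrightarrow> restr D f \<in> homog d"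
  by (simp add: homog_def keys_restr)

lemma mdeg_add: "mdeg (a + b) = mdeg a + mdeg b"
  by (simp add: mdeg_def lookup_add sum.distrib)

lemma homog_mult: "f \<in> homog d \<Longrightarrow> g \<in> homog e \<Longrightarrow> f * g \<in> homog (d + e)"
proof -
  assume f: "f \<in> homog d" and g: "g \<in> homog e"
  show ?thesis unfolding homog_def
  proof safe
    fix m assume "m \<in> Poly_Mapping.keys (f * g)"
    then obtain a b where "m = a + b" "a \<in> Poly_Mapping.keys f" "b \<in> Poly_Mapping.keys g"
      using keys_mult[of f g] by blast
    then show "int (mdeg m) = d + e" using f g by (auto simp: homog_def mdeg_add)
  qed
qed

text \<open>These are the exponent sets of monomial subquotients of the ring: no product leaves
  \<open>D\<close> and comes back.\<close>

definition convex_exp :: "('n \<Rightarrow>\<^sub>0 nat) set \<Rightarrow> bool" where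
  "convex_exp D \<longleftrightarrow> (\<forall>a b c. a \<in> D \<and> a + b + c \<in> D \<longrightarrow> a + b \<in> D)"

text \<open>The condition for the span of \<open>D1\<close> to be a submodule of the span of
  \<open>D\<close>; the quotient then has basis \<open>D - D1\<close>. With \<open>D = UNIV\<close>
  these are the monomial ideals.\<close>

definition up_in :: "('n \<Rightarrow>\<^sub>0 nat) set \<Rightarrow> ('n \<Rightarrow>\<^sub>0 nat) set \<Rightarrow> bool" where
  "up_in D1 D \<longleftrightarrow> D1 \<subseteq> D \<and> (\<forall>a b. a \<in> D1 \<and> a + b \<in> D \<longrightarrow> a + b \<in> D1)"

definition rs :: "('n \<Rightarrow>\<^sub>0 nat) set \<Rightarrow> (nat \<Rightarrow> ('n, 'k::field) mpoly) \<Rightarrow> nat \<Rightarrow> ('n, 'k) mpoly" where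
  "rs D v = (\<lambda>k. restr D (v k))"

lemma rs_add: "rs D (u + v) = rs D u + rs D v"
  by (simp add: rs_def fun_eq_iff restr_add)

lemma rs_diff: "rs D (u - v) = rs D u - rs D v"
  by (simp add: rs_def fun_eq_iff restr_diff)

lemma bdry_add: "bdry (*) F i (u + v) = bdry (*) F i u + bdry (*) F i v"
  by (rule ext) (simp add: bdry_def distrib_left sum.distrib)

lemma bdry_diff: "bdry (*) F i (u - v) = bdry (*) F i u - bdry (*) F i v"
  by (rule ext) (simp add: bdry_def right_diff_distrib sum_subtractf)

lemma bdry_smult: "bdry (*) F i (\<lambda>k. f * v k) = (\<lambda>k. f * bdry (*) F i v k)"
proof (rule ext)
  fix k
  have "(\<Sum>l<rnk F (Suc i). mat F i k l * (f * v l)) = f * (\<Sum>l<rnk F (Suc i). mat F i k l * v l)"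
    unfolding sum_distrib_left by (rule sum.cong) (simp_all only: mult.left_commute[of _ f])
  then show "bdry (*) F i (\<lambda>k. f * v k) k = f * bdry (*) F i v k" by (simp add: bdry_def)
qed

text \<open>For \<open>D\<close> convex, \<open>ch F D i j\<close> with the differential \<open>bd F D\<close> is the tensor product of \<open>F\<close>
  with the monomial module that has the basis \<open>D\<close>; products of monomials that leave \<open>D\<close> vanish.\<close>

definition ch :: "('n::finite, 'k::field, 'c) free_cx \<Rightarrow> ('n \<Rightarrow>\<^sub>0 nat) set \<Rightarrow> nat \<Rightarrow> int
     \<Rightarrow> (nat \<Rightarrow> ('n, 'k) mpoly) set" where
  "ch F D i j = {v \<in> chains homog F i j. \<forall>k. Poly_Mapping.keys (v k) \<subseteq> D}"

definition bd :: "('n::finite, 'k::field, 'c) free_cx \<Rightarrow> ('n \<Rightarrow>\<^sub>0 nat) set \<Rightarrow> nat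
     \<Rightarrow> (nat \<Rightarrow> ('n, 'k) mpoly) \<Rightarrow> nat \<Rightarrow> ('n, 'k) mpoly" where
  "bd F D i v = rs D (bdry (*) F i v)"

text \<open>Exactness of the tensor product at position \<open>i\<close> in degree \<open>j\<close>,
  that is \<open>Tor_i = 0\<close> there once \<open>F\<close> resolves the residue field. Position
  0 has no cycle condition, so there all chains must be boundaries.\<close>

definition vanishing :: "('n::finite, 'k::field, 'c) free_cx \<Rightarrow> nat \<Rightarrow> int \<Rightarrow> ('n \<Rightarrow>\<^sub>0 nat) set \<Rightarrow> bool" where
  "vanishing F i j D \<longleftrightarrow> (\<forall>v \<in> ch F D i j. (\<forall>i'. i = Suc i' \<longrightarrow> bd F D i' v = 0)
     \<longrightarrow> v \<in> bd F D i ` ch F D (Suc i) j)"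

text \<open>Only an upper bound, so that it also makes sense for the zero module
  \<open>D = {}\<close>.\<close>

definition reg_le :: "('n::finite, 'k::field, 'c) free_cx \<Rightarrow> int \<Rightarrow> ('n \<Rightarrow>\<^sub>0 nat) set \<Rightarrow> bool" where
  "reg_le F r D \<longleftrightarrow> (\<forall>i j. int i + r < j \<longrightarrow> vanishing F i j D)"

lemma bd_add: "bd F D i (u + v) = bd F D i u + bd F D i v"
  by (simp add: bd_def bdry_add rs_add)

lemma bd_diff: "bd F D i (u - v) = bd F D i u - bd F D i v"
  by (simp add: bd_def bdry_diff rs_diff)

lemma ch_add: "u \<in> ch F D i j \<Longrightarrow> v \<in> ch F D i j \<Longrightarrow> u + v \<in> ch F D i j"
proof -
  assume "u \<in> ch F D i j" "v \<in> ch F D i j"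
  moreover have "Poly_Mapping.keys ((u + v) k) \<subseteq> Poly_Mapping.keys (u k) \<union> Poly_Mapping.keys (v k)" for k
    by (simp add: keys_add)
  ultimately show ?thesis by (simp add: ch_def chains_def homog_add) blast
qed

lemma ch_diff: "u \<in> ch F D i j \<Longrightarrow> v \<in> ch F D i j \<Longrightarrow> u - v \<in> ch F D i j"
proof -
  assume "u \<in> ch F D i j" "v \<in> ch F D i j"
  moreover have "Poly_Mapping.keys ((u - v) k) \<subseteq> Poly_Mapping.keys (u k) \<union> Poly_Mapping.keys (v k)" for k
    by (simp add: keys_diff)
  ultimately show ?thesis by (simp add: ch_def chains_def homog_diff) blast
qed

lemma ch_mono: "D \<subseteq> D' \<Longrightarrow> v \<in> ch F D i j \<Longrightarrow> v \<in> ch F D' i j"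
  by (auto simp: ch_def)

lemma ch_rs: "v \<in> ch F D i j \<Longrightarrow> rs D' v \<in> ch F (D \<inter> D') i j"
  by (auto simp: ch_def chains_def rs_def keys_restr homog_restr)

lemma ch_rs_chains: "v \<in> chains homog F i j \<Longrightarrow> rs D' v \<in> ch F D' i j"
  by (auto simp: ch_def chains_def rs_def keys_restr homog_restr)

lemma rs_id: "v \<in> ch F D i j \<Longrightarrow> D \<subseteq> D' \<Longrightarrow> rs D' v = v"
  by (rule ext) (auto simp: ch_def rs_def intro!: restr_id)

lemma ch_zero [simp]: "0 \<in> ch F D i j"
  by (simp add: ch_def chains_def)

lemma rs_bdry_rs:
  assumes "\<And>k m. m \<in> Poly_Mapping.keys (v k) \<Longrightarrow> m \<notin> D \<Longrightarrow> \<forall>c. m + c \<notin> D"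
  shows "rs D (bdry (*) F i (rs D v)) = rs D (bdry (*) F i v)"
proof (rule ext)
  fix k
  have "restr D (f * restr D (v l)) = restr D (f * v l)" for f l
    by (rule restr_mult) (use assms in blast)
  then show "rs D (bdry (*) F i (rs D v)) k = rs D (bdry (*) F i v) k"
    by (simp add: rs_def bdry_def restr_sum)
qed

lemma keys_bdry:
  assumes "\<And>k. Poly_Mapping.keys (v k) \<subseteq> D" "m \<in> Poly_Mapping.keys (bdry (*) F i v k)"
  shows "\<exists>a \<in> D. \<exists>c. m = a + c"
proof -
  have "k < rnk F i" using assms(2) by (auto simp: bdry_def split: if_splits)
  with assms(2) have "m \<in> Poly_Mapping.keys (\<Sum>l < rnk F (Suc i). mat F i k l * v l)"
    by (simp add: bdry_def)
  then obtain l where "m \<in> Poly_Mapping.keys (mat F i k l * v l)"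
    using keys_sum[of "\<lambda>l. mat F i k l * v l" "{..<rnk F (Suc i)}"] by blast
  then obtain a b where "m = a + b" "b \<in> Poly_Mapping.keys (v l)"
    using keys_mult[of "mat F i k l" "v l"] by blast
  then show ?thesis using assms(1)[of l] by (intro bexI[of _ b] exI[of _ a]) (auto simp: add.commute)
qed

text \<open>Says that \<open>x\<close> is a free variable: the module is the polynomial extension of
  its part without \<open>x\<close>, and \<open>x\<close> is a nonzerodivisor on it.\<close>

definition cyl :: "'n \<Rightarrow> ('n \<Rightarrow>\<^sub>0 nat) set \<Rightarrow> bool" where
  "cyl x D \<longleftrightarrow> (\<forall>a n. a + Poly_Mapping.single x n \<in> D \<longleftrightarrow> a \<in> D)"

lemma mdeg_single: "mdeg (Poly_Mapping.single x n) = n"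
  by (simp add: mdeg_def lookup_single when_def)

lemma up_in_UNIV_convex: "up_in D UNIV \<Longrightarrow> convex_exp D"
  by (simp add: up_in_def convex_exp_def)

lemma convex_exp_fixed:
  assumes "convex_exp D"
  shows "convex_exp {a \<in> D. \<forall>x\<in>A. Poly_Mapping.lookup a x = g x}"
  unfolding convex_exp_def
proof (intro allI impI)
  fix a b c
  assume H: "a \<in> {a \<in> D. \<forall>x\<in>A. Poly_Mapping.lookup a x = g x} \<and>
    a + b + c \<in> {a \<in> D. \<forall>x\<in>A. Poly_Mapping.lookup a x = g x}"
  then have "a + b \<in> D" using assms unfolding convex_exp_def by (metis (lifting) mem_Collect_eq)
  moreover have "Poly_Mapping.lookup (a + b) x = g x" if "x \<in> A" for x
  proof -
    have "Poly_Mapping.lookup (a + b + c) x = Poly_Mapping.lookup a x" using H that by simp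
    then show ?thesis using H that by (simp add: lookup_add)
  qed
  ultimately show "a + b \<in> {a \<in> D. \<forall>x\<in>A. Poly_Mapping.lookup a x = g x}" by simp
qed

lemma chains_bdry:
  fixes F :: "('n::finite, 'k::field, 'c) free_cx"
  assumes M: "\<And>k l. k < rnk F i \<Longrightarrow> l < rnk F (Suc i) \<Longrightarrow>
      mat F i k l \<in> homog (shift F (Suc i) l - shift F i k)"
    and v: "v \<in> chains homog F (Suc i) j"
  shows "bdry (*) F i v \<in> chains homog F i j"
proof -
  have "mat F i k l * v l \<in> homog (j - shift F i k)"
    if "k < rnk F i" "l < rnk F (Suc i)" for k l
  proof -
    have "v l \<in> homog (j - shift F (Suc i) l)" using v that by (simp add: chains_def)
    then show ?thesis using homog_mult[OF M[OF that], of "v l"] by force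
  qed
  then show ?thesis by (auto simp: chains_def bdry_def intro!: homog_sum)
qed

section \<open>Tor against one fixed resolution of the residue field\<close>

locale resolution =
  fixes F :: "('n::finite, 'k::field, 'k) free_cx"
  assumes res: "graded_free_resolution res_scale res_field F"
begin

lemma
  shows mat_homog: "k < rnk F i \<Longrightarrow> l < rnk F (Suc i) \<Longrightarrow>
      mat F i k l \<in> homog (shift F (Suc i) l - shift F i k)"
    and aug_res: "k < rnk F 0 \<Longrightarrow> aug F k \<in> res_field (shift F 0 k)"
    and cycles_eq: "cycles (*) homog F (Suc i) j = boundaries (*) homog F (Suc i) j"
    and augment_kernel: "{v \<in> chains homog F 0 j. augment res_scale F v = 0} = boundaries (*) homog F 0 j"
    and augment_image: "augment res_scale F ` chains homog F 0 j = res_field j"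
proof -
  note c = res[unfolded graded_free_resolution_def]
  show "k < rnk F i \<Longrightarrow> l < rnk F (Suc i) \<Longrightarrow>
      mat F i k l \<in> homog (shift F (Suc i) l - shift F i k)"
    using c[THEN conjunct1] by simp
  show "k < rnk F 0 \<Longrightarrow> aug F k \<in> res_field (shift F 0 k)"
    using c[THEN conjunct2, THEN conjunct1] by simp
  show "cycles (*) homog F (Suc i) j = boundaries (*) homog F (Suc i) j"
    using c[THEN conjunct2, THEN conjunct2, THEN conjunct1, THEN spec, THEN spec] .
  show "{v \<in> chains homog F 0 j. augment res_scale F v = 0} = boundaries (*) homog F 0 j"
    using c[THEN conjunct2, THEN conjunct2, THEN conjunct2, THEN conjunct1, THEN spec] .
  show "augment res_scale F ` chains homog F 0 j = res_field j"
    using c[THEN conjunct2, THEN conjunct2, THEN conjunct2, THEN conjunct2, THEN spec] .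
qed

lemma bdry_chains: "v \<in> chains homog F (Suc i) j \<Longrightarrow> bdry (*) F i v \<in> chains homog F i j"
  using mat_homog by (rule chains_bdry)

lemma bdry_bdry: 
  assumes "v \<in> chains homog F (Suc (Suc i)) j"
  shows "bdry (*) F i (bdry (*) F (Suc i) v) = 0"
proof -
  have "bdry (*) F (Suc i) v \<in> boundaries (*) homog F (Suc i) j"
    unfolding boundaries_def using assms by (rule imageI)
  then have "bdry (*) F (Suc i) v \<in> cycles (*) homog F (Suc i) j" by (simp only: cycles_eq)
  then show ?thesis by simp
qed

lemma bd_ch: "v \<in> ch F D (Suc i) j \<Longrightarrow> bd F D' i v \<in> ch F D' i j"
proof -
  assume "v \<in> ch F D (Suc i) j"
  then have "v \<in> chains homog F (Suc i) j" by (simp add: ch_def)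
  then show ?thesis unfolding bd_def by (intro ch_rs_chains bdry_chains)
qed

text \<open>Convexity lets the inner truncation be dropped: a monomial of the first boundary outside
  \<open>D\<close> is a multiple of one in \<open>D\<close>, hence has no multiple in
  \<open>D\<close> itself.\<close>

lemma bd_bd:
  assumes "convex_exp D" "v \<in> ch F D (Suc (Suc i)) j"
  shows "bd F D i (bd F D (Suc i) v) = 0"
proof -
  have 1: "rs D (bdry (*) F i (rs D (bdry (*) F (Suc i) v))) = rs D (bdry (*) F i (bdry (*) F (Suc i) v))"
  proof (rule rs_bdry_rs)
    fix k m assume m: "m \<in> Poly_Mapping.keys (bdry (*) F (Suc i) v k)" "m \<notin> D"
    have "\<And>k. Poly_Mapping.keys (v k) \<subseteq> D" using assms(2) by (simp add: ch_def)
    from keys_bdry[OF this m(1)] obtain a c where "a \<in> D" "m = a + c" by blast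
    then show "\<forall>c. m + c \<notin> D" using m(2) assms(1) unfolding convex_exp_def by metis
  qed
  have "v \<in> chains homog F (Suc (Suc i)) j" using assms(2) by (simp add: ch_def)
  from bdry_bdry[OF this] 1 show ?thesis by (simp add: bd_def) (simp add: rs_def fun_eq_iff)
qed

text \<open>Together with \<open>bd_down\<close> this says that inclusion of the submodule and
  truncation to the quotient are chain maps.\<close>

lemma bd_up:
  assumes "up_in D1 D" "v \<in> ch F D1 (Suc i) j"
  shows "bd F D i v = bd F D1 i v"
proof (rule ext)
  fix k
  have "Poly_Mapping.keys (bdry (*) F i v k) \<inter> D = Poly_Mapping.keys (bdry (*) F i v k) \<inter> D1"
  proof -
    have "m \<in> D1" if "m \<in> Poly_Mapping.keys (bdry (*) F i v k)" "m \<in> D" for m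
    proof -
      have "\<And>k. Poly_Mapping.keys (v k) \<subseteq> D1" using assms(2) by (simp add: ch_def)
      from keys_bdry[OF this that(1)] obtain a c where "a \<in> D1" "m = a + c" by blast
      then show ?thesis using assms(1) that(2) by (auto simp: up_in_def)
    qed
    then show ?thesis using assms(1) by (auto simp: up_in_def)
  qed
  then show "bd F D i v k = bd F D1 i v k"
    by (simp add: bd_def rs_def restr_def)
qed

lemma bd_down:
  assumes "up_in D1 D" "v \<in> ch F D (Suc i) j"
  shows "bd F (D - D1) i (rs (D - D1) v) = rs (D - D1) (bd F D i v)"
proof -
  have "rs (D - D1) (bdry (*) F i (rs (D - D1) v)) = rs (D - D1) (bdry (*) F i v)"
  proof (rule rs_bdry_rs)
    fix k m assume "m \<in> Poly_Mapping.keys (v k)" "m \<notin> D - D1"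
    then have "m \<in> D1" using assms(2) by (auto simp: ch_def)
    then show "\<forall>c. m + c \<notin> D - D1" using assms(1) by (auto simp: up_in_def)
  qed
  also have "\<dots> = rs (D - D1) (rs D (bdry (*) F i v))"
    by (simp add: rs_def restr_restr Int_absorb2)
  finally show ?thesis by (simp add: bd_def)
qed

section \<open>The long exact sequence of Tor, piece by piece\<close>

lemma rs_compl_0:
  assumes "v \<in> ch F D i j" "rs (D - D1) v = 0"
  shows "v \<in> ch F D1 i j"
proof -
  have "Poly_Mapping.keys (v k) \<subseteq> D1" for k
  proof -
    have "restr (D - D1) (v k) = 0" using assms(2) by (simp add: rs_def fun_eq_iff)
    then show ?thesis using assms(1) by (auto simp: restr_eq_0 ch_def)
  qed
  with assms(1) show ?thesis by (simp add: ch_def)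
qed

text \<open>Exactness at the middle term: a boundary lifted from the quotient moves a given cycle
  into the submodule.\<close>

lemma vanishing_trans:
  assumes c: "convex_exp D" and u: "up_in D1 D"
    and 1: "vanishing F i j D1" and 2: "vanishing F i j (D - D1)"
  shows "vanishing F i j D"
  unfolding vanishing_def
proof (intro ballI impI)
  fix v assume v: "v \<in> ch F D i j" and cyc: "\<forall>i'. i = Suc i' \<longrightarrow> bd F D i' v = 0"
  let ?D = "D - D1"
  have sub: "D1 \<subseteq> D" using u by (simp add: up_in_def)
  have "rs ?D v \<in> ch F ?D i j" using ch_rs[OF v, of ?D] by (simp add: Int_absorb1)
  moreover have "bd F ?D i' (rs ?D v) = 0" if "i = Suc i'" for i'
    using bd_down[OF u] v cyc that by (simp add: rs_def fun_eq_iff)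
  ultimately obtain w where w: "w \<in> ch F ?D (Suc i) j" "rs ?D v = bd F ?D i w"
    using 2 unfolding vanishing_def by blast
  have wD: "w \<in> ch F D (Suc i) j" using w(1) ch_mono by blast
  let ?v = "v - bd F D i w"
  have vD: "?v \<in> ch F D i j" using v bd_ch[OF wD] ch_diff by blast
  have "rs ?D ?v = 0"
    using w(2) bd_down[OF u wD] rs_id[OF w(1) order_refl] by (simp add: rs_diff)
  then have v1: "?v \<in> ch F D1 i j" using rs_compl_0[OF vD] by blast
  moreover have "bd F D1 i' ?v = 0" if i: "i = Suc i'" for i'
  proof -
    have "bd F D1 i' ?v = bd F D i' ?v" using bd_up[OF u] v1 i by metis
    also have "\<dots> = 0" using cyc i bd_bd[OF c] wD by (simp add: bd_diff)
    finally show ?thesis .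
  qed
  ultimately obtain x where x: "x \<in> ch F D1 (Suc i) j" "?v = bd F D1 i x"
    using 1 unfolding vanishing_def by blast
  have "v = bd F D i (w + x)"
    using x(2) bd_up[OF u x(1)] by (simp add: bd_add algebra_simps)
  moreover have "w + x \<in> ch F D (Suc i) j" using wD x(1) ch_mono[OF sub] ch_add by blast
  ultimately show "v \<in> bd F D i ` ch F D (Suc i) j" by blast
qed

text \<open>Exactness at the quotient: the connecting map lands in the homology of \<open>D1\<close>
  one position lower.\<close>

lemma vanishing_quotient:
  assumes c: "convex_exp D" and u: "up_in D1 D"
    and 1: "vanishing F i j D" and 2: "\<And>i'. i = Suc i' \<Longrightarrow> vanishing F i' j D1"
  shows "vanishing F i j (D - D1)"
  unfolding vanishing_def
proof (intro ballI impI)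
  let ?D = "D - D1"
  fix v assume v: "v \<in> ch F ?D i j" and cyc: "\<forall>i'. i = Suc i' \<longrightarrow> bd F ?D i' v = 0"
  have sub: "D1 \<subseteq> D" using u by (simp add: up_in_def)
  have vD: "v \<in> ch F D i j" using v ch_mono by blast
  have vr: "rs ?D v = v" using rs_id[OF v] by simp
  \<comment> \<open>The chain \<open>x\<close> repairs the lift: the boundary of \<open>v\<close>,
    taken in \<open>D\<close>, is a cycle of \<open>D1\<close> and hence the boundary of some
    \<open>x\<close>. In position 0 nothing needs repair.\<close>
  have "\<exists>x \<in> ch F D1 i j. \<forall>i'. i = Suc i' \<longrightarrow> bd F D i' (v - x) = 0"
  proof (cases i)
    case 0 then show ?thesis using ch_zero by blast
  next
    case (Suc i')
    have "rs ?D (bd F D i' v) = 0" using bd_down[OF u] vD cyc Suc vr by metis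
    then have b1: "bd F D i' v \<in> ch F D1 i' j"
      using rs_compl_0 bd_ch vD Suc by blast
    moreover have "bd F D1 k (bd F D i' v) = 0" if "i' = Suc k" for k
    proof -
      have "bd F D1 k (bd F D i' v) = bd F D k (bd F D i' v)" using bd_up[OF u] b1 that by metis
      then show ?thesis using bd_bd[OF c] vD Suc that by simp
    qed
    ultimately obtain x where "x \<in> ch F D1 i j" "bd F D i' v = bd F D1 i' x"
      using 2[OF Suc] Suc unfolding vanishing_def by blast
    then show ?thesis using bd_up[OF u] Suc by (intro bexI[of _ x]) (auto simp: bd_diff)
  qed
  then obtain x where x: "x \<in> ch F D1 i j" "\<forall>i'. i = Suc i' \<longrightarrow> bd F D i' (v - x) = 0" by blast
  have "v - x \<in> ch F D i j" using vD x(1) ch_mono[OF sub] ch_diff by blast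
  then obtain w where w: "w \<in> ch F D (Suc i) j" "v - x = bd F D i w"
    using 1 x(2) unfolding vanishing_def by blast
  have "rs ?D x = 0" using x(1) by (auto simp: rs_def fun_eq_iff restr_eq_0 ch_def)
  then have "v = rs ?D (v - x)" using vr by (simp add: rs_diff)
  also have "\<dots> = bd F ?D i (rs ?D w)" using w bd_down[OF u w(1)] by simp
  finally show "v \<in> bd F ?D i ` ch F ?D (Suc i) j"
    using ch_rs[OF w(1), of ?D] by (auto simp: Int_absorb1)
qed

text \<open>Exactness at the submodule: the obstruction to moving a bounding chain into
  \<open>D1\<close> is a class of the quotient one position higher.\<close>

lemma vanishing_sub:
  assumes c: "convex_exp D" and u: "up_in D1 D"
    and 1: "vanishing F i j D" and 2: "vanishing F (Suc i) j (D - D1)"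
  shows "vanishing F i j D1"
  unfolding vanishing_def
proof (intro ballI impI)
  let ?D = "D - D1"
  fix v assume v: "v \<in> ch F D1 i j" and cyc: "\<forall>i'. i = Suc i' \<longrightarrow> bd F D1 i' v = 0"
  have sub: "D1 \<subseteq> D" using u by (simp add: up_in_def)
  have vD: "v \<in> ch F D i j" using v ch_mono[OF sub] by blast
  have "bd F D i' v = 0" if "i = Suc i'" for i' using bd_up[OF u] v cyc that by metis
  then obtain w where w: "w \<in> ch F D (Suc i) j" "v = bd F D i w"
    using 1 vD unfolding vanishing_def by blast
  have rv: "rs ?D v = 0" using v by (auto simp: rs_def fun_eq_iff restr_eq_0 ch_def)
  have "rs ?D w \<in> ch F ?D (Suc i) j" using ch_rs[OF w(1), of ?D] by (simp add: Int_absorb1)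
  moreover have "bd F ?D i (rs ?D w) = 0" using bd_down[OF u w(1)] w(2) rv by simp
  ultimately obtain x where x: "x \<in> ch F ?D (Suc (Suc i)) j" "rs ?D w = bd F ?D (Suc i) x"
    using 2 unfolding vanishing_def by blast
  have xD: "x \<in> ch F D (Suc (Suc i)) j" using x(1) ch_mono by blast
  let ?w = "w - bd F D (Suc i) x"
  have wD: "?w \<in> ch F D (Suc i) j" using w(1) bd_ch[OF xD] ch_diff by blast
  have "rs ?D ?w = 0"
    using x(2) bd_down[OF u xD] rs_id[OF x(1) order_refl] by (simp add: rs_diff)
  then have w1: "?w \<in> ch F D1 (Suc i) j" using rs_compl_0[OF wD] by blast
  have "bd F D1 i ?w = bd F D i ?w" using bd_up[OF u w1] by simp
  also have "\<dots> = v" using bd_bd[OF c xD] w(2) by (simp add: bd_diff)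
  finally show "v \<in> bd F D1 i ` ch F D1 (Suc i) j" using w1 by blast
qed

lemma reg_le_trans:
  assumes "convex_exp D" "up_in D1 D" "reg_le F r D1" "reg_le F r (D - D1)"
  shows "reg_le F r D"
  using assms vanishing_trans[OF assms(1,2)] unfolding reg_le_def by simp

text \<open>The connecting map shifts the position but not the degree: position \<open>i - 1\<close>
  with bound \<open>r + 1\<close> covers the same degrees as position \<open>i\<close> with bound
  \<open>r\<close>. In \<open>reg_le_sub\<close> the shift goes the other way.\<close>

lemma reg_le_quotient:
  assumes "convex_exp D" "up_in D1 D" "reg_le F r D" "reg_le F (r + 1) D1"
  shows "reg_le F r (D - D1)"
  unfolding reg_le_def
proof (intro allI impI)
  fix i j assume "int i + r < j"
  with assms(3,4) show "vanishing F i j (D - D1)"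
    unfolding reg_le_def by (intro vanishing_quotient[OF assms(1,2)]) auto
qed

lemma reg_le_sub:
  assumes "convex_exp D" "up_in D1 D" "reg_le F r D" "reg_le F (r - 1) (D - D1)"
  shows "reg_le F r D1"
  unfolding reg_le_def
proof (intro allI impI)
  fix i j assume "int i + r < j"
  with assms(3,4) have "vanishing F i j D" "vanishing F (Suc i) j (D - D1)"
    unfolding reg_le_def by auto
  then show "vanishing F i j D1" by (rule vanishing_sub[OF assms(1,2)])
qed

lemma reg_le_mono: "reg_le F r D \<Longrightarrow> r \<le> r' \<Longrightarrow> reg_le F r' D"
  unfolding reg_le_def by auto

lemma vanishing_empty: "vanishing F i j {}"
proof -
  have "v = 0" if "v \<in> ch F {} i j" for v
    using that by (auto simp: ch_def fun_eq_iff)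
  moreover have "bd F {} i 0 = 0" by (simp add: bd_def rs_def fun_eq_iff restr_def)
  ultimately show ?thesis unfolding vanishing_def by (metis ch_zero imageI)
qed

lemma reg_le_empty: "reg_le F r {}"
  by (simp add: reg_le_def vanishing_empty)

text \<open>The ring is free, so only \<open>Tor_0\<close> in degree 0 survives. The condition is
  phrased through \<open>j - i\<close>, the quantity that is tracked when exponents get
  fixed.\<close>

lemma vanishing_UNIV: "j \<noteq> int i \<Longrightarrow> vanishing F i j UNIV"
proof -
  assume ji: "j \<noteq> int i"
  have rsU: "rs UNIV v = v" for v :: "nat \<Rightarrow> ('n, 'k) mpoly" by (simp add: rs_def restr_id)
  have chU: "ch F UNIV i j = chains homog F i j" for i j by (simp add: ch_def)
  have bdU: "bd F UNIV i v = bdry (*) F i v" for i v by (simp add: bd_def rsU)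
  show ?thesis
  proof (cases i)
    case 0
    have "augment res_scale F v = 0" if "v \<in> chains homog F 0 j" for v
    proof -
      have "augment res_scale F v \<in> res_field j"
        using augment_image that by blast
      then show ?thesis using ji 0 by (simp add: res_field_def)
    qed
    then have "chains homog F 0 j \<subseteq> boundaries (*) homog F 0 j"
      using augment_kernel by blast
    then show ?thesis using 0 by (auto simp: vanishing_def chU bdU boundaries_def)
  next
    case (Suc i')
    have "cycles (*) homog F (Suc i') j \<subseteq> boundaries (*) homog F (Suc i') j"
      using cycles_eq by blast
    then show ?thesis using Suc by (auto simp: vanishing_def chU bdU boundaries_def)
  qed
qed

lemma reg_le_UNIV: "0 \<le> r \<Longrightarrow> reg_le F r UNIV"
  unfolding reg_le_def using vanishing_UNIV by auto

text \<open>Multiplication by the monomial is an isomorphism, up to a shift of degrees, from the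
  module on \<open>D\<close> to the one on its translate.\<close>

lemma vanishing_shift:
  fixes g :: "'n \<Rightarrow>\<^sub>0 nat"
  assumes V: "vanishing F i (j - int (mdeg g)) D"
  shows "vanishing F i j ((+) g ` D)"
  unfolding vanishing_def
proof (intro ballI impI)
  let ?x = "Poly_Mapping.single g (1::'k)" and ?D = "(+) g ` D" and ?j = "j - int (mdeg g)"
  fix v assume v: "v \<in> ch F ?D i j" and cyc: "\<forall>i'. i = Suc i' \<longrightarrow> bd F ?D i' v = 0"
  have rx: "restr ?D (?x * f) = ?x * restr D f" for f
  proof (rule poly_mapping_eqI)
    fix m
    show "Poly_Mapping.lookup (restr ?D (?x * f)) m = Poly_Mapping.lookup (?x * restr D f) m"
    proof (cases "\<exists>c. m = g + c")
      case True then show ?thesis by (auto simp: lookup_monom_mult lookup_restr)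
    next
      case False
      then show ?thesis using keys_monom_mult[of g "restr D f"]
        by (auto simp: in_keys_iff lookup_restr)
    qed
  qed
  have bx: "bd F ?D i (\<lambda>k. ?x * u k) = (\<lambda>k. ?x * bd F D i u k)" for i u
    by (simp add: bd_def bdry_smult rs_def rx)
  have "\<exists>f'. v k = ?x * f' \<and> Poly_Mapping.keys f' \<subseteq> D" for k
  proof -
    have "Poly_Mapping.keys (v k) \<subseteq> ?D" using v by (simp add: ch_def)
    then show ?thesis by (rule monom_divide) blast
  qed
  then obtain u where u: "\<And>k. v k = ?x * u k" "\<And>k. Poly_Mapping.keys (u k) \<subseteq> D" by metis
  then have vu: "v = (\<lambda>k. ?x * u k)" by blast
  have kv: "Poly_Mapping.keys (v k) = (+) g ` Poly_Mapping.keys (u k)" for k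
    by (simp only: u(1) keys_monom_mult)
  have "u k = 0" if "v k = 0" for k using kv[of k] that by (simp flip: keys_eq_empty)
  then have "u \<in> ch F D i ?j"
    using v u(2) by (fastforce simp: ch_def chains_def homog_def kv mdeg_add)
  moreover have "bd F D i' u = 0" if "i = Suc i'" for i'
  proof -
    have "(\<lambda>k. ?x * bd F D i' u k) = 0" using cyc that bx vu by metis
    then have "Poly_Mapping.keys (?x * bd F D i' u k) = {}" for k by (simp add: fun_eq_iff)
    then show ?thesis by (simp add: keys_monom_mult fun_eq_iff)
  qed
  ultimately obtain w where w: "w \<in> ch F D (Suc i) ?j" "u = bd F D i w"
    using V unfolding vanishing_def by blast
  have "(\<lambda>k. ?x * w k) \<in> ch F ?D (Suc i) j"
    using w(1) by (force simp: ch_def chains_def homog_def keys_monom_mult mdeg_add)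
  moreover have "v = bd F ?D i (\<lambda>k. ?x * w k)" using w(2) bx vu by simp
  ultimately show "v \<in> bd F ?D i ` ch F ?D (Suc i) j" by blast
qed

lemma reg_le_shift: "reg_le F r D \<Longrightarrow> reg_le F (r + int (mdeg g)) ((+) g ` D)"
  unfolding reg_le_def by (auto intro!: vanishing_shift)


text \<open>Exponent 0 means reduction modulo the nonzerodivisor \<open>x\<close>: the removed part
  is \<open>x\<close> times \<open>D\<close>, a copy of \<open>D\<close> in degrees raised by
  one.\<close>

lemma cut_0:
  assumes c: "convex_exp D" and cy: "cyl x D"
    and 1: "vanishing F i j D" and 2: "\<And>i'. i = Suc i' \<Longrightarrow> vanishing F i' (j - 1) D"
  shows "vanishing F i j {a \<in> D. Poly_Mapping.lookup a x = 0}"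
proof -
  let ?e = "Poly_Mapping.single x (1::nat)"
  let ?D1 = "(+) ?e ` D"
  have u: "up_in ?D1 D"
    unfolding up_in_def
  proof (intro conjI allI impI)
    show "?D1 \<subseteq> D" using cy by (auto simp: cyl_def add.commute)
  next
    fix a b assume "a \<in> ?D1 \<and> a + b \<in> D"
    then obtain a' where a': "a = ?e + a'" "?e + a' + b \<in> D" by auto
    then have "(a' + b) + ?e \<in> D" by (simp add: ac_simps)
    then have "a' + b \<in> D" using cy by (simp add: cyl_def)
    then show "a + b \<in> ?D1" using a'(1) by (auto simp: add.assoc)
  qed
  have "vanishing F i' j ?D1" if "i = Suc i'" for i'
    using vanishing_shift[of i' j ?e D] 2[OF that] by (simp add: mdeg_single)
  then have "vanishing F i j (D - ?D1)" by (rule vanishing_quotient[OF c u 1])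
  moreover have "D - ?D1 = {a \<in> D. Poly_Mapping.lookup a x = 0}"
  proof -
    have H: "a \<in> ?D1 \<longleftrightarrow> 0 < Poly_Mapping.lookup a x" if "a \<in> D" for a
    proof
      assume "0 < Poly_Mapping.lookup a x"
      then obtain b where b: "a = ?e + b" using single_divides_iff[of a x] by auto
      then have "b + ?e \<in> D" using that by (simp add: add.commute)
      then have "b \<in> D" using cy by (simp add: cyl_def)
      then show "a \<in> ?D1" using b by auto
    qed (auto simp: lookup_add lookup_single)
    have "D - X = {a \<in> D. Poly_Mapping.lookup a x = 0}"
      if "\<And>a. a \<in> D \<Longrightarrow> a \<in> X \<longleftrightarrow> 0 < Poly_Mapping.lookup a x" for X
      using that by auto
    from this[OF H] show ?thesis .
  qed
  ultimately show ?thesis by simp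
qed

section \<open>Fixing the exponents of free variables\<close>

lemma single_shift_image:
  assumes "cyl x D"
  shows "(+) (Poly_Mapping.single x n) ` {a \<in> D. P (Poly_Mapping.lookup a x)} =
    {a \<in> D. n \<le> Poly_Mapping.lookup a x \<and> P (Poly_Mapping.lookup a x - n)}"
proof (intro equalityI subsetI)
  fix a assume a: "a \<in> {a \<in> D. n \<le> Poly_Mapping.lookup a x \<and> P (Poly_Mapping.lookup a x - n)}"
  let ?b = "a - Poly_Mapping.single x n"
  have eq: "a = Poly_Mapping.single x n + ?b"
    using a by (intro poly_mapping_eqI) (auto simp: lookup_add lookup_minus lookup_single when_def)
  then have "?b + Poly_Mapping.single x n \<in> D" using a by (simp add: add.commute)
  then have "?b \<in> D" using assms by (simp add: cyl_def)
  moreover have "P (Poly_Mapping.lookup ?b x)" using a by (simp add: lookup_minus)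
  ultimately have "?b \<in> {a \<in> D. P (Poly_Mapping.lookup a x)}" by simp
  then show "a \<in> (+) (Poly_Mapping.single x n) ` {a \<in> D. P (Poly_Mapping.lookup a x)}"
    using eq by (rule image_eqI[rotated])
next
  fix a assume "a \<in> (+) (Poly_Mapping.single x n) ` {a \<in> D. P (Poly_Mapping.lookup a x)}"
  then obtain b where b: "a = b + Poly_Mapping.single x n" "b \<in> D" "P (Poly_Mapping.lookup b x)"
    by (auto simp: add.commute)
  then show "a \<in> {a \<in> D. n \<le> Poly_Mapping.lookup a x \<and> P (Poly_Mapping.lookup a x - n)}"
    using assms by (simp add: cyl_def lookup_add)
qed

text \<open>A predicate on \<open>j - i\<close> in place of a bound, since cuts are used both for
  upper bounds and for the exact degrees in which a single monomial has homology.\<close>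

definition van_on :: "(int \<Rightarrow> bool) \<Rightarrow> ('n \<Rightarrow>\<^sub>0 nat) set \<Rightarrow> bool" where
  "van_on Q D \<longleftrightarrow> (\<forall>i j. Q (j - int i) \<longrightarrow> vanishing F i j D)"

lemma reg_le_van_on: "reg_le F r D \<longleftrightarrow> van_on (\<lambda>d. r < d) D"
  unfolding reg_le_def van_on_def by (simp add: less_diff_eq add.commute)

lemma van_on_cut:
  assumes c: "convex_exp D" and cy: "cyl x D" and V: "van_on Q D"
  shows "van_on (\<lambda>d. Q (d - int t)) {a \<in> D. Poly_Mapping.lookup a x = t}"
  unfolding van_on_def
proof (intro allI impI)
  fix i j assume Q: "Q (j - int i - int t)"
  have "vanishing F i (j - int t) {a \<in> D. Poly_Mapping.lookup a x = 0}"
  proof (rule cut_0[OF c cy])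
    show "vanishing F i (j - int t) D" using V Q by (simp add: van_on_def algebra_simps)
    show "vanishing F i' (j - int t - 1) D" if "i = Suc i'" for i'
      using V Q that by (simp add: van_on_def algebra_simps)
  qed
  then have "vanishing F i j ((+) (Poly_Mapping.single x t) ` {a \<in> D. Poly_Mapping.lookup a x = 0})"
    by (intro vanishing_shift) (simp add: mdeg_single)
  moreover have "{a \<in> D. t \<le> Poly_Mapping.lookup a x \<and> Poly_Mapping.lookup a x \<le> t} =
    {a \<in> D. Poly_Mapping.lookup a x = t}" by auto
  ultimately show "vanishing F i j {a \<in> D. Poly_Mapping.lookup a x = t}"
    using single_shift_image[OF cy, of t "\<lambda>n. n = 0"] by simp
qed

lemma van_on_cut_set:
  assumes "finite A" "convex_exp D" "\<And>x. x \<in> A \<Longrightarrow> cyl x D" "van_on Q D"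
  shows "van_on (\<lambda>d. Q (d - int (sum g A))) {a \<in> D. \<forall>x\<in>A. Poly_Mapping.lookup a x = g x}"
  using assms(1,3)
proof (induction A)
  case empty
  then show ?case using assms(4) by simp
next
  case (insert y A)
  let ?D = "{a \<in> D. \<forall>x\<in>A. Poly_Mapping.lookup a x = g x}"
  have "convex_exp ?D"
    using assms(2) by (rule convex_exp_fixed)
  moreover have "cyl y ?D"
    using insert.prems[of y] insert.hyps(2) by (auto simp: cyl_def lookup_add lookup_single when_def)
  ultimately have "van_on (\<lambda>d. Q (d - int (g y) - int (sum g A)))
      {a \<in> ?D. Poly_Mapping.lookup a y = g y}"
    using insert by (intro van_on_cut) auto
  moreover have "{a \<in> ?D. Poly_Mapping.lookup a y = g y} =
     {a \<in> D. \<forall>x\<in>insert y A. Poly_Mapping.lookup a x = g x}" by auto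
  ultimately show ?case using insert.hyps by (simp add: algebra_simps)
qed

lemma reg_le_cut_set:
  assumes "finite A" "convex_exp D" "\<And>x. x \<in> A \<Longrightarrow> cyl x D" "reg_le F r D"
  shows "reg_le F (r + int (sum g A)) {a \<in> D. \<forall>x\<in>A. Poly_Mapping.lookup a x = g x}"
  using van_on_cut_set[of A D "\<lambda>d. r < d" g] assms by (simp add: reg_le_van_on less_diff_eq)

text \<open>A single monomial spans a shifted residue field. It arises from the ring by fixing all
  exponents.\<close>

lemma vanishing_point:
  assumes "j \<noteq> int i + int (mdeg a)"
  shows "vanishing F i j {a}"
proof -
  have "van_on (\<lambda>d. d \<noteq> 0) UNIV" by (simp add: van_on_def vanishing_UNIV)
  then have "van_on (\<lambda>d. d - int (sum (Poly_Mapping.lookup a) UNIV) \<noteq> 0)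
      {b \<in> UNIV. \<forall>x\<in>UNIV. Poly_Mapping.lookup b x = Poly_Mapping.lookup a x}"
    by (intro van_on_cut_set) (auto simp: convex_exp_def cyl_def)
  moreover have "{b \<in> UNIV. \<forall>x\<in>UNIV. Poly_Mapping.lookup b x = Poly_Mapping.lookup a x} = {a}"
    by (auto intro: poly_mapping_eqI)
  ultimately show ?thesis using assms by (simp add: van_on_def mdeg_def)
qed

text \<open>Multiplication inside \<open>D\<close> preserves \<open>f\<close>, so the module is the
  direct sum of its classes. Splitting them off one at a time needs only extensions.\<close>

lemma vanishing_classes:
  assumes c: "convex_exp D" and f: "\<And>a b. a \<in> D \<Longrightarrow> a + b \<in> D \<Longrightarrow> f (a + b) = f a"
    and fin: "finite (f ` D)" and r: "\<And>y. vanishing F i j {a \<in> D. f a = y}"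
  shows "vanishing F i j D"
proof -
  have "vanishing F i j {a \<in> D. f a \<in> Y}" if "finite Y" for Y
    using that
  proof (induction Y)
    case empty
    then show ?case by (simp add: vanishing_empty)
  next
    case (insert y Y)
    let ?D = "{a \<in> D. f a \<in> insert y Y}"
    have conv: "convex_exp ?D"
      unfolding convex_exp_def
    proof (intro allI impI)
      fix a b c' assume "a \<in> ?D \<and> a + b + c' \<in> ?D"
      then have ab: "a \<in> D" "f a \<in> insert y Y" "a + b + c' \<in> D" by auto
      then have "a + b \<in> D" using c unfolding convex_exp_def by metis
      then show "a + b \<in> ?D" using f[of a b] ab by auto
    qed
    have up: "up_in {a \<in> D. f a = y} ?D"
      using f by (auto simp: up_in_def)
    have "?D - {a \<in> D. f a = y} = {a \<in> D. f a \<in> Y}" using insert.hyps(2) by auto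
    then show ?case using vanishing_trans[OF conv up r] insert.IH by simp
  qed
  from this[OF fin] have "vanishing F i j {a \<in> D. f a \<in> f ` D}" .
  moreover have "{a \<in> D. f a \<in> f ` D} = D" by auto
  ultimately show ?thesis by (simp only:)
qed

lemma reg_le_classes:
  assumes "convex_exp D" "\<And>a b. a \<in> D \<Longrightarrow> a + b \<in> D \<Longrightarrow> f (a + b) = f a"
    and "finite (f ` D)" "\<And>y. reg_le F r {a \<in> D. f a = y}"
  shows "reg_le F r D"
  unfolding reg_le_def
proof (intro allI impI)
  fix i j assume "int i + r < j"
  then have V: "vanishing F i j {a \<in> D. f a = y}" for y using assms(4)[of y] by (simp add: reg_le_def)
  show "vanishing F i j D"
    by (rule vanishing_classes[where f = f]) (fact assms(1), erule (1) assms(2), fact assms(3), rule V)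
qed

text \<open>The ideal whose slice at \<open>x\<close>-exponent \<open>t\<close> is \<open>J t\<close> is filtered with quotients
  \<open>x\<^sup>t J\<^sub>t / x\<^sup>t J\<^bsub>t-1\<^esub>\<close>; so only those \<open>t\<close> matter at which the slices grow.\<close>

lemma reg_le_slices:
  assumes up: "\<And>t. up_in (J t) UNIV" and cy: "\<And>t. cyl x (J t)"
    and mono: "\<And>t. J t \<subseteq> J (Suc t)" and stat: "\<And>t. N \<le> t \<Longrightarrow> J t = J N"
    and r0: "reg_le F r (J 0)"
    and r: "\<And>t. J t \<noteq> J (Suc t) \<Longrightarrow> reg_le F (r - 1 - int t) (J (Suc t)) \<and> reg_le F (r - int t) (J t)"
  shows "reg_le F r {a. a \<in> J (Poly_Mapping.lookup a x)}"
proof -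
  \<comment> \<open>\<open>U t\<close> freezes the slices at \<open>J t\<close> from exponent
    \<open>t\<close> on. It begins with \<open>J 0\<close> and has become the whole ideal at
    \<open>N\<close>.\<close>
  define U where "U = (\<lambda>t. {a. a \<in> J (min (Poly_Mapping.lookup a x) t)})"
  have jm: "J s \<subseteq> J t" if "s \<le> t" for s t using mono that by (rule lift_Suc_mono_le)
  have Uup: "up_in (U t) UNIV" for t
  proof -
    have "a + b \<in> U t" if "a \<in> U t" for a b
    proof -
      have "a + b \<in> J (min (Poly_Mapping.lookup a x) t)"
        using that up[of "min (Poly_Mapping.lookup a x) t"] by (simp add: U_def up_in_def)
      moreover have "J (min (Poly_Mapping.lookup a x) t) \<subseteq> J (min (Poly_Mapping.lookup (a + b) x) t)"
        by (rule jm) (auto simp: lookup_add)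
      ultimately show ?thesis by (auto simp: U_def)
    qed
    then show ?thesis by (simp add: up_in_def)
  qed
  have "reg_le F r (U t)" for t
  proof (induction t)
    case 0
    then show ?case using r0 by (simp add: U_def)
  next
    case (Suc t)
    have sub: "U t \<subseteq> U (Suc t)" using jm[OF min.mono[OF order_refl le_SucI[OF order_refl]]]
      by (force simp: U_def)
    have cJ: "cyl x (J (Suc t) - J t)" using cy by (simp add: cyl_def)
    have "U (Suc t) - U t = {a \<in> J (Suc t) - J t. Suc t \<le> Poly_Mapping.lookup a x}"
      by (auto simp: U_def min_def not_less_eq_eq split: if_splits)
    also have "\<dots> = (+) (Poly_Mapping.single x (Suc t)) ` (J (Suc t) - J t)"
      using single_shift_image[OF cJ, of "Suc t" "\<lambda>_. True"] by (simp only: simp_thms Collect_mem_eq)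
    finally have eq: "U (Suc t) - U t = (+) (Poly_Mapping.single x (Suc t)) ` (J (Suc t) - J t)" .
    \<comment> \<open>The factor \<open>x\<close> to the power \<open>Suc t\<close> will add
      \<open>Suc t\<close> degrees, so that much is deducted from \<open>r\<close>
      beforehand.\<close>
    have "reg_le F (r - int (Suc t)) (J (Suc t) - J t)"
    proof (cases "J t = J (Suc t)")
      case True
      then show ?thesis by (simp add: reg_le_empty)
    next
      case False
      have "up_in (J t) (J (Suc t))" using up[of t] mono[of t] by (auto simp: up_in_def)
      moreover have "convex_exp (J (Suc t))" using up_in_UNIV_convex[OF up] .
      ultimately show ?thesis using r[OF False]
        by (intro reg_le_quotient) (simp_all add: algebra_simps)
    qed
    from reg_le_shift[OF this, of "Poly_Mapping.single x (Suc t)"]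
    have "reg_le F r (U (Suc t) - U t)" by (simp add: eq mdeg_single)
    moreover have "up_in (U t) (U (Suc t))" using Uup[of t] sub by (auto simp: up_in_def)
    ultimately show ?case using Suc up_in_UNIV_convex[OF Uup] by (intro reg_le_trans[of "U (Suc t)" "U t"])
  qed
  from this[of N] have "reg_le F r (U N)" .
  moreover have "J (min n N) = J n" for n
    using stat[of n] by (cases "N \<le> n") (simp_all add: min_def)
  then have "U N = {a. a \<in> J (Poly_Mapping.lookup a x)}" by (simp add: U_def)
  ultimately show ?thesis by simp
qed

end

section \<open>A finite free resolution of the residue field\<close>

text \<open>The mapping cone of multiplication by \<open>x\<close>: the basis of \<open>F_i\<close>
  comes first, then that of \<open>F_(i-1)\<close> with degrees raised by one. The sign in the lower
  block makes the differential square to zero.\<close>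

definition cone :: "'n \<Rightarrow> ('n, 'k::field, 'c) free_cx \<Rightarrow> ('n, 'k, 'c) free_cx" where
  "cone x F = \<lparr>
     rnk = (\<lambda>i. rnk F i + (case i of 0 \<Rightarrow> 0 | Suc i' \<Rightarrow> rnk F i')),
     shift = (\<lambda>i k. if k < rnk F i then shift F i k
        else case i of 0 \<Rightarrow> 0 | Suc i' \<Rightarrow> shift F i' (k - rnk F i) + 1),
     mat = (\<lambda>i k l.
        if l < rnk F (Suc i) then (if k < rnk F i then mat F i k l else 0)
        else if k < rnk F i then (if k = l - rnk F (Suc i) then var x else 0)
        else case i of 0 \<Rightarrow> 0 | Suc i' \<Rightarrow> - mat F i' (k - rnk F i) (l - rnk F (Suc i))),
     aug = aug F\<rparr>"

definition join :: "('n, 'k, 'c) free_cx \<Rightarrow> nat \<Rightarrow> (nat \<Rightarrow> ('n, 'k::field) mpoly)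
    \<Rightarrow> (nat \<Rightarrow> ('n, 'k) mpoly) \<Rightarrow> nat \<Rightarrow> ('n, 'k) mpoly" where
  "join F i u w = (\<lambda>k. if k < rnk F (Suc i) then u k else w (k - rnk F (Suc i)))"

section \<open>Chains and differential of the mapping cone\<close>

lemma sum_split_add:
  fixes g :: "nat \<Rightarrow> 'a::comm_monoid_add"
  shows "(\<Sum>l<r + r'. g l) = (\<Sum>l<r. g l) + (\<Sum>l<r'. g (r + l))"
  by (induction r') (simp_all add: add.assoc)

lemma join_chains:
  assumes "u \<in> chains homog F (Suc i) j" "w \<in> chains homog F i (j - 1)"
  shows "join F i u w \<in> chains homog (cone x F) (Suc i) j"
  unfolding chains_def
proof (intro CollectI conjI allI impI)
  fix k assume k: "k < rnk (cone x F) (Suc i)"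
  show "join F i u w k \<in> homog (j - shift (cone x F) (Suc i) k)"
  proof (cases "k < rnk F (Suc i)")
    case True
    then show ?thesis using assms(1) by (simp add: chains_def join_def cone_def)
  next
    case False
    then have "w (k - rnk F (Suc i)) \<in> homog (j - 1 - shift F i (k - rnk F (Suc i)))"
      using assms(2) k by (simp add: chains_def cone_def)
    then show ?thesis using False by (simp add: join_def cone_def algebra_simps)
  qed
next
  fix k assume "rnk (cone x F) (Suc i) \<le> k"
  then show "join F i u w k = 0" using assms(2) by (simp add: chains_def join_def cone_def)
qed

lemma join_exists:
  assumes "v \<in> chains homog (cone x F) (Suc i) j"
  obtains u w where "u \<in> chains homog F (Suc i) j" "w \<in> chains homog F i (j - 1)"
    "v = join F i u w"
proof
  let ?r = "rnk F (Suc i)"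
  have 1: "v k \<in> homog (j - shift F (Suc i) k)" if "k < ?r" for k
    using assms that by (auto simp: chains_def cone_def dest!: spec[of _ k])
  have 2: "v (?r + k) \<in> homog (j - 1 - shift F i k)" if "k < rnk F i" for k
    using assms that by (auto simp: chains_def cone_def algebra_simps dest!: spec[of _ "?r + k"])
  have 3: "v k = 0" if "?r + rnk F i \<le> k" for k
    using assms that by (auto simp: chains_def cone_def)
  show "(\<lambda>k. if k < ?r then v k else 0) \<in> chains homog F (Suc i) j"
    using 1 by (simp add: chains_def)
  show "(\<lambda>k. v (?r + k)) \<in> chains homog F i (j - 1)"
    using 2 3 by (simp add: chains_def)
  show "v = join F i (\<lambda>k. if k < ?r then v k else 0) (\<lambda>k. v (?r + k))"
    by (simp add: join_def fun_eq_iff)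
qed

lemma join_inject:
  assumes "u \<in> chains homog F (Suc i) j" "u' \<in> chains homog F (Suc i) j"
    and "join F i u w = join F i u' w'"
  shows "u = u'" "w = w'"
proof -
  show "u = u'"
  proof (rule ext)
    fix k show "u k = u' k"
      using assms(1,2) fun_cong[OF assms(3), of k] 
      by (cases "k < rnk F (Suc i)") (auto simp: join_def chains_def)
  qed
  show "w = w'"
  proof (rule ext)
    fix k show "w k = w' k" using fun_cong[OF assms(3), of "rnk F (Suc i) + k"] by (simp add: join_def)
  qed
qed

lemma bdry_cone_upper:
  assumes "k < rnk F i"
  shows "bdry (*) (cone x F) i (join F i u w) k = bdry (*) F i u k + var x * w k"
proof -
  let ?g = "\<lambda>l. mat (cone x F) i k l * join F i u w l"
  have "bdry (*) (cone x F) i (join F i u w) k = (\<Sum>l<rnk F (Suc i) + rnk F i. ?g l)"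
    using assms by (simp add: bdry_def) (simp add: cone_def)
  also have "\<dots> = (\<Sum>l<rnk F (Suc i). ?g l) + (\<Sum>l<rnk F i. ?g (rnk F (Suc i) + l))"
    by (rule sum_split_add)
  also have "(\<Sum>l<rnk F (Suc i). ?g l) = bdry (*) F i u k"
    using assms by (simp add: bdry_def cone_def join_def)
  also have "(\<Sum>l<rnk F i. ?g (rnk F (Suc i) + l)) = (\<Sum>l<rnk F i. if k = l then var x * w l else 0)"
    using assms by (intro sum.cong) (auto simp: cone_def join_def)
  also have "\<dots> = var x * w k" using assms by simp
  finally show ?thesis .
qed

lemma bdry_cone_lower:
  assumes "k < rnk F i"
  shows "bdry (*) (cone x F) (Suc i) (join F (Suc i) u w) (rnk F (Suc i) + k) = - bdry (*) F i w k"
proof -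
  let ?r = "rnk F (Suc i)" and ?s = "rnk F (Suc (Suc i))"
  let ?g = "\<lambda>l. mat (cone x F) (Suc i) (?r + k) l * join F (Suc i) u w l"
  have "bdry (*) (cone x F) (Suc i) (join F (Suc i) u w) (?r + k) = (\<Sum>l<?s + ?r. ?g l)"
    using assms by (simp add: bdry_def) (simp add: cone_def)
  also have "\<dots> = (\<Sum>l<?s. ?g l) + (\<Sum>l<?r. ?g (?s + l))"
    by (rule sum_split_add)
  also have "(\<Sum>l<?s. ?g l) = 0" by (simp add: cone_def)
  also have "(\<Sum>l<?r. ?g (?s + l)) = - bdry (*) F i w k"
    using assms by (simp add: bdry_def cone_def join_def sum_negf)
  finally show ?thesis by simp
qed

lemma bdry_cone_0:
  assumes "w \<in> chains homog F 0 j"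
  shows "bdry (*) (cone x F) 0 (join F 0 u w) = bdry (*) F 0 u + (\<lambda>k. var x * w k)"
proof (rule ext)
  fix k
  show "bdry (*) (cone x F) 0 (join F 0 u w) k = (bdry (*) F 0 u + (\<lambda>k. var x * w k)) k"
  proof (cases "k < rnk F 0")
    case True
    then show ?thesis by (simp add: bdry_cone_upper)
  next
    case False
    then show ?thesis using assms by (simp add: bdry_def chains_def) (simp add: cone_def)
  qed
qed

lemma bdry_cone_Suc:
  assumes "w \<in> chains homog F (Suc i) j"
  shows "bdry (*) (cone x F) (Suc i) (join F (Suc i) u w) =
    join F i (bdry (*) F (Suc i) u + (\<lambda>k. var x * w k)) (- bdry (*) F i w)"
proof (rule ext)
  fix k
  show "bdry (*) (cone x F) (Suc i) (join F (Suc i) u w) k =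
    join F i (bdry (*) F (Suc i) u + (\<lambda>k. var x * w k)) (- bdry (*) F i w) k"
  proof (cases "k < rnk F (Suc i)")
    case True
    then show ?thesis by (simp add: bdry_cone_upper) (simp add: join_def)
  next
    case False
    then obtain k' where k: "k = rnk F (Suc i) + k'" using le_Suc_ex by (metis not_less)
    show ?thesis
    proof (cases "k' < rnk F i")
      case True
      then show ?thesis unfolding k bdry_cone_lower[OF True] by (simp add: join_def)
    next
      case False
      then show ?thesis unfolding k join_def by (simp add: bdry_def) (simp add: cone_def)
    qed
  qed
qed

text \<open>Says that \<open>F\<close> resolves the quotient by the variables in \<open>A\<close>:
  the last clause identifies the image in \<open>F_0\<close>, a copy of the ring, with the ideal of
  these variables. An augmentation is left out, since its target would change with
  \<open>A\<close>.\<close>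

definition koszul :: "'n::finite set \<Rightarrow> ('n, 'k::field, 'c) free_cx \<Rightarrow> bool" where
  "koszul A F \<longleftrightarrow> rnk F 0 = 1 \<and> shift F 0 0 = 0 \<and>
     (\<forall>i. \<forall>k < rnk F i. \<forall>l < rnk F (Suc i).
        mat F i k l \<in> homog (shift F (Suc i) l - shift F i k)) \<and>
     (\<forall>i j. cycles (*) homog F (Suc i) j = boundaries (*) homog F (Suc i) j) \<and>
     (\<forall>j. boundaries (*) homog F 0 j =
        {v \<in> chains homog F 0 j. \<forall>m \<in> Poly_Mapping.keys (v 0). \<exists>y\<in>A. 0 < Poly_Mapping.lookup m y})"

lemma koszulD:
  assumes "koszul A F"
  shows "rnk F 0 = 1" "shift F 0 0 = 0"
    "\<And>i k l. k < rnk F i \<Longrightarrow> l < rnk F (Suc i) \<Longrightarrow> mat F i k l \<in> homog (shift F (Suc i) l - shift F i k)"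
    "\<And>i j. cycles (*) homog F (Suc i) j = boundaries (*) homog F (Suc i) j"
    "\<And>j. boundaries (*) homog F 0 j =
        {v \<in> chains homog F 0 j. \<forall>m \<in> Poly_Mapping.keys (v 0). \<exists>y\<in>A. 0 < Poly_Mapping.lookup m y}"
  using assms unfolding koszul_def by auto

lemma var_homog: "var x \<in> homog 1"
  by (simp add: var_def homog_def mdeg_single)

lemma chains_add: "u \<in> chains homog F i j \<Longrightarrow> v \<in> chains homog F i j \<Longrightarrow> u + v \<in> chains homog F i j"
  by (simp add: chains_def homog_add)

lemma chains_uminus: "v \<in> chains homog F i j \<Longrightarrow> - v \<in> chains homog F i j"
  by (simp add: chains_def homog_uminus)

lemma chains_var_mult:
  assumes "w \<in> chains homog F i (j - 1)"
  shows "(\<lambda>k. var x * w k) \<in> chains homog F i j"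
  using assms homog_mult[OF var_homog, of "w k" "j - 1 - shift F i k" for k]
  by (fastforce simp: chains_def algebra_simps)

lemma bdry_uminus: "bdry (*) F i (- v) = - bdry (*) F i v"
  using bdry_diff[of F i 0 v] by (simp add: bdry_def fun_eq_iff sum_negf)

lemma keys_var_mult:
  fixes f :: "('n, 'k::field) mpoly"
  shows "Poly_Mapping.keys (var x * f) = (+) (Poly_Mapping.single x 1) ` Poly_Mapping.keys f"
  unfolding var_def by (rule keys_monom_mult)

text \<open>The cone stays exact because \<open>x\<close> is a nonzerodivisor modulo the variables
  in \<open>A\<close>.\<close>

lemma koszul_cone:
  fixes F :: "('n::finite, 'k::field, 'c) free_cx"
  assumes K: "koszul A F" and x: "x \<notin> A"
  shows "koszul (insert x A) (cone x F)"
proof -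
  note k = koszulD[OF K]
  let ?C = "cone x F"
  have bdry_bdry: "bdry (*) F i (bdry (*) F (Suc i) v) = 0" if "v \<in> chains homog F (Suc (Suc i)) j" for i v j
  proof -
    have "bdry (*) F (Suc i) v \<in> boundaries (*) homog F (Suc i) j"
      unfolding boundaries_def using that by (rule imageI)
    then have "bdry (*) F (Suc i) v \<in> cycles (*) homog F (Suc i) j" by (simp only: k(4))
    then show ?thesis by simp
  qed
  have bch: "bdry (*) F i v \<in> chains homog F i j" if "v \<in> chains homog F (Suc i) j" for i v j
    using k(3) that by (rule chains_bdry)
  have mat: "mat ?C i k l \<in> homog (shift ?C (Suc i) l - shift ?C i k)"
    if "k < rnk ?C i" "l < rnk ?C (Suc i)" for i k l
    using that k(3) by (cases i) (auto simp: cone_def var_homog homog_uminus split: if_splits)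
  have exact: "cycles (*) homog ?C (Suc i) j = boundaries (*) homog ?C (Suc i) j" for i j
  proof (intro equalityI subsetI)
    fix v assume v: "v \<in> cycles (*) homog ?C (Suc i) j"
    then have "v \<in> chains homog ?C (Suc i) j" by simp
    then obtain u w where uw: "u \<in> chains homog F (Suc i) j" "w \<in> chains homog F i (j - 1)"
      "v = join F i u w" by (rule join_exists)
    have v0: "bdry (*) ?C i (join F i u w) = 0" using v uw(3) by simp
    \<comment> \<open>The lower part \<open>w\<close> of a cycle bounds: in positive position
      because it is a cycle of \<open>F\<close>, in position 0 because \<open>x\<close> times it
      lies in the ideal of \<open>A\<close> and \<open>x\<close> is not in \<open>A\<close>.\<close>
    have "\<exists>z \<in> chains homog F (Suc i) (j - 1). w = bdry (*) F i z \<and> bdry (*) F i u + (\<lambda>k. var x * w k) = 0"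
    proof (cases i)
      case 0
      have e: "bdry (*) F 0 u + (\<lambda>k. var x * w k) = 0"
        using v0 uw(2) bdry_cone_0 0 by metis
      have "bdry (*) F 0 (- u) \<in> boundaries (*) homog F 0 j"
        unfolding boundaries_def using chains_uminus uw(1) 0 by blast
      then have "bdry (*) F 0 (- u) \<in> {v \<in> chains homog F 0 j. \<forall>m \<in> Poly_Mapping.keys (v 0). \<exists>y\<in>A. 0 < Poly_Mapping.lookup m y}"
        by (simp only: k(5))
      moreover have "bdry (*) F 0 (- u) = (\<lambda>k. var x * w k)"
        unfolding bdry_uminus using e by (rule minus_unique)
      ultimately have ky: "\<forall>m \<in> Poly_Mapping.keys (var x * w 0). \<exists>y\<in>A. 0 < Poly_Mapping.lookup m y"
        by simp
      have "\<exists>y\<in>A. 0 < Poly_Mapping.lookup m y" if m: "m \<in> Poly_Mapping.keys (w 0)" for m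
      proof -
        obtain y where "y \<in> A" "0 < Poly_Mapping.lookup (Poly_Mapping.single x 1 + m) y"
          using ky m unfolding keys_var_mult by blast
        then show ?thesis using x by (intro bexI[of _ y]) (auto simp: lookup_add lookup_single when_def split: if_splits)
      qed
      then have "w \<in> {v \<in> chains homog F 0 (j - 1). \<forall>m \<in> Poly_Mapping.keys (v 0). \<exists>y\<in>A. 0 < Poly_Mapping.lookup m y}"
        using uw(2) 0 by simp
      then have "w \<in> boundaries (*) homog F 0 (j - 1)" by (simp only: k(5))
      then show ?thesis using e 0 unfolding boundaries_def by blast
    next
      case (Suc i')
      have "bdry (*) ?C i (join F i u w) = join F i' (bdry (*) F i u + (\<lambda>k. var x * w k)) (- bdry (*) F i' w)"
        using bdry_cone_Suc uw(2) Suc by metis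
      also have "bdry (*) ?C i (join F i u w) = join F i' 0 0" using v0 by (simp add: join_def fun_eq_iff)
      finally have e: "join F i' 0 0 = join F i' (bdry (*) F i u + (\<lambda>k. var x * w k)) (- bdry (*) F i' w)" .
      have c: "0 \<in> chains homog F (Suc i') j" by (simp add: chains_def)
      have c': "bdry (*) F i u + (\<lambda>k. var x * w k) \<in> chains homog F (Suc i') j"
        using chains_add[OF bch[OF uw(1)] chains_var_mult[OF uw(2)]] Suc by simp
      have e1: "bdry (*) F i u + (\<lambda>k. var x * w k) = 0" using join_inject(1)[OF c c' e] by simp
      have "- bdry (*) F i' w = 0" using join_inject(2)[OF c c' e] by simp
      then have "w \<in> cycles (*) homog F (Suc i') (j - 1)"
        using uw(2) Suc by (simp add: fun_eq_iff)
      then have "w \<in> boundaries (*) homog F (Suc i') (j - 1)" by (simp only: k(4))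
      then show ?thesis using e1 Suc unfolding boundaries_def by blast
    qed
    then obtain z where z: "z \<in> chains homog F (Suc i) (j - 1)" "w = bdry (*) F i z"
      "bdry (*) F i u + (\<lambda>k. var x * w k) = 0" by blast
    \<comment> \<open>Adding \<open>x\<close> times \<open>z\<close> turns the upper part into a
      cycle of \<open>F\<close>; a chain that bounds it, joined with \<open>- z\<close>, bounds
      \<open>v\<close>.\<close>
    let ?y = "u + (\<lambda>k. var x * z k)"
    have "bdry (*) F i ?y = 0"
      using z(2,3) by (simp add: bdry_add bdry_smult)
    then have "?y \<in> cycles (*) homog F (Suc i) j"
      using chains_add[OF uw(1) chains_var_mult[OF z(1)]] by simp
    then have "?y \<in> boundaries (*) homog F (Suc i) j" by (simp only: k(4))
    then obtain u' where u': "u' \<in> chains homog F (Suc (Suc i)) j" "?y = bdry (*) F (Suc i) u'"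
      unfolding boundaries_def by blast
    have "bdry (*) ?C (Suc i) (join F (Suc i) u' (- z)) =
      join F i (bdry (*) F (Suc i) u' + (\<lambda>k. var x * (- z) k)) (- bdry (*) F i (- z))"
      by (rule bdry_cone_Suc[OF chains_uminus[OF z(1)]])
    also have "\<dots> = v"
      using z(2) uw(3) by (simp add: bdry_uminus flip: u'(2)) (simp add: join_def fun_eq_iff)
    finally show "v \<in> boundaries (*) homog ?C (Suc i) j"
      unfolding boundaries_def
      using join_chains[OF u'(1) chains_uminus[OF z(1)]] by (rule image_eqI[OF sym])
  next
    fix v assume "v \<in> boundaries (*) homog ?C (Suc i) j"
    then obtain v' where v': "v' \<in> chains homog ?C (Suc (Suc i)) j" "v = bdry (*) ?C (Suc i) v'"
      unfolding boundaries_def by blast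
    from v'(1) obtain u w where uw: "u \<in> chains homog F (Suc (Suc i)) j" "w \<in> chains homog F (Suc i) (j - 1)"
      "v' = join F (Suc i) u w" by (rule join_exists)
    have v: "v = join F i (bdry (*) F (Suc i) u + (\<lambda>k. var x * w k)) (- bdry (*) F i w)"
      using bdry_cone_Suc[OF uw(2)] v'(2) uw(3) by metis
    have wc: "- bdry (*) F i w \<in> chains homog F i (j - 1)" by (rule chains_uminus[OF bch[OF uw(2)]])
    have vc: "v \<in> chains homog ?C (Suc i) j"
      unfolding v by (rule join_chains[OF chains_add[OF bch[OF uw(1)] chains_var_mult[OF uw(2)]] wc])
    have z0: "bdry (*) F i (bdry (*) F (Suc i) u + (\<lambda>k. var x * w k)) + (\<lambda>k. var x * (- bdry (*) F i w) k) = 0"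
      using bdry_bdry[OF uw(1)] by (simp add: bdry_add bdry_smult) (simp add: fun_eq_iff)
    have "bdry (*) ?C i v = 0"
    proof (cases i)
      case 0
      then show ?thesis using z0 bdry_cone_0[of "- bdry (*) F i w" F "j - 1" x] wc v by metis
    next
      case (Suc i')
      have "bdry (*) F i' (- bdry (*) F i w) = 0"
        using bdry_bdry[of w i'] uw(2) Suc by (simp add: bdry_uminus)
      moreover have "bdry (*) ?C (Suc i') v = join F i' (bdry (*) F i (bdry (*) F (Suc i) u + (\<lambda>k. var x * w k))
         + (\<lambda>k. var x * (- bdry (*) F i w) k)) (- bdry (*) F i' (- bdry (*) F i w))"
        using bdry_cone_Suc[of "- bdry (*) F i w" F i' "j - 1" x] wc Suc v by metis
      ultimately show ?thesis unfolding z0 by (simp add: Suc join_def fun_eq_iff)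
    qed
    then show "v \<in> cycles (*) homog ?C (Suc i) j" using vc by simp
  qed
  have zero: "boundaries (*) homog ?C 0 j =
    {v \<in> chains homog ?C 0 j. \<forall>m \<in> Poly_Mapping.keys (v 0). \<exists>y\<in>insert x A. 0 < Poly_Mapping.lookup m y}" for j
  proof (intro equalityI subsetI)
    fix v assume "v \<in> boundaries (*) homog ?C 0 j"
    then obtain v' where v': "v' \<in> chains homog ?C (Suc 0) j" "v = bdry (*) ?C 0 v'"
      unfolding boundaries_def by blast
    from v'(1) obtain u w where uw: "u \<in> chains homog F (Suc 0) j" "w \<in> chains homog F 0 (j - 1)"
      "v' = join F 0 u w" by (rule join_exists)
    have v: "v = bdry (*) F 0 u + (\<lambda>k. var x * w k)"
      using bdry_cone_0[OF uw(2)] v'(2) uw(3) by metis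
    have "v \<in> chains homog F 0 j"
      unfolding v by (rule chains_add[OF bch[OF uw(1)] chains_var_mult[OF uw(2)]])
    then have c: "v \<in> chains homog ?C 0 j" by (simp add: chains_def cone_def)
    have "bdry (*) F 0 u \<in> boundaries (*) homog F 0 j"
      unfolding boundaries_def using uw(1) by (rule imageI)
    then have b: "\<forall>m \<in> Poly_Mapping.keys (bdry (*) F 0 u 0). \<exists>y\<in>A. 0 < Poly_Mapping.lookup m y"
      by (simp add: k(5))
    have "\<exists>y\<in>insert x A. 0 < Poly_Mapping.lookup m y" if "m \<in> Poly_Mapping.keys (v 0)" for m
    proof -
      have "m \<in> Poly_Mapping.keys (bdry (*) F 0 u 0) \<or> m \<in> Poly_Mapping.keys (var x * w 0)"
        using that keys_add[of "bdry (*) F 0 u 0" "var x * w 0"] unfolding v by auto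
      then show ?thesis
      proof
        assume "m \<in> Poly_Mapping.keys (var x * w 0)"
        then show ?thesis unfolding keys_var_mult by (auto simp: lookup_add lookup_single)
      qed (use b in blast)
    qed
    with c show "v \<in> {v \<in> chains homog ?C 0 j. \<forall>m \<in> Poly_Mapping.keys (v 0). \<exists>y\<in>insert x A. 0 < Poly_Mapping.lookup m y}"
      by blast
  next
    fix v :: "nat \<Rightarrow> ('n, 'k) mpoly" assume "v \<in> {v \<in> chains homog ?C 0 j. \<forall>m \<in> Poly_Mapping.keys (v 0). \<exists>y\<in>insert x A. 0 < Poly_Mapping.lookup m y}"
    then have v: "v \<in> chains homog F 0 j" and
      vk: "\<And>m. m \<in> Poly_Mapping.keys (v 0) \<Longrightarrow> \<exists>y\<in>insert x A. 0 < Poly_Mapping.lookup m y"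
      by (auto simp: chains_def cone_def)
    have v0: "v 0 \<in> homog j" and vs: "\<And>k. k \<noteq> 0 \<Longrightarrow> v k = 0"
      using v k(1,2) by (auto simp: chains_def)
    \<comment> \<open>Monomials divisible by \<open>x\<close> are reached through the new generator
      of the cone, the others already by \<open>F\<close>.\<close>
    define X where "X = {m :: 'n \<Rightarrow>\<^sub>0 nat. 0 < Poly_Mapping.lookup m x}"
    have "Poly_Mapping.keys (restr X (v 0)) \<subseteq> (+) (Poly_Mapping.single x 1) ` UNIV"
    proof
      fix m assume "m \<in> Poly_Mapping.keys (restr X (v 0))"
      then have "0 < Poly_Mapping.lookup m x" by (simp add: keys_restr X_def)
      then show "m \<in> (+) (Poly_Mapping.single x 1) ` UNIV" using single_divides_iff[of m x] by blast
    qed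
    then obtain f where f: "restr X (v 0) = Poly_Mapping.single (Poly_Mapping.single x 1) 1 * f"
      by (rule monom_divide)
    then have f': "restr X (v 0) = var x * f" by (simp add: var_def)
    have "f \<in> homog (j - 1)"
      unfolding homog_def
    proof (intro CollectI ballI)
      fix m assume "m \<in> Poly_Mapping.keys f"
      then have "Poly_Mapping.single x 1 + m \<in> Poly_Mapping.keys (restr X (v 0))"
        unfolding f' keys_var_mult by blast
      then have "int (mdeg (Poly_Mapping.single x 1 + m)) = j"
        using v0 by (simp add: keys_restr homog_def)
      then show "int (mdeg m) = j - 1" by (simp add: mdeg_add mdeg_single)
    qed
    then have w: "(\<lambda>k. if k = 0 then f else 0) \<in> chains homog F 0 (j - 1)"
      using k(1,2) by (simp add: chains_def)
    let ?r = "\<lambda>k. if k = 0 then restr (- X) (v 0) else 0"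
    have "?r \<in> {v \<in> chains homog F 0 j. \<forall>m \<in> Poly_Mapping.keys (v 0). \<exists>y\<in>A. 0 < Poly_Mapping.lookup m y}"
      using k(1,2) v0 vk by (auto simp: chains_def homog_restr keys_restr X_def)
    then have "?r \<in> boundaries (*) homog F 0 j" by (simp only: k(5))
    then obtain u where u: "u \<in> chains homog F (Suc 0) j" "?r = bdry (*) F 0 u"
      unfolding boundaries_def by blast
    have "restr (- X) (v 0) + restr X (v 0) = v 0"
      by (rule poly_mapping_eqI) (simp add: lookup_add lookup_restr)
    then have "v = ?r + (\<lambda>k. var x * (if k = 0 then f else 0))"
      using vs f' by (simp add: fun_eq_iff)
    also have "\<dots> = bdry (*) ?C 0 (join F 0 u (\<lambda>k. if k = 0 then f else 0))"
      unfolding u(2) by (rule bdry_cone_0[OF w, symmetric])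
    finally show "v \<in> boundaries (*) homog ?C 0 j"
      unfolding boundaries_def using join_chains[OF u(1) w] by (rule image_eqI)
  qed
  show ?thesis
    unfolding koszul_def
  proof (intro conjI allI impI)
    show "rnk ?C 0 = 1" "shift ?C 0 0 = 0" using k(1,2) by (simp_all add: cone_def)
  qed (fact mat exact zero)+
qed

lemma koszul_exists: "finite A \<Longrightarrow> \<exists>F :: ('n::finite, 'k::field, 'c) free_cx. koszul A F"
proof (induction A rule: finite_induct)
  case empty
  let ?F = "\<lparr>rnk = (\<lambda>i. if i = 0 then 1 else 0), shift = (\<lambda>i k. 0), mat = (\<lambda>i k l. 0),
    aug = (\<lambda>k. undefined)\<rparr> :: ('n, 'k, 'c) free_cx"
  have "chains homog ?F (Suc i) j = {0 :: nat \<Rightarrow> ('n, 'k) mpoly}" for i j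
    by (auto simp: chains_def fun_eq_iff)
  moreover have "bdry (*) ?F i 0 = (0 :: nat \<Rightarrow> ('n, 'k) mpoly)" for i by (simp add: bdry_def fun_eq_iff)
  moreover have "{v \<in> chains homog ?F 0 j. Poly_Mapping.keys (v 0) = {}} = {0 :: nat \<Rightarrow> ('n, 'k) mpoly}" for j
  proof -
    have "v = 0" if "\<forall>k>0. v k = 0" "v 0 = 0" for v :: "nat \<Rightarrow> ('n, 'k) mpoly"
    proof (rule ext)
      fix k show "v k = 0 k" using that by (cases k) auto
    qed
    then have "{v :: nat \<Rightarrow> ('n, 'k) mpoly. (\<forall>k>0. v k = 0) \<and> v 0 = 0} = {0}"
      by (intro equalityI subsetI; simp)
    moreover have "{v \<in> chains homog ?F 0 j. Poly_Mapping.keys (v 0) = {}} =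
      {v :: nat \<Rightarrow> ('n, 'k) mpoly. (\<forall>k>0. v k = 0) \<and> v 0 = 0}"
      by (intro Collect_cong) (auto simp: chains_def Suc_le_eq)
    ultimately show ?thesis by simp
  qed
  ultimately have "koszul {} ?F"
    by (simp add: koszul_def boundaries_def) auto
  then show ?case by blast
next
  case (insert x A)
  then show ?case using koszul_cone by blast
qed

text \<open>Without this the choice inside \<open>tor_dim\<close> would be unspecified. The Koszul
  complex on all variables is completed by the augmentation that sends its single generator in
  position 0 to 1.\<close>

lemma residue_field_resolution_exists:
  "\<exists>F :: ('n::finite, 'k::field, 'k) free_cx. graded_free_resolution res_scale res_field F"
proof -
  obtain F :: "('n, 'k, 'k) free_cx" where F: "koszul UNIV F" using koszul_exists finite by blast
  note k = koszulD[OF F]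
  let ?F = "F\<lparr>aug := \<lambda>_. 1\<rparr>"
  have ch: "chains M ?F = chains M F" for M by (simp add: chains_def fun_eq_iff)
  have bd: "bdry (*) ?F = bdry (*) F" by (simp add: bdry_def fun_eq_iff)
  have cy: "cycles (*) homog ?F i j = cycles (*) homog F i j" for i j
    by (cases i) (simp_all add: ch bd)
  have bo: "boundaries (*) homog ?F = boundaries (*) homog F"
    by (simp add: boundaries_def fun_eq_iff ch bd)
  have au: "augment res_scale ?F v = Poly_Mapping.lookup (v 0) 0" for v
    by (simp add: augment_def res_scale_def k(1))
  have pos: "(\<exists>y. 0 < Poly_Mapping.lookup m y) \<longleftrightarrow> m \<noteq> 0" for m :: "'n \<Rightarrow>\<^sub>0 nat"
    by (metis lookup_zero neq0_conv poly_mapping_eqI)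
  have ker: "{v \<in> chains homog F 0 j. Poly_Mapping.lookup (v 0) 0 = 0} = boundaries (*) homog F 0 j" for j
    unfolding k(5) by (auto simp: pos in_keys_iff)
  have im: "(\<lambda>v :: nat \<Rightarrow> ('n, 'k) mpoly. Poly_Mapping.lookup (v 0) 0) ` chains homog F 0 j = res_field j" for j
  proof (intro equalityI subsetI)
    fix c :: 'k assume "c \<in> (\<lambda>v :: nat \<Rightarrow> ('n, 'k) mpoly. Poly_Mapping.lookup (v 0) 0) ` chains homog F 0 j"
    then obtain v :: "nat \<Rightarrow> ('n, 'k) mpoly" where v: "v 0 \<in> homog j" "c = Poly_Mapping.lookup (v 0) 0"
    proof -
      obtain v :: "nat \<Rightarrow> ('n, 'k) mpoly" where "c = Poly_Mapping.lookup (v 0) 0" "v \<in> chains homog F 0 j"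
        using \<open>c \<in> _\<close> by (rule imageE)
      then show thesis using that[of v] k(1,2) by (simp add: chains_def)
    qed
    then show "c \<in> res_field j"
      by (auto simp: res_field_def homog_def mdeg_def in_keys_iff dest: bspec[of _ _ 0])
  next
    fix c :: 'k assume c: "c \<in> res_field j"
    have "(const c :: ('n, 'k) mpoly) \<in> homog j"
      using c by (auto simp: const_def homog_def res_field_def mdeg_def split: if_splits)
    then have "(\<lambda>k. if k = 0 then (const c :: ('n, 'k) mpoly) else 0) \<in> chains homog F 0 j"
      using k(1,2) by (simp add: chains_def)
    then show "c \<in> (\<lambda>v :: nat \<Rightarrow> ('n, 'k) mpoly. Poly_Mapping.lookup (v 0) 0) ` chains homog F 0 j"
      by (rule image_eqI[rotated]) (simp add: const_def)
  qed
  have "graded_free_resolution res_scale res_field ?F"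
    unfolding graded_free_resolution_def ch bo au cy
    using k(1,2,3,4) ker im by (auto simp: res_field_def)
  then show ?thesis by blast
qed

section \<open>Nested trees of monomial primes\<close>

definition wt :: "'n set \<Rightarrow> ('n \<Rightarrow>\<^sub>0 nat) \<Rightarrow> nat" where
  "wt A a = (\<Sum>i\<in>A. Poly_Mapping.lookup a i)"

lemma wt_add: "wt A (a + b) = wt A a + wt A b"
  by (simp add: wt_def lookup_add sum.distrib)

lemma wt_mono: "A \<subseteq> B \<Longrightarrow> wt A a \<le> wt (B :: 'n::finite set) a"
  unfolding wt_def by (rule sum_mono2) auto

lemma wt_Un: "A \<inter> B = {} \<Longrightarrow> wt (A \<union> B) a = wt A a + wt (B :: 'n::finite set) a"
  unfolding wt_def by (rule sum.union_disjoint) auto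

lemma wt_insert: "x \<notin> A \<Longrightarrow> wt (insert x A) a = Poly_Mapping.lookup a x + wt (A :: 'n::finite set) a"
  unfolding wt_def by (rule sum.insert) auto

text \<open>The constraint \<open>(F, c)\<close> stands for the power \<open>(x\<^sub>i : i \<in> Z - F)\<^sup>c\<close>.\<close>

definition constr_ideal :: "'n set \<Rightarrow> ('n set \<times> nat) set \<Rightarrow> ('n \<Rightarrow>\<^sub>0 nat) set" where
  "constr_ideal Z T = {a. \<forall>(F, c) \<in> T. c \<le> wt (Z - F) a}"

datatype 'n ctree = Node (vset: "'n set") nat "'n ctree list"

text \<open>The truncation is intended: a single child gives the maximum of \<open>c\<close> and its
  bound, while several children add only their excess over the level that they share.\<close>

fun bound :: "'n ctree \<Rightarrow> nat" where
  "bound (Node y c ts) = c + sum_list (map (\<lambda>t. bound t - c) ts)"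

fun constrs :: "'n ctree \<Rightarrow> ('n set \<times> nat) set" where
  "constrs (Node y c ts) = insert (y, c) (\<Union>t\<in>set ts. constrs t)"

text \<open>The sets \<open>Z - y\<close> grow along each branch, so the primes increase away from
  the root. \<open>p\<close> is the set of the parent, and \<open>UNIV\<close> leaves a root
  unrestricted.\<close>

fun nested :: "'n set \<Rightarrow> 'n set \<Rightarrow> 'n ctree \<Rightarrow> bool" where
  "nested Z p (Node y c ts) \<longleftrightarrow> Z \<inter> y \<subseteq> p \<and> (\<forall>t\<in>set ts. nested Z y t)"

fun lower :: "nat \<Rightarrow> 'n ctree \<Rightarrow> 'n ctree" where
  "lower k (Node y c ts) = Node y (c - k) (map (lower k) ts)"

text \<open>An exponent \<open>k\<close> of \<open>w\<close> contributes \<open>k\<close> to each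
  constraint whose set omits \<open>w\<close>. In a nested tree with \<open>w\<close> in
  \<open>Z\<close>, a set that omits \<open>w\<close> has only such sets below it, so whole subtrees
  are lowered.\<close>

fun slice :: "'n \<Rightarrow> nat \<Rightarrow> 'n ctree \<Rightarrow> 'n ctree" where
  "slice w k (Node y c ts) =
     (if w \<in> y then Node y c (map (slice w k) ts) else lower k (Node y c ts))"

section \<open>Slices of nested trees and their bounds\<close>

lemma nested_constrs: "nested Z p t \<Longrightarrow> (F, c) \<in> constrs t \<Longrightarrow> Z \<inter> F \<subseteq> p"
proof (induction t arbitrary: p)
  case (Node y d ts)
  show ?case
  proof (cases "(F, c) = (y, d)")
    case True
    then show ?thesis using Node.prems(1) by simp
  next
    case False
    then obtain t where "t \<in> set ts" "(F, c) \<in> constrs t" using Node.prems(2) by auto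
    then have "Z \<inter> F \<subseteq> y" using Node by auto
    then show ?thesis using Node.prems(1) by auto
  qed
qed

lemma nested_mono_vars: "nested Z p t \<Longrightarrow> Z' \<subseteq> Z \<Longrightarrow> nested Z' p t"
  by (induction t arbitrary: p) auto

lemma nested_lower: "nested Z p (lower k t) \<longleftrightarrow> nested Z p t"
  by (induction t arbitrary: p) auto

lemma nested_slice: "nested Z p t \<Longrightarrow> nested Z p (slice w k t)"
proof (induction t arbitrary: p)
  case (Node y c ts)
  then show ?case by (auto simp: nested_lower)
qed

lemma constrs_lower: "constrs (lower k t) = (\<lambda>(F, c). (F, c - k)) ` constrs t"
  by (induction t) auto

lemma constrs_slice:
  assumes "nested Z p t" "w \<in> Z"
  shows "constrs (slice w k t) = (\<lambda>(F, c). (F, if w \<in> F then c else c - k)) ` constrs t"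
  using assms(1)
proof (induction t arbitrary: p)
  case (Node y c ts)
  show ?case
  proof (cases "w \<in> y")
    case True
    have "constrs (slice w k t) = (\<lambda>(F, c). (F, if w \<in> F then c else c - k)) ` constrs t"
      if "t \<in> set ts" for t
      using Node.IH[OF that, of y] Node.prems that by simp
    then show ?thesis using True by (simp add: image_UN)
  next
    case False
    have "w \<notin> F" if "(F, d) \<in> constrs (Node y c ts)" for F d
    proof -
      have "nested Z y (Node y c ts)" using Node.prems by simp
      from nested_constrs[OF this that] show ?thesis using False assms(2) by blast
    qed
    then have "(\<lambda>(F, c). (F, if w \<in> F then c else c - k)) ` constrs (Node y c ts) =
      (\<lambda>(F, c). (F, c - k)) ` constrs (Node y c ts)"
      by (intro image_cong) (auto simp del: constrs.simps)
    then show ?thesis using False constrs_lower[of k "Node y c ts"] by simp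
  qed
qed

text \<open>Either no entry exceeds \<open>k\<close> and the left side is 0, or some entry does and
  its own excess over \<open>c\<close> pays for \<open>k - c\<close>.\<close>

lemma sum_list_truncated_diff:
  fixes xs :: "nat list"
  assumes "c \<le> k"
  shows "sum_list (map (\<lambda>x. x - k) xs) \<le> c + sum_list (map (\<lambda>x. x - c) xs) - k"
proof (induction xs)
  case (Cons x xs)
  have "sum_list (map (\<lambda>x. x - k) xs) \<le> sum_list (map (\<lambda>x. x - c) xs)"
    using assms by (intro sum_list_mono) auto
  then show ?case using Cons assms by (cases "x \<le> k") auto
qed simp

lemma bound_lower: "bound (lower k t) \<le> bound t - k"
proof (induction t)
  case (Node y c ts)
  show ?case
  proof (cases "k \<le> c")
    case True
    have "sum_list (map (\<lambda>t. bound (lower k t) - (c - k)) ts) \<le> sum_list (map (\<lambda>t. bound t - c) ts)"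
      using Node True by (intro sum_list_mono) fastforce
    then show ?thesis using True by (simp add: o_def)
  next
    case False
    \<comment> \<open>The lowered root has level 0, so nothing is subtracted from the children any
      more.\<close>
    have "sum_list (map (\<lambda>t. bound (lower k t)) ts) \<le> sum_list (map (\<lambda>t. bound t - k) ts)"
      using Node by (intro sum_list_mono) auto
    also have "\<dots> \<le> c + sum_list (map (\<lambda>t. bound t - c) ts) - k"
      using sum_list_truncated_diff[of c k "map bound ts"] False by (simp add: o_def)
    finally show ?thesis using False by (simp add: o_def)
  qed
qed

lemma bound_slice: "bound (slice w k t) \<le> bound t"
proof (induction t)
  case (Node y c ts)
  show ?case
  proof (cases "w \<in> y")
    case True
    have "sum_list (map (\<lambda>t. bound (slice w k t) - c) ts) \<le> sum_list (map (\<lambda>t. bound t - c) ts)"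
      using Node by (intro sum_list_mono) fastforce
    then show ?thesis using True by (simp add: o_def)
  next
    case False
    then show ?thesis using bound_lower[of k "Node y c ts"] by simp
  qed
qed

lemma child_bound:
  assumes "t \<in> set ts"
  shows "bound t \<le> bound (Node y c ts)"
proof -
  have "bound t - c \<le> sum_list (map (\<lambda>t. bound t - c) ts)"
    using assms by (intro member_le_sum_list) auto
  then show ?thesis by simp
qed

lemma level_le_bound: "(F, c) \<in> constrs t \<Longrightarrow> c \<le> bound t"
proof (induction t)
  case (Node y d ts)
  show ?case
  proof (cases "(F, c) = (y, d)")
    case False
    then obtain t where t: "t \<in> set ts" "(F, c) \<in> constrs t" using Node.prems by auto
    then show ?thesis using Node.IH child_bound[OF t(1), of y d] by fastforce
  qed simp
qed

lemma sum_list_drop: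
  fixes f g :: "'a \<Rightarrow> nat"
  assumes "x \<in> set xs" "f x + k \<le> g x" "\<And>y. y \<in> set xs \<Longrightarrow> f y \<le> g y"
  shows "sum_list (map f xs) + k \<le> sum_list (map g xs)"
  using assms
proof (induction xs)
  case (Cons y xs)
  have m: "sum_list (map f xs) \<le> sum_list (map g xs)"
    using Cons.prems(3) by (intro sum_list_mono) auto
  show ?case
  proof (cases "x = y")
    case True
    then show ?thesis using m Cons.prems(2) by simp
  next
    case False
    then have "sum_list (map f xs) + k \<le> sum_list (map g xs)" using Cons by auto
    then show ?thesis using Cons.prems(3)[of y] by simp
  qed
qed simp

text \<open>If the slices of a tree ideal at \<open>w\<close>-exponents \<open>k\<close> and \<open>k + 1\<close> differ, then some
  constraint is not yet implied by the constraints above it, and lowering that constraint lowers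
  the bound.\<close>

lemma bound_slice_drop:
  fixes t :: "'n::finite ctree"
  assumes "nested Z p t" "w \<in> Z" "Z' = Z - {w}" "k' \<le> Suc k"
    and "a \<in> constr_ideal Z' (constrs (slice w (Suc k) t))"
    and "a \<notin> constr_ideal Z' (constrs (slice w k t))"
  shows "bound (slice w k' t) + k' \<le> bound t \<and> wt (Z' - p) a + k' \<le> bound t"
  using assms(1,5,6)
proof (induction t arbitrary: p)
  case (Node y c ts)
  let ?t = "Node y c ts"
  show ?case
  proof (cases "w \<in> y")
    case False
    have iff: "a \<in> constr_ideal Z' (constrs (slice w l ?t)) \<longleftrightarrow>
        (\<forall>(F, d)\<in>constrs ?t. (if w \<in> F then d else d - l) \<le> wt (Z' - F) a)" for l
      unfolding constr_ideal_def constrs_slice[OF Node.prems(1) assms(2)]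
      by (auto simp del: constrs.simps)
    \<comment> \<open>A constraint that fails at exponent \<open>k\<close> and holds at
      \<open>Suc k\<close> must omit \<open>w\<close>, and its level exceeds the remaining weight by
      exactly enough to be lowered.\<close>
    obtain F d where Fd: "(F, d) \<in> constrs ?t" "wt (Z' - F) a < (if w \<in> F then d else d - k)"
      using Node.prems(3) unfolding iff by (auto simp del: constrs.simps simp: not_le)
    moreover have "(if w \<in> F then d else d - Suc k) \<le> wt (Z' - F) a"
      using Node.prems(2) Fd(1) unfolding iff by blast
    ultimately have d: "wt (Z' - F) a + Suc k \<le> d" by (simp split: if_splits)
    have db: "d \<le> bound ?t" by (rule level_le_bound[OF Fd(1)])
    have "wt (Z' - p) a \<le> wt (Z' - F) a"
      using nested_constrs[OF Node.prems(1) Fd(1)] assms(3) by (intro wt_mono) auto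
    then have "wt (Z' - p) a + k' \<le> bound ?t" using d db assms(4) by simp
    moreover have "bound (slice w k' ?t) \<le> bound ?t - k'"
      using False bound_lower[of k' ?t] by simp
    ultimately show ?thesis by simp
  next
    case True
    have in1: "c \<le> wt (Z' - y) a"
      using Node.prems(2) True by (simp add: constr_ideal_def)
    from Node.prems(3) obtain t where t: "t \<in> set ts" "a \<notin> constr_ideal Z' (constrs (slice w k t))"
      using True in1 by (auto simp: constr_ideal_def)
    have "a \<in> constr_ideal Z' (constrs (slice w (Suc k) t))"
      using Node.prems(2) True t(1) by (auto simp: constr_ideal_def)
    then have IH: "bound (slice w k' t) + k' \<le> bound t" "wt (Z' - y) a + k' \<le> bound t"
      using Node.IH[OF t(1) _ _ t(2), of y] Node.prems(1) t(1) by auto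
    have "sum_list (map (\<lambda>t. bound (slice w k' t) - c) ts) + k' \<le> sum_list (map (\<lambda>t. bound t - c) ts)"
    proof (rule sum_list_drop[OF t(1)])
      \<comment> \<open>Here the second half of the induction hypothesis is needed: it keeps
        \<open>bound t\<close> at least \<open>c + k'\<close>, so that truncation at
        \<open>c\<close> cannot swallow the drop.\<close>
      show "bound (slice w k' t) - c + k' \<le> bound t - c" using IH in1 by simp
    qed (simp add: bound_slice diff_le_mono)
    then have "bound (slice w k' ?t) + k' \<le> bound ?t" using True by (simp add: o_def)
    moreover have "wt (Z' - p) a \<le> wt (Z' - y) a"
      using Node.prems(1) assms(3) by (intro wt_mono) auto
    ultimately show ?thesis using IH(2) child_bound[OF t(1), of y c] by simp
  qed
qed

lemma constr_ideal_up: "up_in (constr_ideal (Z :: 'n::finite set) T) UNIV"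
  by (fastforce simp: up_in_def constr_ideal_def wt_add)

lemma constr_ideal_cyl:
  assumes "x \<notin> Z"
  shows "cyl x (constr_ideal (Z :: 'n::finite set) T)"
proof -
  have "wt (Z - F) (Poly_Mapping.single x n) = 0" for F n
    using assms by (auto simp: wt_def lookup_single when_def)
  then show ?thesis by (simp add: cyl_def constr_ideal_def wt_add)
qed

text \<open>Induction on the variables, slicing at one of them. Where the slices grow, some tree
  loses as much of its bound as the exponent adds in degree; where they do not grow, nothing has to
  be paid.\<close>

lemma (in resolution) reg_le_forest:
  assumes "\<And>t. t \<in> set ts \<Longrightarrow> nested Z UNIV t"
  shows "reg_le F (int (sum_list (map bound ts))) (constr_ideal Z (\<Union>t\<in>set ts. constrs t))"
  using finite[of Z] assms
proof (induction Z arbitrary: ts rule: finite_induct)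
  case empty
  have "constr_ideal {} (\<Union>t\<in>set ts. constrs t) = UNIV \<or> constr_ideal {} (\<Union>t\<in>set ts. constrs t) = {}"
    by (auto simp: constr_ideal_def wt_def)
  then show ?case by (auto simp: reg_le_UNIV reg_le_empty)
next
  case (insert w Z)
  define J where "J k = constr_ideal Z (\<Union>t\<in>set (map (slice w k) ts). constrs t)" for k
  have J: "a \<in> J k \<longleftrightarrow> (\<forall>t\<in>set ts. a \<in> constr_ideal Z (constrs (slice w k t)))" for a k
    by (auto simp: J_def constr_ideal_def)
  have J2: "a \<in> J k \<longleftrightarrow> (\<forall>t\<in>set ts. \<forall>(F, c)\<in>constrs t. c \<le> wt (Z - F) a + (if w \<in> F then 0 else k))"
    for a k
  proof -
    have "a \<in> constr_ideal Z (constrs (slice w k t)) \<longleftrightarrow>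
       (\<forall>(F, c)\<in>constrs t. c \<le> wt (Z - F) a + (if w \<in> F then 0 else k))" if "t \<in> set ts" for t
      unfolding constr_ideal_def constrs_slice[OF insert.prems[OF that] insertI1]
      by (auto simp: le_diff_conv split: if_splits)
    then show ?thesis by (simp add: J)
  qed
  let ?B = "sum_list (map bound ts)"
  have nest: "nested Z UNIV (slice w k t)" if "t \<in> set ts" for k t
    using nested_slice[OF nested_mono_vars[OF insert.prems[OF that]]] by blast
  have regJ: "reg_le F (int (sum_list (map (\<lambda>t. bound (slice w k t)) ts))) (J k)" for k
  proof -
    have "reg_le F (int (sum_list (map bound (map (slice w k) ts)))) (J k)"
      unfolding J_def by (rule insert.IH) (use nest in auto)
    then show ?thesis by (simp add: J_def o_def)
  qed
  have mono: "J k \<subseteq> J (Suc k)" for k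
    unfolding subset_iff J2 by (force split: if_splits)
  have stat: "J k = J ?B" if "?B \<le> k" for k
  proof -
    have "c \<le> ?B" if "t \<in> set ts" "(F, c) \<in> constrs t" for t F c
      using level_le_bound[OF that(2)] member_le_sum_list[of "bound t" "map bound ts"] that(1) by simp
    then have "c \<le> wt (Z - F) a + (if w \<in> F then 0 else k) \<longleftrightarrow>
        c \<le> wt (Z - F) a + (if w \<in> F then 0 else ?B)"
      if "t \<in> set ts" "(F, c) \<in> constrs t" for t F c a
      using that \<open>?B \<le> k\<close> by fastforce
    then have "a \<in> J k \<longleftrightarrow> a \<in> J ?B" for a
      unfolding J2 by (intro ball_cong refl) auto
    then show ?thesis by blast
  qed
  \<comment> \<open>Both \<open>k' = k\<close> and \<open>k' = Suc k\<close> occur, one for each of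
    the two slices in the quotient.\<close>
  have drop: "sum_list (map (\<lambda>t. bound (slice w k' t)) ts) + k' \<le> ?B"
    if "J k \<noteq> J (Suc k)" "k' \<le> Suc k" for k k'
  proof -
    obtain a where a: "a \<in> J (Suc k)" "a \<notin> J k" using mono[of k] \<open>J k \<noteq> J (Suc k)\<close> by auto
    then obtain t where t: "t \<in> set ts" "a \<notin> constr_ideal Z (constrs (slice w k t))"
      "a \<in> constr_ideal Z (constrs (slice w (Suc k) t))" unfolding J by blast
    have "bound (slice w k' t) + k' \<le> bound t"
      using bound_slice_drop[OF insert.prems[OF t(1)] insertI1 _ \<open>k' \<le> Suc k\<close> t(3,2)] insert.hyps(2) by auto
    then show ?thesis using t(1) by (intro sum_list_drop) (auto simp: bound_slice)
  qed
  have "reg_le F (int ?B) {a. a \<in> J (Poly_Mapping.lookup a w)}"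
  proof (rule reg_le_slices)
    show "up_in (J k) UNIV" for k unfolding J_def by (rule constr_ideal_up)
    show "cyl w (J k)" for k unfolding J_def by (rule constr_ideal_cyl) (fact insert.hyps)
    show "J k \<subseteq> J (Suc k)" for k by (rule mono)
    show "J k = J ?B" if "?B \<le> k" for k using that by (rule stat)
    show "reg_le F (int ?B) (J 0)"
      by (rule reg_le_mono[OF regJ]) (simp add: bound_slice sum_list_mono)
    fix k assume k: "J k \<noteq> J (Suc k)"
    have "reg_le F (int ?B - 1 - int k) (J (Suc k))"
      by (rule reg_le_mono[OF regJ]) (use drop[OF k, of "Suc k"] in linarith)
    moreover have "reg_le F (int ?B - int k) (J k)"
      by (rule reg_le_mono[OF regJ]) (use drop[OF k, of k] in linarith)
    ultimately show "reg_le F (int ?B - 1 - int k) (J (Suc k)) \<and> reg_le F (int ?B - int k) (J k)" ..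
  qed
  moreover have "{a. a \<in> J (Poly_Mapping.lookup a w)} = constr_ideal (insert w Z) (\<Union>t\<in>set ts. constrs t)"
  proof -
    have "wt (insert w Z - F) a = wt (Z - F) a + (if w \<in> F then 0 else Poly_Mapping.lookup a w)" for F a
      using insert.hyps(2) by (simp add: insert_Diff_if wt_insert)
    then show ?thesis by (simp add: J2 constr_ideal_def)
  qed
  ultimately show ?case by simp
qed

section \<open>Chordal graphs\<close>

definition clique :: "'n set set \<Rightarrow> 'n set \<Rightarrow> bool" where
  "clique H F \<longleftrightarrow> (\<forall>x\<in>F. \<forall>y\<in>F. x \<noteq> y \<longrightarrow> {x, y} \<in> H)"

lemma clique_subset: "clique H F \<Longrightarrow> F' \<subseteq> F \<Longrightarrow> clique H F'"
  by (auto simp: clique_def)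

text \<open>Take a shortest path inside \<open>C\<close> from \<open>u\<close> to a neighbour of
  \<open>z\<close>. If its end missed a neighbour \<open>x\<close> of \<open>u\<close> in
  \<open>K\<close>, the path from the last neighbour of \<open>x\<close> on, closed up through
  \<open>z\<close> and \<open>x\<close>, would be an induced cycle of length at least 4.\<close>

lemma chordal_common_neighbour:
  fixes H :: "'n set set"
  assumes ch: "chordal H" and simple: "simple_graph H" and K: "clique H K"
    and u: "u \<in> C" "{u, z} \<notin> H" and disj: "C \<inter> K = {}" and z: "z \<in> K"
    and path: "p 0 = u" "\<And>i. i \<le> r \<Longrightarrow> p i \<in> C" "\<And>i. i < r \<Longrightarrow> {p i, p (Suc i)} \<in> H" "{p r, z} \<in> H"
  shows "\<exists>c\<in>C. {c, z} \<in> H \<and> (\<forall>x\<in>K. {u, x} \<in> H \<longrightarrow> {c, x} \<in> H)"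
proof -
  define W where "W p r \<longleftrightarrow> p 0 = u \<and> (\<forall>i\<le>r. p i \<in> C) \<and> (\<forall>i<r. {p i, p (Suc i)} \<in> H) \<and> {p r, z} \<in> H"
    for p :: "nat \<Rightarrow> 'n" and r :: nat
  have "\<exists>r p. W p r" using path by (auto simp: W_def)
  define r where "r = (LEAST r. \<exists>p. W p r)"
  obtain p where W: "W p r"
    using LeastI_ex[OF \<open>\<exists>r p. W p r\<close>] unfolding r_def by blast
  have least: "r \<le> r'" if "W q r'" for q r'
    unfolding r_def using that by (intro Least_le) blast
  have p0: "p 0 = u" and pC: "\<And>i. i \<le> r \<Longrightarrow> p i \<in> C" and pe: "\<And>i. i < r \<Longrightarrow> {p i, p (Suc i)} \<in> H"
    and pz: "{p r, z} \<in> H" using W by (auto simp: W_def)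
  have nz: "{p i, z} \<notin> H" if "i < r" for i
  proof
    assume "{p i, z} \<in> H"
    then have "W p i" using W that by (auto simp: W_def)
    then show False using least that by fastforce
  qed
  have ne: "{p i, p j} \<notin> H" if "Suc i < j" "j \<le> r" for i j
  proof
    assume e: "{p i, p j} \<in> H"
    \<comment> \<open>The path shortened by the chord from \<open>p i\<close> to
      \<open>p j\<close>.\<close>
    define q where "q k = (if k \<le> i then p k else p (k + (j - Suc i)))" for k
    have "W q (r - (j - Suc i))"
      unfolding W_def
    proof (intro conjI allI impI)
      show "q 0 = u" by (simp add: q_def p0)
      show "q k \<in> C" if "k \<le> r - (j - Suc i)" for k
        using that \<open>Suc i < j\<close> \<open>j \<le> r\<close> by (auto simp: q_def intro!: pC)
      show "{q k, q (Suc k)} \<in> H" if k: "k < r - (j - Suc i)" for k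
      proof -
        consider "k < i" | "k = i" | "i < k" by linarith
        then show ?thesis
        proof cases
          case 1 then show ?thesis using pe[of k] \<open>Suc i < j\<close> \<open>j \<le> r\<close> by (simp add: q_def)
        next
          case 2 then show ?thesis using e \<open>Suc i < j\<close> by (simp add: q_def)
        next
          case 3 then show ?thesis using pe[of "k + (j - Suc i)"] k by (simp add: q_def)
        qed
      qed
      show "{q (r - (j - Suc i)), z} \<in> H"
      proof -
        have "\<not> r - (j - Suc i) \<le> i" "r - (j - Suc i) + (j - Suc i) = r"
          using \<open>Suc i < j\<close> \<open>j \<le> r\<close> by auto
        then show ?thesis using pz by (simp add: q_def)
      qed
    qed
    then show False using least that by fastforce
  qed
  have irr: "{c, c} \<notin> H" for c
    using simple by (auto simp: simple_graph_def)
  have inj: "p i \<noteq> p j" if "i < j" "j \<le> r" for i j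
  proof
    assume e: "p i = p j"
    show False
    proof (cases "j = r")
      case True
      then show ?thesis using nz[of i] pz e that by simp
    next
      case False
      then show ?thesis using ne[of i "Suc j"] pe[of j] e that by simp
    qed
  qed
  have "{p r, x} \<in> H" if x: "x \<in> K" "{u, x} \<in> H" for x
  proof (rule ccontr)
    assume nx: "{p r, x} \<notin> H"
    define i where "i = Max {i. i \<le> r \<and> {p i, x} \<in> H}"
    have fin: "finite {i. i \<le> r \<and> {p i, x} \<in> H}" by simp
    have "0 \<in> {i. i \<le> r \<and> {p i, x} \<in> H}" using x p0 by simp
    then have "i \<in> {i. i \<le> r \<and> {p i, x} \<in> H}"
      unfolding i_def using fin by (intro Max_in) auto
    then have i: "i \<le> r" "{p i, x} \<in> H" by auto
    have later: "{p k, x} \<notin> H" if "i < k" "k \<le> r" for k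
      using Max_ge[OF fin, of k] that by (auto simp: i_def[symmetric])
    \<comment> \<open>So the cycle contains at least two vertices of the path besides
      \<open>x\<close> and \<open>z\<close>.\<close>
    have ir: "i < r" using i nx by (cases "i = r") auto
    have xz: "x \<noteq> z" using x u by auto
    define vs where "vs = x # map p [i..<Suc r] @ [z]"
    have len: "length vs = r - i + 3" using ir by (simp add: vs_def)
    have nth0: "vs ! 0 = x" by (simp add: vs_def)
    have nthm: "vs ! Suc k = p (i + k)" if "k \<le> r - i" for k
    proof -
      have "k < Suc r - i" using that ir by simp
      then show ?thesis by (simp add: vs_def nth_append del: upt_Suc)
    qed
    have nthl: "vs ! (r - i + 2) = z" using ir by (simp add: vs_def nth_append Suc_diff_le del: upt_Suc)
    have pK: "p k \<notin> K" if "k \<le> r" for k using pC[OF that] disj by auto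
    have "induced_cycle H vs"
      unfolding induced_cycle_def
    proof (intro conjI allI impI)
      show "3 \<le> length vs" using len by simp
      have "inj_on p {i..<Suc r}"
        by (rule linorder_inj_onI') (use inj in auto)
      then show "distinct vs"
        using xz x(1) z pK by (auto simp: vs_def distinct_map simp del: upt_Suc)
      fix a b assume ab: "a < b \<and> b < length vs"
      show "({vs ! a, vs ! b} \<in> H) = (b = Suc a \<or> a = 0 \<and> Suc b = length vs)"
      proof (cases "b = r - i + 2")
        case bl: True
        show ?thesis
        proof (cases a)
          case 0
          have "{x, z} \<in> H" using K x(1) z xz by (simp add: clique_def)
          then show ?thesis using bl 0 nth0 nthl len by simp
        next
          case (Suc k)
          then have k: "k \<le> r - i" using ab bl by simp
          show ?thesis
          proof (cases "k = r - i")
            case True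
            then show ?thesis using Suc bl nthm[OF k] nthl pz ir by simp
          next
            case False
            then show ?thesis using Suc bl nthm[OF k] nthl nz[of "i + k"] k by simp
          qed
        qed
      next
        case False
        then obtain l where l: "b = Suc l" "l \<le> r - i" using ab len by (cases b) auto
        show ?thesis
        proof (cases a)
          case 0
          have "{x, p (i + l)} \<in> H \<longleftrightarrow> l = 0"
            using i(2) later[of "i + l"] l(2) ir by (cases "l = 0") (auto simp: insert_commute)
          then show ?thesis using 0 l nth0 nthm len False by auto
        next
          case (Suc k)
          then have k: "k < l" using ab l by simp
          have "{p (i + k), p (i + l)} \<in> H \<longleftrightarrow> l = Suc k"
            using pe[of "i + k"] ne[of "i + k" "i + l"] k l(2) ir by (cases "l = Suc k") auto
          then show ?thesis using Suc l k nthm by auto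
        qed
      qed
    qed
    moreover have "4 \<le> length vs" using len ir by simp
    ultimately show False using ch unfolding chordal_def by blast
  qed
  then show ?thesis using pC[of r] pz by auto
qed

text \<open>A decomposition of \<open>V\<close> rooted at \<open>K\<close>. If \<open>V - K\<close>
  is disconnected, it splits along \<open>K\<close>. If it is connected, a vertex \<open>u\<close>
  with the most neighbours in \<open>K\<close> sees every vertex of \<open>K\<close> that has a
  neighbour in \<open>V - K\<close>; so \<open>u\<close> with these neighbours can replace
  \<open>K\<close>, and the rest of \<open>K\<close> is dropped.\<close>

lemma chordal_clique_induct [consumes 4, case_names base split extend]:
  fixes H :: "'n::finite set set"
  assumes ch: "chordal H" and simple: "simple_graph H" and "clique H K" "K \<subseteq> V"
    and base: "\<And>K. clique H K \<Longrightarrow> P K K"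
    and split: "\<And>V1 V2 K. clique H K \<Longrightarrow> V1 \<inter> V2 = K \<Longrightarrow> V1 \<noteq> K \<Longrightarrow>
        (\<And>x y. x \<in> V1 - K \<Longrightarrow> y \<in> V2 - K \<Longrightarrow> {x, y} \<notin> H) \<Longrightarrow> P V1 K \<Longrightarrow> P V2 K \<Longrightarrow> P (V1 \<union> V2) K"
    and extend: "\<And>V K K' u. clique H K \<Longrightarrow> K \<subseteq> V \<Longrightarrow> K' \<subseteq> K \<Longrightarrow> u \<in> V - K \<Longrightarrow>
        clique H (insert u K') \<Longrightarrow> (\<And>x y. x \<in> V - K \<Longrightarrow> y \<in> K - K' \<Longrightarrow> {x, y} \<notin> H) \<Longrightarrow>
        P (V - (K - K')) (insert u K') \<Longrightarrow> P V K"
  shows "P V K"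
  using assms(3,4)
proof (induction "card (V - K)" arbitrary: V K rule: less_induct)
  case less
  show ?case
  proof (cases "V = K")
    case True
    then show ?thesis using base less.prems by simp
  next
    case False
    let ?C = "V - K"
    show ?thesis
    proof (cases "\<exists>C1 C2. C1 \<union> C2 = ?C \<and> C1 \<inter> C2 = {} \<and> C1 \<noteq> {} \<and> C2 \<noteq> {} \<and>
        (\<forall>x\<in>C1. \<forall>y\<in>C2. {x, y} \<notin> H)")
      case True
      then obtain C1 C2 where C: "C1 \<union> C2 = ?C" "C1 \<inter> C2 = {}" "C1 \<noteq> {}" "C2 \<noteq> {}"
        "\<forall>x\<in>C1. \<forall>y\<in>C2. {x, y} \<notin> H" by blast
      have d: "K \<union> C1 - K = C1" "K \<union> C2 - K = C2" using C(1) by auto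
      have "C1 \<subset> ?C" "C2 \<subset> ?C" using C by auto
      then have "card C1 < card ?C" "card C2 < card ?C" by (simp_all add: psubset_card_mono)
      then have PC: "P (K \<union> C1) K" "P (K \<union> C2) K" 
        using less.hyps[of "K \<union> C1" K] less.hyps[of "K \<union> C2" K] less.prems(1) d by auto
      have "P ((K \<union> C1) \<union> (K \<union> C2)) K"
      proof (rule split[OF less.prems(1)])
        show "(K \<union> C1) \<inter> (K \<union> C2) = K" using C(2) by blast
        show "K \<union> C1 \<noteq> K" using C(3) d by blast
        show "{x, y} \<notin> H" if "x \<in> K \<union> C1 - K" "y \<in> K \<union> C2 - K" for x y
          using that C(5) unfolding d by blast
      qed (fact PC)+
      moreover have "(K \<union> C1) \<union> (K \<union> C2) = V" using C(1) less.prems(2) by auto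
      ultimately show ?thesis by simp
    next
      case conn: False
      define N where "N u = {x \<in> K. {u, x} \<in> H}" for u
      have "?C \<noteq> {}" using False less.prems(2) by auto
      then have "Max ((\<lambda>c. card (N c)) ` ?C) \<in> (\<lambda>c. card (N c)) ` ?C" by (intro Max_in) simp_all
      then obtain u where Mu: "Max ((\<lambda>c. card (N c)) ` ?C) = card (N u)" and u: "u \<in> ?C"
        by (rule imageE)
      have umax: "card (N c) \<le> card (N u)" if "c \<in> ?C" for c
        unfolding Mu[symmetric] using that by (intro Max_ge) simp_all
      \<comment> \<open>The component of \<open>u\<close> in \<open>V - K\<close>. It is everything,
        as otherwise the previous case would apply.\<close>
      define R where "R = {c. \<exists>r p. p 0 = u \<and> (\<forall>i\<le>r. p i \<in> ?C) \<and> (\<forall>i<r. {p i, p (Suc i)} \<in> H) \<and> p r = c}"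
      have RC: "R \<subseteq> ?C" by (auto simp: R_def)
      have uR: "u \<in> R" unfolding R_def using u by (intro CollectI exI[of _ 0] exI[of _ "\<lambda>_. u"]) auto
      have closed: "d \<in> R" if c: "c \<in> R" and d: "d \<in> ?C" "{c, d} \<in> H" for c d
      proof -
        obtain r p where p: "p 0 = u" "\<forall>i\<le>r. p i \<in> ?C" "\<forall>i<r. {p i, p (Suc i)} \<in> H" "p r = c"
          using c unfolding R_def by blast
        show ?thesis unfolding R_def
          using p d by (intro CollectI exI[of _ "Suc r"] exI[of _ "p(Suc r := d)"])
            (auto simp: le_Suc_eq less_Suc_eq)
      qed
      have R: "R = ?C"
      proof (rule ccontr)
        assume "R \<noteq> ?C"
        then have "R \<union> (?C - R) = ?C \<and> R \<inter> (?C - R) = {} \<and> R \<noteq> {} \<and> ?C - R \<noteq> {} \<and>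
          (\<forall>x\<in>R. \<forall>y\<in>?C - R. {x, y} \<notin> H)"
          using RC uR closed by blast
        then show False using conn by blast
      qed
      have nb: "{u, z} \<in> H" if z: "z \<in> K" and c: "c \<in> ?C" "{c, z} \<in> H" for z c
      proof (rule ccontr)
        assume uz: "{u, z} \<notin> H"
        obtain r p where p: "p 0 = u" "\<And>i. i \<le> r \<Longrightarrow> p i \<in> ?C" "\<And>i. i < r \<Longrightarrow> {p i, p (Suc i)} \<in> H" "p r = c"
          using c(1) R unfolding R_def by blast
        have "\<exists>c\<in>?C. {c, z} \<in> H \<and> (\<forall>x\<in>K. {u, x} \<in> H \<longrightarrow> {c, x} \<in> H)"
        proof (rule chordal_common_neighbour[OF ch simple less.prems(1) u uz _ z p(1,2,3)])
          show "{p r, z} \<in> H" using p(4) c(2) by simp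
        qed auto
        then obtain c' where c': "c' \<in> ?C" "{c', z} \<in> H" "\<forall>x\<in>K. {u, x} \<in> H \<longrightarrow> {c', x} \<in> H" by blast
        have "N u \<subset> N c'" using c'(2,3) z uz by (auto simp: N_def)
        then have "card (N u) < card (N c')" by (simp add: psubset_card_mono)
        then show False using umax[OF c'(1)] by simp
      qed
      have "P (V - (K - N u)) (insert u (N u))"
      proof (rule less.hyps)
        have "V - (K - N u) - insert u (N u) \<subset> ?C" using u by (auto simp: N_def)
        then show "card (V - (K - N u) - insert u (N u)) < card ?C" by (simp add: psubset_card_mono)
        show "clique H (insert u (N u))"
          using less.prems(1) by (auto simp: clique_def N_def insert_commute)
        show "insert u (N u) \<subseteq> V - (K - N u)" using u less.prems(2) by (auto simp: N_def)
      qed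
      moreover have "clique H (insert u (N u))"
        using less.prems(1) by (auto simp: clique_def N_def insert_commute)
      ultimately show ?thesis
        using u nb by (intro extend[OF less.prems, of "N u" u]) (auto simp: N_def)
    qed
  qed
qed

text \<open>Demanding a vertex outside \<open>K\<close> makes the induction work: its neighbours in
  a part of the decomposition are all its neighbours in the whole.\<close>

lemma simplicial_exists:
  fixes H :: "'n::finite set set"
  assumes "chordal H" "simple_graph H" "clique H K" "K \<subseteq> V"
  shows "V \<noteq> K \<Longrightarrow> \<exists>v\<in>V - K. clique H {x \<in> V. {v, x} \<in> H}"
  using assms
proof (induction V K rule: chordal_clique_induct)
  case (base K)
  then show ?case by simp
next
  case (split V1 V2 K)
  then obtain v where v: "v \<in> V1 - K" "clique H {x \<in> V1. {v, x} \<in> H}" by blast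
  have "{x \<in> V1 \<union> V2. {v, x} \<in> H} = {x \<in> V1. {v, x} \<in> H}"
    using split.hyps(2) split.hyps(4)[OF v(1)] by auto
  then show ?case using v by (intro bexI[of _ v]) auto
next
  case (extend V K K' u)
  have nbr: "{x \<in> V. {v, x} \<in> H} = {x \<in> V - (K - K'). {v, x} \<in> H}" if "v \<in> V - K" for v
    using extend.hyps(6)[OF that] by auto
  show ?case
  proof (cases "V - (K - K') = insert u K'")
    case True
    have "{x \<in> V. {u, x} \<in> H} \<subseteq> insert u K'" unfolding nbr[OF extend.hyps(4)] True by auto
    then show ?thesis using extend.hyps(4,5) clique_subset by blast
  next
    case False
    then obtain v where v: "v \<in> V - (K - K') - insert u K'" "clique H {x \<in> V - (K - K'). {v, x} \<in> H}"
      using extend.IH by blast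
    then have vV: "v \<in> V - K" by auto
    have "clique H {x \<in> V. {v, x} \<in> H}" unfolding nbr[OF vV] by (fact v(2))
    then show ?thesis using vV by blast
  qed
qed

section \<open>Clique trees\<close>

lemma nested_change_vars:
  "nested Z p t \<Longrightarrow> (\<And>F c. (F, c) \<in> constrs t \<Longrightarrow> Z' \<inter> F \<subseteq> Z) \<Longrightarrow> nested Z' p t"
proof (induction t arbitrary: p)
  case (Node y c ts)
  have "Z' \<inter> y \<subseteq> Z" using Node.prems(2)[of y c] by simp
  moreover have "nested Z' y t" if "t \<in> set ts" for t
    using Node.IH[OF that, of y] Node.prems that by auto
  ultimately show ?case using Node.prems(1) by auto
qed

text \<open>The level of \<open>F\<close> is what \<open>s\<close> still demands once the exponents
  \<open>g\<close> outside of \<open>F\<close> are counted. Every clique lies inside a node, so the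
  nodes account for the constraints of all cliques.\<close>

definition clique_tree :: "'n set set \<Rightarrow> 'n set \<Rightarrow> ('n \<Rightarrow>\<^sub>0 nat) \<Rightarrow> nat \<Rightarrow> 'n ctree \<Rightarrow> bool" where
  "clique_tree H V g s t \<longleftrightarrow>
    (\<forall>F c. (F, c) \<in> constrs t \<longrightarrow> clique H F \<and> F \<subseteq> V \<and> c = s - wt (V - F) g) \<and>
    (\<forall>F. clique H F \<and> F \<subseteq> V \<longrightarrow> (\<exists>F' c. (F', c) \<in> constrs t \<and> F \<subseteq> F'))"

lemma clique_treeI:
  assumes "\<And>F c. (F, c) \<in> constrs t \<Longrightarrow> clique H F \<and> F \<subseteq> V \<and> c = s - wt (V - F) g"
    and "\<And>F. clique H F \<Longrightarrow> F \<subseteq> V \<Longrightarrow> \<exists>F' c. (F', c) \<in> constrs t \<and> F \<subseteq> F'"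
  shows "clique_tree H V g s t"
  using assms by (simp add: clique_tree_def)

lemma clique_treeD:
  assumes "clique_tree H V g s t"
  shows "(F, c) \<in> constrs t \<Longrightarrow> clique H F \<and> F \<subseteq> V \<and> c = s - wt (V - F) g"
    and "clique H F \<Longrightarrow> F \<subseteq> V \<Longrightarrow> \<exists>F' c. (F', c) \<in> constrs t \<and> F \<subseteq> F'"
  using assms by (simp_all add: clique_tree_def)

text \<open>At a split each part is built for \<open>s\<close> minus the weight of the other part.
  Then both root levels agree, the trees merge at the root, and the bounds combine to at most
  \<open>s\<close> since the common level counts once. An extension puts \<open>K\<close> above the
  tree of the new clique, and the bound is a maximum.\<close>

lemma clique_tree_exists:
  fixes H :: "'n::finite set set" and g :: "'n \<Rightarrow>\<^sub>0 nat"
  assumes "chordal H" "simple_graph H" "clique H K" "K \<subseteq> V"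
  shows "\<exists>ts. nested K UNIV (Node K (s - wt (V - K) g) ts) \<and> bound (Node K (s - wt (V - K) g) ts) \<le> s \<and>
    clique_tree H V g s (Node K (s - wt (V - K) g) ts)"
  using assms
proof (induction V K arbitrary: s rule: chordal_clique_induct)
  case (base K)
  then show ?case by (intro exI[of _ "[]"]) (auto simp: clique_tree_def wt_def)
next
  case (split V1 V2 K)
  let ?s1 = "s - wt (V2 - K) g" and ?s2 = "s - wt (V1 - K) g" and ?c = "s - wt (V1 \<union> V2 - K) g"
  have wK: "wt (V1 \<union> V2 - K) g = wt (V1 - K) g + wt (V2 - K) g"
    using split.hyps(2) by (subst wt_Un[symmetric]) (auto simp: Un_Diff)
  have w1: "wt (V1 \<union> V2 - F) g = wt (V1 - F) g + wt (V2 - K) g" if "F \<subseteq> V1" for F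
  proof -
    have "V1 \<union> V2 - F = (V1 - F) \<union> (V2 - K)" using that split.hyps(2) by auto
    then show ?thesis using split.hyps(2) by (subst wt_Un[symmetric]) auto
  qed
  have w2: "wt (V1 \<union> V2 - F) g = wt (V2 - F) g + wt (V1 - K) g" if "F \<subseteq> V2" for F
  proof -
    have "V1 \<union> V2 - F = (V2 - F) \<union> (V1 - K)" using that split.hyps(2) by auto
    then show ?thesis using split.hyps(2) by (subst wt_Un[symmetric]) auto
  qed
  have c1: "?s1 - wt (V1 - K) g = ?c" and c2: "?s2 - wt (V2 - K) g = ?c" using wK by simp_all
  obtain ts1 where t1: "nested K UNIV (Node K ?c ts1)" "bound (Node K ?c ts1) \<le> ?s1"
    "clique_tree H V1 g ?s1 (Node K ?c ts1)"
    using split.IH(1)[of ?s1] unfolding c1 by blast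
  obtain ts2 where t2: "nested K UNIV (Node K ?c ts2)" "bound (Node K ?c ts2) \<le> ?s2"
    "clique_tree H V2 g ?s2 (Node K ?c ts2)"
    using split.IH(2)[of ?s2] unfolding c2 by blast
  let ?t = "Node K ?c (ts1 @ ts2)"
  have cons: "constrs ?t = constrs (Node K ?c ts1) \<union> constrs (Node K ?c ts2)" by auto
  have "nested K UNIV ?t" using t1(1) t2(1) by auto
  moreover have "bound ?t \<le> s"
    using t1(2) t2(2) wK by simp
  moreover have "clique H F \<and> F \<subseteq> V1 \<union> V2 \<and> c = s - wt (V1 \<union> V2 - F) g" if "(F, c) \<in> constrs ?t" for F c
    using that unfolding cons
  proof
    assume "(F, c) \<in> constrs (Node K ?c ts1)"
    from clique_treeD(1)[OF t1(3) this] w1[of F] show ?thesis by (auto simp: add.commute)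
  next
    assume "(F, c) \<in> constrs (Node K ?c ts2)"
    from clique_treeD(1)[OF t2(3) this] w2[of F] show ?thesis by (auto simp: add.commute)
  qed
  moreover have "\<exists>F' c. (F', c) \<in> constrs ?t \<and> F \<subseteq> F'" if F: "clique H F" "F \<subseteq> V1 \<union> V2" for F
  proof -
    have "F \<subseteq> V1 \<or> F \<subseteq> V2"
    proof (rule ccontr)
      assume "\<not> ?thesis"
      then obtain x y where xy: "x \<in> F" "x \<notin> V2" "y \<in> F" "y \<notin> V1" by blast
      then have "x \<in> V1 - K" "y \<in> V2 - K" "x \<noteq> y" using F(2) split.hyps(2) by auto
      then show False using split.hyps(4) F(1) xy unfolding clique_def by blast
    qed
    then show ?thesis using clique_treeD(2)[OF t1(3) F(1)] clique_treeD(2)[OF t2(3) F(1)] unfolding cons by blast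
  qed
  ultimately show ?case by (intro exI[of _ "ts1 @ ts2"] conjI[OF _ conjI[OF _ clique_treeI]])
next
  case (extend V K K' u)
  let ?V = "V - (K - K')" and ?K = "insert u K'" and ?s = "s - wt (K - K') g" and ?c = "s - wt (V - K) g"
  obtain t where t: "nested ?K UNIV t" "vset t = ?K" "bound t \<le> ?s"
    "clique_tree H ?V g ?s t"
    using extend.IH[of ?s] by (metis ctree.sel(1))
  have w: "wt (V - F) g = wt (?V - F) g + wt (K - K') g" if "F \<subseteq> ?V" for F
  proof -
    have "V - F = (?V - F) \<union> (K - K')" using that extend.hyps(2) by auto
    then show ?thesis by (subst wt_Un[symmetric]) auto
  qed
  let ?t = "Node K ?c [t]"
  \<comment> \<open>The sets of \<open>t\<close> avoid \<open>K - K'\<close>, so enlarging the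
    variables by this part does not disturb nestedness.\<close>
  have "nested K UNIV t"
  proof (rule nested_change_vars[OF t(1)])
    fix F c assume "(F, c) \<in> constrs t"
    then show "K \<inter> F \<subseteq> ?K" using clique_treeD(1)[OF t(4)] by blast
  qed
  then have "nested K K t" using t(2) extend.hyps(3,4) by (cases t) auto
  then have "nested K UNIV ?t" by simp
  moreover have "bound ?t \<le> s" using t(3) by simp
  moreover have "clique H F \<and> F \<subseteq> V \<and> c = s - wt (V - F) g" if "(F, c) \<in> constrs ?t" for F c
  proof (cases "(F, c) \<in> constrs t")
    case True
    from clique_treeD(1)[OF t(4) this] w[of F] show ?thesis by (auto simp: add.commute)
  next
    case False
    then show ?thesis using that extend.hyps(1,2) by auto
  qed
  moreover have "\<exists>F' c. (F', c) \<in> constrs ?t \<and> F \<subseteq> F'" if F: "clique H F" "F \<subseteq> V" for F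
  proof (cases "F \<subseteq> K")
    case True
    then show ?thesis by auto
  next
    case False
    then obtain x where x: "x \<in> F" "x \<in> V - K" using F(2) by auto
    have "y \<notin> K - K'" if "y \<in> F" for y
    proof
      assume y: "y \<in> K - K'"
      then have "x \<noteq> y" using x(2) by auto
      then have "{x, y} \<in> H" using F(1) x(1) that unfolding clique_def by blast
      then show False using extend.hyps(6)[OF x(2) y] by blast
    qed
    then have "F \<subseteq> ?V" using F(2) by auto
    then show ?thesis using clique_treeD(2)[OF t(4) F(1)] by auto
  qed
  ultimately show ?case by (intro exI[of _ "[t]"] conjI[OF _ conjI[OF _ clique_treeI]])
qed

text \<open>The exponents of the symbolic power for the complement of \<open>H\<close> on
  \<open>V\<close>. Using all cliques gives the same set as the maximal ones and behaves well when
  \<open>V\<close> shrinks.\<close>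

definition clique_ideal :: "'n set set \<Rightarrow> 'n set \<Rightarrow> nat \<Rightarrow> ('n \<Rightarrow>\<^sub>0 nat) set" where
  "clique_ideal H V s = {a. \<forall>F. clique H F \<and> F \<subseteq> V \<longrightarrow> s \<le> wt (V - F) a}"

lemma clique_ideal_up: "up_in (clique_ideal (H :: 'n::finite set set) V s) UNIV"
  by (fastforce simp: up_in_def clique_ideal_def wt_add)

section \<open>Regularity of clique ideals\<close>

context resolution
begin

text \<open>Multiplication inside this layer cannot change exponents outside of \<open>K\<close>, so
  it is a finite direct sum of classes. Each class is an ideal in the variables of \<open>K\<close>,
  shifted by \<open>k\<close>, and a clique tree bounds that ideal by \<open>s\<close>.\<close>

lemma reg_le_level:
  fixes H :: "'n set set"
  assumes "chordal H" "simple_graph H" "clique H K" "K \<subseteq> V"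
  shows "reg_le F (int (s + k)) {a \<in> clique_ideal H V s. wt (V - K) a = k}"
proof -
  let ?D = "{a \<in> clique_ideal H V s. wt (V - K) a = k}"
  let ?f = "\<lambda>a x. if x \<in> V - K then Poly_Mapping.lookup a x else 0"
  have conv: "convex_exp ?D"
    unfolding convex_exp_def
  proof (intro allI impI)
    fix a b c assume "a \<in> ?D \<and> a + b + c \<in> ?D"
    then have "a \<in> clique_ideal H V s" "wt (V - K) a = k" "wt (V - K) (a + b + c) = k" by auto
    then show "a + b \<in> ?D" using clique_ideal_up[of H V s] by (auto simp: up_in_def wt_add)
  qed
  show ?thesis
  proof (rule reg_le_classes[OF conv, where f = ?f])
    fix a b assume "a \<in> ?D" "a + b \<in> ?D"
    then have "wt (V - K) b = 0" by (simp add: wt_add)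
    then have "\<forall>x\<in>V - K. Poly_Mapping.lookup b x = 0" by (simp add: wt_def)
    then show "?f (a + b) = ?f a" by (auto simp: lookup_add)
  next
    have "?f a x \<in> {..k}" if "a \<in> ?D" "x \<in> V - K" for a x
    proof -
      have "Poly_Mapping.lookup a x \<le> wt (V - K) a"
        unfolding wt_def using that(2) by (intro member_le_sum) auto
      then show ?thesis using that by simp
    qed
    then have "?f ` ?D \<subseteq> {f. \<forall>x. (x \<in> V - K \<longrightarrow> f x \<in> {..k}) \<and> (x \<notin> V - K \<longrightarrow> f x = 0)}"
      by auto
    moreover have "finite {f. \<forall>x. (x \<in> V - K \<longrightarrow> f x \<in> {..k}) \<and> (x \<notin> V - K \<longrightarrow> f x = (0::nat))}"
      by (intro finite_set_of_finite_funs) auto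
    ultimately show "finite (?f ` ?D)" by (rule finite_subset)
  next
    fix y
    show "reg_le F (int (s + k)) {a \<in> ?D. ?f a = y}"
    proof (cases "{a \<in> ?D. ?f a = y} = {}")
      case True
      then show ?thesis by (simp only: reg_le_empty)
    next
      case False
      then obtain g where g: "g \<in> ?D" "?f g = y" by blast
      \<comment> \<open>Only the exponents outside of \<open>K\<close> are kept, so that the levels
        of the tree do not depend on the \<open>K\<close>-part of the representative
        \<open>g\<close>.\<close>
      define h where "h = (\<Sum>x\<in>V - K. Poly_Mapping.single x (Poly_Mapping.lookup g x))"
      have h: "Poly_Mapping.lookup h x = ?f g x" for x
        by (simp add: h_def lookup_sum lookup_single when_def)
      obtain ts where t: "nested K UNIV (Node K (s - wt (V - K) h) ts)"
        "bound (Node K (s - wt (V - K) h) ts) \<le> s"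
        "clique_tree H V h s (Node K (s - wt (V - K) h) ts)"
        using clique_tree_exists[OF assms] by blast
      let ?t = "Node K (s - wt (V - K) h) ts"
      let ?I = "constr_ideal K (constrs ?t)"
      have "reg_le F (int (bound ?t)) ?I"
        using reg_le_forest[of "[?t]" K] t(1) by simp
      from reg_le_mono[OF this, of "int s"] have "reg_le F (int s) ?I" using t(2) by simp
      then have "reg_le F (int s + int (sum (Poly_Mapping.lookup g) (V - K)))
          {a \<in> ?I. \<forall>x\<in>V - K. Poly_Mapping.lookup a x = Poly_Mapping.lookup g x}"
        by (intro reg_le_cut_set up_in_UNIV_convex[OF constr_ideal_up] constr_ideal_cyl) auto
      moreover have "sum (Poly_Mapping.lookup g) (V - K) = k" using g(1) by (simp add: wt_def)
      moreover have "{a \<in> ?I. \<forall>x\<in>V - K. Poly_Mapping.lookup a x = Poly_Mapping.lookup g x} = {a \<in> ?D. ?f a = y}"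
      proof (rule set_eqI)
        fix a
        have eqf: "?f a = y \<longleftrightarrow> (\<forall>x\<in>V - K. Poly_Mapping.lookup a x = Poly_Mapping.lookup g x)"
          unfolding g(2)[symmetric] fun_eq_iff by auto
        have "a \<in> ?I \<longleftrightarrow> a \<in> ?D" if eq: "\<forall>x\<in>V - K. Poly_Mapping.lookup a x = Poly_Mapping.lookup g x"
        proof -
          have wk: "wt (V - K) a = k" using g(1) eq by (simp add: wt_def)
          have w: "wt (V - F) a = wt (K - F) a + wt (V - F) h" for F
          proof -
            have "wt (V - F) a = wt ((K - F) \<union> (V - K - F)) a"
              using assms(4) by (intro arg_cong[where f = "\<lambda>A. wt A a"]) auto
            also have "\<dots> = wt (K - F) a + wt (V - K - F) a" by (rule wt_Un) auto
            also have "wt (V - K - F) a = wt (V - K - F) h"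
              unfolding wt_def using eq by (intro sum.cong) (auto simp: h)
            also have "\<dots> = wt (V - F) h"
              unfolding wt_def by (intro sum.mono_neutral_left) (auto simp: h)
            finally show ?thesis .
          qed
          \<comment> \<open>Not every clique is a node, but one contained in a node imposes a weaker
            condition than the node.\<close>
          have "a \<in> ?I \<longleftrightarrow> (\<forall>F. clique H F \<and> F \<subseteq> V \<longrightarrow> s \<le> wt (K - F) a + wt (V - F) h)"
          proof
            assume a: "a \<in> ?I"
            show "\<forall>F. clique H F \<and> F \<subseteq> V \<longrightarrow> s \<le> wt (K - F) a + wt (V - F) h"
            proof (intro allI impI)
              fix F assume "clique H F \<and> F \<subseteq> V"
              then obtain F' c where F': "(F', c) \<in> constrs ?t" "F \<subseteq> F'"
                using clique_treeD(2)[OF t(3)] by blast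
              have "c \<le> wt (K - F') a" using a F'(1) unfolding constr_ideal_def by blast
              moreover have "c = s - wt (V - F') h" using clique_treeD(1)[OF t(3) F'(1)] by blast
              moreover have "wt (K - F') a \<le> wt (K - F) a" "wt (V - F') h \<le> wt (V - F) h"
                using F'(2) by (auto intro!: wt_mono)
              ultimately show "s \<le> wt (K - F) a + wt (V - F) h" by linarith
            qed
          next
            assume a: "\<forall>F. clique H F \<and> F \<subseteq> V \<longrightarrow> s \<le> wt (K - F) a + wt (V - F) h"
            show "a \<in> ?I"
              unfolding constr_ideal_def
            proof (intro CollectI ballI, clarify)
              fix F c assume "(F, c) \<in> constrs ?t"
              from clique_treeD(1)[OF t(3) this] a show "c \<le> wt (K - F) a"
                by (auto simp: le_diff_conv)
            qed
          qed
          then show ?thesis using wk by (simp add: clique_ideal_def w)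
        qed
        then show "a \<in> {a \<in> ?I. \<forall>x\<in>V - K. Poly_Mapping.lookup a x = Poly_Mapping.lookup g x}
          \<longleftrightarrow> a \<in> {a \<in> ?D. ?f a = y}"
          unfolding mem_Collect_eq eqf by blast
      qed
      ultimately show ?thesis by simp
    qed
  qed
qed

text \<open>Since \<open>K\<close> is a clique, weight \<open>s\<close> outside of it is automatic.
  Raising the threshold cuts off the layer of weight \<open>s + k\<close>, of regularity at most
  \<open>2 s + k\<close>, and the submodule gets a bound one higher than that.\<close>

lemma reg_le_inter_clique:
  fixes H :: "'n set set"
  assumes "chordal H" "simple_graph H" "clique H K" "K \<subseteq> V"
    and I: "reg_le F (2 * int s) (clique_ideal H V s)"
  shows "reg_le F (int (2 * s + k)) {a \<in> clique_ideal H V s. s + k \<le> wt (V - K) a}"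
proof (induction k)
  case 0
  have "{a \<in> clique_ideal H V s. s \<le> wt (V - K) a} = clique_ideal H V s"
    using assms(3,4) by (auto simp: clique_ideal_def)
  then show ?case using I by simp
next
  case (Suc k)
  let ?A = "\<lambda>k. {a \<in> clique_ideal H V s. s + k \<le> wt (V - K) a}"
  have up: "up_in (?A k) UNIV" for k
    using clique_ideal_up[of H V s] by (auto simp: up_in_def wt_add intro: trans_le_add1)
  have u: "up_in (?A (Suc k)) (?A k)" using up[of "Suc k"] by (auto simp: up_in_def)
  have r: "reg_le F (int (2 * s + Suc k)) (?A k)" using Suc by (rule reg_le_mono) simp
  have "?A k - ?A (Suc k) = {a \<in> clique_ideal H V s. wt (V - K) a = s + k}" by auto
  then have "reg_le F (int (2 * s + Suc k) - 1) (?A k - ?A (Suc k))"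
    using reg_le_level[OF assms(1-4), of s "s + k"] by (simp add: algebra_simps)
  then show ?case by (rule reg_le_sub[OF up_in_UNIV_convex[OF up] u r])
qed

text \<open>As \<open>v\<close> is simplicial, all cliques through \<open>v\<close> lie in the
  single clique \<open>insert v N\<close>, whose constraint ignores the exponent of
  \<open>v\<close>. For the other cliques this exponent lowers the demand \<open>s\<close>.\<close>

lemma reg_le_clique_ideal:
  fixes H :: "'n set set"
  assumes "chordal H" "simple_graph H"
  shows "reg_le F (2 * int s) (clique_ideal H V s)"
proof (induction "card V" arbitrary: V s rule: less_induct)
  case less
  show ?case
  proof (cases "V = {}")
    case True
    then have "clique_ideal H V s = (if s = 0 then UNIV else {})"
      by (auto simp: clique_ideal_def wt_def clique_def)
    then show ?thesis by (simp add: reg_le_UNIV reg_le_empty)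
  next
    case False
    have "clique H {}" by (simp add: clique_def)
    then obtain v where v: "v \<in> V" "clique H {x \<in> V. {v, x} \<in> H}"
      using simplicial_exists[OF assms, of "{}" V] False by auto
    let ?W = "V - {v}"
    define N where "N = {x \<in> V. {v, x} \<in> H}"
    have vN: "v \<notin> N" using assms(2) by (auto simp: N_def simple_graph_def)
    have N: "clique H N" "N \<subseteq> ?W" using v vN by (auto simp: N_def)
    have vN': "clique H (insert v N)" "insert v N \<subseteq> V"
      using v by (auto simp: clique_def N_def insert_commute)
    have IH: "reg_le F (2 * int s) (clique_ideal H ?W s)" for s
      using v(1) by (intro less card_Diff1_less) auto
    define J where "J t = {a \<in> clique_ideal H ?W (s - t). s \<le> wt (?W - N) a}" for t
    have regJ: "reg_le F (int (s - t + s)) (J t)" if "t \<le> s" for t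
    proof -
      have "s - t + t = s" "2 * (s - t) + t = s - t + s" using that by auto
      then show ?thesis
        using reg_le_inter_clique[OF assms N IH, of "s - t" t] unfolding J_def by metis
    qed
    have wv: "wt (V - F) a = wt (?W - F) a + (if v \<in> F then 0 else Poly_Mapping.lookup a v)" for F a
    proof (cases "v \<in> F")
      case True
      then have "V - F = ?W - F" by auto
      then show ?thesis using True by simp
    next
      case False
      then have "V - F = insert v (?W - F)" using v(1) by auto
      then show ?thesis using False by (simp add: wt_insert)
    qed
    have eq: "clique_ideal H V s = {a. a \<in> J (Poly_Mapping.lookup a v)}"
    proof (intro set_eqI iffI)
      fix a assume a: "a \<in> clique_ideal H V s"
      have "s - Poly_Mapping.lookup a v \<le> wt (?W - F) a" if "clique H F" "F \<subseteq> ?W" for F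
      proof -
        have "s \<le> wt (V - F) a" using a that unfolding clique_ideal_def by blast
        then show ?thesis using that(2) by (auto simp: wv split: if_splits)
      qed
      moreover have "s \<le> wt (?W - N) a"
      proof -
        have "s \<le> wt (V - insert v N) a" using a vN' unfolding clique_ideal_def by blast
        moreover have "V - insert v N = ?W - N" by auto
        ultimately show ?thesis by simp
      qed
      ultimately show "a \<in> {a. a \<in> J (Poly_Mapping.lookup a v)}"
        by (simp add: J_def clique_ideal_def)
    next
      fix a assume "a \<in> {a. a \<in> J (Poly_Mapping.lookup a v)}"
      then have a: "\<And>F. clique H F \<Longrightarrow> F \<subseteq> ?W \<Longrightarrow> s - Poly_Mapping.lookup a v \<le> wt (?W - F) a"
        "s \<le> wt (?W - N) a" by (auto simp: J_def clique_ideal_def)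
      have "s \<le> wt (V - F) a" if F: "clique H F" "F \<subseteq> V" for F
      proof (cases "v \<in> F")
        case True
        then have "F - {v} \<subseteq> N" using F by (auto simp: clique_def N_def)
        then have "wt (?W - N) a \<le> wt (V - F) a" using vN by (intro wt_mono) auto
        then show ?thesis using a(2) by simp
      next
        case False
        then have "F \<subseteq> ?W" using F(2) by auto
        then show ?thesis using a(1)[OF F(1)] False by (simp add: wv le_diff_conv)
      qed
      then show "a \<in> clique_ideal H V s" by (simp add: clique_ideal_def)
    qed
    have "reg_le F (2 * int s) {a. a \<in> J (Poly_Mapping.lookup a v)}"
    proof (rule reg_le_slices[where N = s])
      show "up_in (J t) UNIV" for t
        using clique_ideal_up[of H ?W "s - t"]
        by (auto simp: J_def up_in_def wt_add intro: trans_le_add1)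
      have w0: "wt (?W - F) (Poly_Mapping.single v n) = 0" for F n
        by (auto simp: wt_def lookup_single when_def)
      show "cyl v (J t)" for t
        by (simp add: cyl_def J_def clique_ideal_def wt_add w0)
      show "J t \<subseteq> J (Suc t)" for t
        by (auto simp: J_def clique_ideal_def)
      \<comment> \<open>From exponent \<open>s\<close> on only the constraint of \<open>N\<close> is
        left.\<close>
      show stat: "J t = J s" if "s \<le> t" for t using that by (simp add: J_def)
      show "reg_le F (2 * int s) (J 0)" using regJ[of 0] by simp
      fix t assume "J t \<noteq> J (Suc t)"
      then have t: "Suc t \<le> s" using stat[of t] stat[of "Suc t"] by (cases "Suc t \<le> s") auto
      have "reg_le F (2 * int s - 1 - int t) (J (Suc t))"
        by (rule reg_le_mono[OF regJ[OF t]]) (use t in simp)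
      moreover have "reg_le F (2 * int s - int t) (J t)"
        by (rule reg_le_mono[OF regJ]) (use t in simp_all)
      ultimately show "reg_le F (2 * int s - 1 - int t) (J (Suc t)) \<and> reg_le F (2 * int s - int t) (J t)" ..
    qed
    then show ?thesis by (simp only: eq)
  qed
qed

end

section \<open>Symbolic powers\<close>

text \<open>A monomial of degree at least \<open>Suc s\<close> in the variables of \<open>C\<close>
  contains one of them, and splitting it off leaves degree at least \<open>s\<close>.\<close>

lemma var_ideal_power_iff:
  fixes f :: "('n::finite, 'k::field) mpoly"
  shows "f \<in> ideal_power (ideal_gen (var ` C)) s \<longleftrightarrow> (\<forall>m \<in> Poly_Mapping.keys f. s \<le> wt C m)"
proof (induction s arbitrary: f)
  case 0
  show ?case by simp
next
  case (Suc s)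
  let ?P = "{f * g |f g. f \<in> ideal_gen (var ` C) \<and> g \<in> ideal_power (ideal_gen (var ` C)) s} :: ('n, 'k) mpoly set"
  have "f \<in> ideal_gen ?P \<longleftrightarrow> (\<forall>m \<in> Poly_Mapping.keys f. Suc s \<le> wt C m)"
  proof
    assume "f \<in> ideal_gen ?P"
    then show "\<forall>m \<in> Poly_Mapping.keys f. Suc s \<le> wt C m"
    proof (induction rule: pm.span_induct_alt)
      case base
      show ?case by simp
    next
      case (step c x y)
      then obtain p q where pq: "x = p * q" "p \<in> ideal_gen (var ` C)"
        "q \<in> ideal_power (ideal_gen (var ` C)) s" by blast
      have "Suc s \<le> wt C m" if m: "m \<in> Poly_Mapping.keys (c * x)" for m
      proof -
        obtain a b where ab: "m = a + b" "b \<in> Poly_Mapping.keys (p * q)"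
          using keys_mult[of c x] m pq(1) by blast
        obtain p' q' where b: "b = p' + q'" "p' \<in> Poly_Mapping.keys p" "q' \<in> Poly_Mapping.keys q"
          using keys_mult[of p q] ab(2) by blast
        obtain i where "i \<in> C" "0 < Poly_Mapping.lookup p' i"
          using pq(2) b(2) unfolding var_ideal_iff by blast
        then have "1 \<le> wt C p'"
          using member_le_sum[of i C "Poly_Mapping.lookup p'"] by (simp add: wt_def)
        moreover have "s \<le> wt C q'" using Suc.IH[of q] pq(3) b(3) by blast
        ultimately show ?thesis by (simp add: ab(1) b(1) wt_add)
      qed
      then show ?case using step.IH keys_add[of "c * x" y] by blast
    qed
  next
    assume H: "\<forall>m \<in> Poly_Mapping.keys f. Suc s \<le> wt C m"
    have "(\<Sum>m \<in> Poly_Mapping.keys f. Poly_Mapping.single m (Poly_Mapping.lookup f m)) \<in> ideal_gen ?P"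
    proof (rule pm.span_sum)
      fix m assume m: "m \<in> Poly_Mapping.keys f"
      have "\<exists>i\<in>C. 0 < Poly_Mapping.lookup m i"
      proof (rule ccontr)
        assume "\<not> ?thesis"
        then have "wt C m = 0" by (simp add: wt_def)
        then show False using H m by fastforce
      qed
      then obtain i where i: "i \<in> C" "0 < Poly_Mapping.lookup m i" by blast
      then obtain b where b: "m = Poly_Mapping.single i 1 + b" using single_divides_iff[of m i] by blast
      have "wt C (Poly_Mapping.single i 1) = 1" using i(1) by (simp add: wt_def lookup_single when_def)
      then have "s \<le> wt C b" using H m by (auto simp: b wt_add)
      then have "Poly_Mapping.single b (Poly_Mapping.lookup f m) \<in> ideal_power (ideal_gen (var ` C)) s"
        by (simp add: Suc.IH)
      moreover have "var i \<in> ideal_gen (var ` C :: ('n, 'k) mpoly set)"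
        using i(1) by (intro pm.span_base) blast
      moreover have "Poly_Mapping.single m (Poly_Mapping.lookup f m) =
          var i * Poly_Mapping.single b (Poly_Mapping.lookup f m)"
        by (simp add: var_def mult_single b)
      ultimately show "Poly_Mapping.single m (Poly_Mapping.lookup f m) \<in> ideal_gen ?P"
        by (intro pm.span_base) blast
    qed
    then show "f \<in> ideal_gen ?P" using mpoly_sum_monomials[of f] by simp
  qed
  then show ?case by simp
qed

text \<open>Complements of vertex covers are the independent sets of the graph, that is the cliques
  of the complement. Cliques that are not maximal add nothing, because their complements contain
  minimal covers.\<close>

lemma symbolic_power_iff:
  fixes f :: "('n::finite, 'k::field) mpoly"
  assumes "simple_graph E"
  shows "f \<in> symbolic_power E s \<longleftrightarrow> Poly_Mapping.keys f \<subseteq> clique_ideal (complement_graph E) UNIV s"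
proof -
  have "(\<forall>C. minimal_vertex_cover E C \<longrightarrow> s \<le> wt C m) \<longleftrightarrow> m \<in> clique_ideal (complement_graph E) UNIV s" for m
  proof
    assume H: "\<forall>C. minimal_vertex_cover E C \<longrightarrow> s \<le> wt C m"
    have "s \<le> wt (UNIV - F) m" if F: "clique (complement_graph E) F" for F
    proof -
      have "vertex_cover E (UNIV - F)"
        unfolding vertex_cover_def
      proof
        fix e assume e: "e \<in> E"
        then obtain i j where ij: "e = {i, j}" "i \<noteq> j"
          using assms by (auto simp: simple_graph_def card_2_iff)
        show "e \<inter> (UNIV - F) \<noteq> {}"
        proof
          assume "e \<inter> (UNIV - F) = {}"
          then have "{i, j} \<in> complement_graph E" using F ij by (auto simp: clique_def)
          then show False using e ij by (simp add: complement_graph_def)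
        qed
      qed
      then obtain D where "D \<subseteq> UNIV - F" "minimal_vertex_cover E D"
        using minimal_vertex_cover_exists by blast
      then show ?thesis using H wt_mono[of D "UNIV - F" m] by (meson le_trans)
    qed
    then show "m \<in> clique_ideal (complement_graph E) UNIV s" by (simp add: clique_ideal_def)
  next
    assume H: "m \<in> clique_ideal (complement_graph E) UNIV s"
    show "\<forall>C. minimal_vertex_cover E C \<longrightarrow> s \<le> wt C m"
    proof (intro allI impI)
      fix C assume "minimal_vertex_cover E C"
      then have C: "vertex_cover E C" by (simp add: minimal_vertex_cover_def)
      have "clique (complement_graph E) (UNIV - C)"
        unfolding clique_def complement_graph_def
      proof (intro ballI impI CollectI conjI)
        fix x y assume xy: "x \<in> UNIV - C" "y \<in> UNIV - C" "x \<noteq> y"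
        then show "card {x, y} = 2" by simp
        show "{x, y} \<notin> E" using C xy by (auto simp: vertex_cover_def)
      qed
      then have "s \<le> wt (UNIV - (UNIV - C)) m" using H by (simp add: clique_ideal_def)
      then show "s \<le> wt C m" by (simp add: double_diff)
    qed
  qed
  then show ?thesis
    unfolding symbolic_power_def INT_iff var_ideal_power_iff by blast
qed

lemma simple_complement_graph: "simple_graph (complement_graph E)"
  by (simp add: simple_graph_def complement_graph_def)

section \<open>Dimension counts\<close>

lemma finite_mdeg_le: "finite {a :: 'n::finite \<Rightarrow>\<^sub>0 nat. mdeg a \<le> N}"
proof (rule finite_imageD)
  have "Poly_Mapping.lookup a x \<le> N" if "mdeg a \<le> N" for a :: "'n \<Rightarrow>\<^sub>0 nat" and x
    using member_le_sum[of x UNIV "Poly_Mapping.lookup a"] that by (simp add: mdeg_def)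
  then have "Poly_Mapping.lookup ` {a :: 'n \<Rightarrow>\<^sub>0 nat. mdeg a \<le> N}
      \<subseteq> {f. \<forall>x. (x \<in> UNIV \<longrightarrow> f x \<in> {..N}) \<and> (x \<notin> UNIV \<longrightarrow> f x = 0)}" by auto
  moreover have "finite {f :: 'n \<Rightarrow> nat. \<forall>x. (x \<in> UNIV \<longrightarrow> f x \<in> {..N}) \<and> (x \<notin> UNIV \<longrightarrow> f x = 0)}"
    by (intro finite_set_of_finite_funs) auto
  ultimately show "finite (Poly_Mapping.lookup ` {a :: 'n \<Rightarrow>\<^sub>0 nat. mdeg a \<le> N})"
    by (rule finite_subset)
  show "inj_on Poly_Mapping.lookup {a :: 'n \<Rightarrow>\<^sub>0 nat. mdeg a \<le> N}"
    by (simp add: inj_on_def)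
qed

text \<open>An infinite basis would have \<open>card\<close> 0; the finite spanning set
  \<open>S\<close> rules this out.\<close>

lemma (in vector_space) dim_less:
  assumes "finite S" "C \<subseteq> span S" "B \<subseteq> C" "z \<in> C" "z \<notin> span B"
  shows "dim B < dim C"
proof -
  obtain A where A: "A \<subseteq> B" "independent A" "B \<subseteq> span A" "card A = dim B" by (rule basis_exists)
  have zA: "z \<notin> span A" using span_mono[OF A(1)] assms(5) by blast
  then have "independent (insert z A)" using A(2) by (rule independent_insertI)
  then obtain A' where A': "insert z A \<subseteq> A'" "A' \<subseteq> C" "independent A'" "C \<subseteq> span A'"
    using maximal_independent_subset_extend[of "insert z A" C] A(1) assms(3,4) by blast
  have "finite A'" using independent_span_bound[OF assms(1) A'(3)] A'(2) assms(2) by blast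
  moreover have "z \<notin> A" using zA span_base by blast
  ultimately have "card A < card A'" using A'(1) by (intro psubset_card_mono) auto
  then show ?thesis using A(4) basis_card_eq_dim[OF A'(2,4,3)] by simp
qed

lemma const_scale_vector_space:
  "vector_space (\<lambda>(c::'k::field) (v::nat \<Rightarrow> ('n, 'k) mpoly) k. const c * v k)"
proof
  fix a b :: 'k and x y :: "nat \<Rightarrow> ('n, 'k) mpoly"
  show "(\<lambda>k. const a * (x + y) k) = (\<lambda>k. const a * x k) + (\<lambda>k. const a * y k)"
    by (simp add: fun_eq_iff distrib_left)
  show "(\<lambda>k. const (a + b) * x k) = (\<lambda>k. const a * x k) + (\<lambda>k. const b * x k)"
    by (simp add: fun_eq_iff const_def single_add distrib_right)
  show "(\<lambda>k. const a * (const b * x k)) = (\<lambda>k. const (a * b) * x k)"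
    by (simp add: fun_eq_iff const_def mult_single flip: mult.assoc)
  show "(\<lambda>k. const 1 * x k) = x"
    by (simp add: const_def)
qed

text \<open>No nonconstant monomial of \<open>f\<close> can carry a monomial of \<open>g\<close> to
  \<open>m\<close>, so \<open>f\<close> acts on this coefficient as it does on the residue
  field.\<close>

lemma lookup_mult_minimal:
  fixes f g :: "('n, 'k::field) mpoly"
  assumes "\<And>a b. a \<in> Poly_Mapping.keys g \<Longrightarrow> m = b + a \<Longrightarrow> b = 0"
  shows "Poly_Mapping.lookup (f * g) m = Poly_Mapping.lookup f 0 * Poly_Mapping.lookup g m"
proof -
  let ?c = "Poly_Mapping.single 0 (Poly_Mapping.lookup f 0)" and ?f = "restr (- {0}) f"
  have "f = ?c + ?f"
    by (rule poly_mapping_eqI) (simp add: lookup_add lookup_restr lookup_single when_def)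
  then have "f * g = ?c * g + ?f * g" by (metis distrib_right)
  moreover have "m \<notin> Poly_Mapping.keys (?f * g)"
  proof
    assume "m \<in> Poly_Mapping.keys (?f * g)"
    then obtain b a where "m = b + a" "b \<in> Poly_Mapping.keys ?f" "a \<in> Poly_Mapping.keys g"
      using keys_mult[of ?f g] by blast
    then show False using assms[of a b] by (simp add: keys_restr)
  qed
  moreover have "Poly_Mapping.lookup (?c * g) m = Poly_Mapping.lookup f 0 * Poly_Mapping.lookup g m"
    using lookup_monom_mult[of 0 "Poly_Mapping.lookup f 0" g m] by simp
  ultimately show ?thesis by (simp add: lookup_add in_keys_iff)
qed

section \<open>From vanishing to Betti numbers\<close>

context resolution
begin

text \<open>Filter by degree: the quotients are direct sums of single monomials \<open>a\<close>,
  with homology only in \<open>j = i + mdeg a\<close>. This bounds \<open>j - i\<close> from below,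
  so that the maximum in \<open>regularity\<close> is taken over a finite set.\<close>

lemma vanishing_low:
  assumes D: "convex_exp D" and ji: "j < int i"
  shows "vanishing F i j D"
proof -
  let ?D = "\<lambda>N. {a \<in> D. N \<le> mdeg a}"
  have conv: "convex_exp (?D N)" for N
    using D unfolding convex_exp_def mem_Collect_eq by (metis mdeg_add trans_le_add1)
  \<comment> \<open>Larger than every \<open>j - shift F i k\<close>, so the part of
    \<open>D\<close> in degrees from \<open>M\<close> on has no nonzero chains here.\<close>
  define M where "M = nat (\<Sum>k<rnk F i. \<bar>j - shift F i k\<bar>) + 1"
  have "vanishing F i j (?D M)"
    unfolding vanishing_def
  proof (intro ballI impI)
    fix v assume v: "v \<in> ch F (?D M) i j"
    have "v k = 0" for k
    proof (cases "k < rnk F i")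
      case True
      have "\<bar>j - shift F i k\<bar> \<le> (\<Sum>k<rnk F i. \<bar>j - shift F i k\<bar>)"
        using True by (intro member_le_sum) auto
      then have M: "j - shift F i k < int M" by (simp add: M_def)
      have "Poly_Mapping.keys (v k) \<subseteq> ?D M" "v k \<in> homog (j - shift F i k)"
        using v True by (auto simp: ch_def chains_def)
      then have "Poly_Mapping.keys (v k) = {}"
        using M unfolding homog_def by fastforce
      then show ?thesis by simp
    next
      case False
      then show ?thesis using v by (simp add: ch_def chains_def)
    qed
    then have "v = bd F (?D M) i 0" by (auto simp: fun_eq_iff bd_def rs_def bdry_def)
    then show "v \<in> bd F (?D M) i ` ch F (?D M) (Suc i) j" using ch_zero by blast
  qed
  then have "vanishing F i j (?D (M - n))" for n
  proof (induction n)
    case 0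
    then show ?case by simp
  next
    case (Suc n)
    show ?case
    proof (cases "M - n = 0")
      case True
      then show ?thesis using Suc by simp
    next
      case False
      let ?N = "M - Suc n"
      have N: "M - n = Suc ?N" using False by simp
      have up: "up_in (?D (Suc ?N)) (?D ?N)" by (auto simp: up_in_def mdeg_add)
      have eq: "?D ?N - ?D (Suc ?N) = {a \<in> D. mdeg a = ?N}" by auto
      have "vanishing F i j {a \<in> D. mdeg a = ?N}"
      proof (rule vanishing_classes[where f = id])
        show "convex_exp {a \<in> D. mdeg a = ?N}"
          using D unfolding convex_exp_def mem_Collect_eq by (metis add_left_cancel add_0_right add.assoc add_is_0 mdeg_add)
        show "id (a + b) = id a" if "a \<in> {a \<in> D. mdeg a = ?N}" "a + b \<in> {a \<in> D. mdeg a = ?N}" for a b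
        proof -
          have "mdeg b = 0" using that by (simp add: mdeg_add)
          then have "b = 0" by (intro poly_mapping_eqI) (simp add: mdeg_def)
          then show ?thesis by simp
        qed
        have "finite {a \<in> D. mdeg a = ?N}" by (rule finite_subset[OF _ finite_mdeg_le[of ?N]]) auto
        then show "finite (id ` {a \<in> D. mdeg a = ?N})" by simp
        fix y
        have yc: "{a \<in> {a \<in> D. mdeg a = ?N}. id a = y} = {y} \<or> {a \<in> {a \<in> D. mdeg a = ?N}. id a = y} = {}"
          by auto
        have "vanishing F i j {y}" using ji by (intro vanishing_point) simp
        then show "vanishing F i j {a \<in> {a \<in> D. mdeg a = ?N}. id a = y}"
          using yc by (elim disjE) (simp_all only: vanishing_empty)
      qed
      then show ?thesis
        using vanishing_trans[OF conv up] Suc.IH[OF Suc.prems] unfolding N eq by blast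
    qed
  qed
  from this[of M] show ?thesis by simp
qed


lemma chains_monomial_ideal:
  "chains (\<lambda>d. {f. Poly_Mapping.keys f \<subseteq> D} \<inter> homog d) F i j = ch F D i j"
proof -
  have "Poly_Mapping.keys (v k) \<subseteq> D"
    if "\<And>k. k < rnk F i \<Longrightarrow> Poly_Mapping.keys (v k) \<subseteq> D" "\<And>k. rnk F i \<le> k \<Longrightarrow> v k = 0"
    for v :: "nat \<Rightarrow> ('n, 'k) mpoly" and k
    using that[of k] by (cases "k < rnk F i") auto
  then show ?thesis by (auto simp: ch_def chains_def)
qed

lemma bd_monomial_ideal:
  assumes "up_in D UNIV" "v \<in> ch F D (Suc i) j"
  shows "bd F D i v = bdry (*) F i v"
proof (rule ext)
  fix k
  have "Poly_Mapping.keys (bdry (*) F i v k) \<subseteq> D"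
  proof
    fix m assume m: "m \<in> Poly_Mapping.keys (bdry (*) F i v k)"
    have "\<And>k. Poly_Mapping.keys (v k) \<subseteq> D" using assms(2) by (simp add: ch_def)
    from keys_bdry[OF this m] show "m \<in> D" using assms(1) by (auto simp: up_in_def)
  qed
  then show "bd F D i v k = bdry (*) F i v k" by (simp add: bd_def rs_def restr_id)
qed

text \<open>An equality of sets, which makes the difference of dimensions 0 without computing
  either.\<close>

lemma cycles_eq_boundaries:
  assumes D: "up_in D UNIV" and V: "vanishing F i j D"
  defines "M \<equiv> \<lambda>d. {f. Poly_Mapping.keys f \<subseteq> D} \<inter> homog d"
  shows "cycles (*) M F i j = boundaries (*) M F i j"
proof (intro equalityI subsetI)
  fix v assume v: "v \<in> cycles (*) M F i j"
  have c: "v \<in> ch F D i j"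
    using v by (cases i) (simp_all add: M_def chains_monomial_ideal)
  have "bd F D i' v = 0" if "i = Suc i'" for i'
    using v c bd_monomial_ideal[OF D] that by simp
  then have "v \<in> bd F D i ` ch F D (Suc i) j"
    using V c unfolding vanishing_def by blast
  then show "v \<in> boundaries (*) M F i j"
    unfolding boundaries_def M_def chains_monomial_ideal using bd_monomial_ideal[OF D] by force
next
  fix v assume "v \<in> boundaries (*) M F i j"
  then obtain w where w: "w \<in> ch F D (Suc i) j" "v = bd F D i w"
    unfolding boundaries_def M_def chains_monomial_ideal using bd_monomial_ideal[OF D] by force
  have v: "v \<in> ch F D i j" using w bd_ch by blast
  show "v \<in> cycles (*) M F i j"
  proof (cases i)
    case 0
    then show ?thesis using v by (simp add: M_def chains_monomial_ideal)
  next
    case (Suc i')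
    have "bd F D i' v = 0" using bd_bd[OF up_in_UNIV_convex[OF D]] w Suc by blast
    then have "bdry (*) F i' v = 0" using bd_monomial_ideal[OF D] v Suc by metis
    then show ?thesis using v Suc by (simp add: M_def chains_monomial_ideal)
  qed
qed

text \<open>If \<open>m\<close> is a minimal generator, then \<open>v \<mapsto> \<Sum>\<^sub>k aug\<^sub>k \<cdot> coeff\<^sub>m (v\<^sub>k)\<close> is a functional on the chains in
  homological degree 0 that kills all boundaries.\<close>

lemma minimal_generator_homology:
  assumes m: "m \<in> D" and min: "\<And>a b. a \<in> D \<Longrightarrow> m = b + a \<Longrightarrow> b = 0"
  defines "M \<equiv> \<lambda>d. {f :: ('n, 'k) mpoly. Poly_Mapping.keys f \<subseteq> D} \<inter> homog d"
    and "dimK \<equiv> vector_space.dim (\<lambda>(c::'k) (v::nat \<Rightarrow> ('n, 'k) mpoly) k. const c * v k)"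
  assumes sub: "boundaries (*) M F 0 (int (mdeg m)) \<subseteq> cycles (*) M F 0 (int (mdeg m))"
  shows "dimK (boundaries (*) M F 0 (int (mdeg m))) < dimK (cycles (*) M F 0 (int (mdeg m)))"
proof -
  let ?j = "int (mdeg m)"
  interpret vs: vector_space "\<lambda>(c::'k) (v::nat \<Rightarrow> ('n, 'k) mpoly) k. const c * v k"
    by (rule const_scale_vector_space)
  define phi where "phi v = (\<Sum>k<rnk F 0. aug F k * Poly_Mapping.lookup (v k) m)"
    for v :: "nat \<Rightarrow> ('n, 'k) mpoly"
  have phi_bdry: "phi (bdry (*) F 0 w) = 0" if w: "\<And>k. Poly_Mapping.keys (w k) \<subseteq> D" for w
  proof -
    let ?a = "\<lambda>k l. aug F k * Poly_Mapping.lookup (mat F 0 k l) 0"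
    \<comment> \<open>The boundary of a basis element augments to 0, and the augmentation sees only
      constant terms.\<close>
    have col: "(\<Sum>k<rnk F 0. ?a k l) = 0" if l: "l < rnk F 1" for l
    proof -
      let ?e = "\<lambda>l'. if l' = l then 1 else (0 :: ('n, 'k) mpoly)"
      have "?e \<in> chains homog F (Suc 0) (shift F (Suc 0) l)"
        using l by (auto simp: chains_def homog_def mdeg_def)
      then have "bdry (*) F 0 ?e \<in> boundaries (*) homog F 0 (shift F (Suc 0) l)"
        unfolding boundaries_def by (rule imageI)
      then have "augment res_scale F (bdry (*) F 0 ?e) = 0"
        unfolding augment_kernel[symmetric] by simp
      moreover have "bdry (*) F 0 ?e k = mat F 0 k l" if "k < rnk F 0" for k
      proof -
        have "(\<Sum>l'<rnk F (Suc 0). mat F 0 k l' * ?e l') = (\<Sum>l'<rnk F (Suc 0). if l' = l then mat F 0 k l' else 0)"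
          by (intro sum.cong) auto
        then show ?thesis using l that by (simp add: bdry_def)
      qed
      ultimately show ?thesis by (simp add: augment_def res_scale_def mult.commute)
    qed
    have "phi (bdry (*) F 0 w) =
        (\<Sum>k<rnk F 0. \<Sum>l<rnk F 1. aug F k * Poly_Mapping.lookup (mat F 0 k l * w l) m)"
      by (simp add: phi_def bdry_def lookup_sum sum_distrib_left)
    also have "\<dots> = (\<Sum>k<rnk F 0. \<Sum>l<rnk F 1. ?a k l * Poly_Mapping.lookup (w l) m)"
    proof (intro sum.cong refl)
      fix k l
      have "Poly_Mapping.lookup (mat F 0 k l * w l) m =
          Poly_Mapping.lookup (mat F 0 k l) 0 * Poly_Mapping.lookup (w l) m"
        by (rule lookup_mult_minimal) (use w min in blast)
      then show "aug F k * Poly_Mapping.lookup (mat F 0 k l * w l) m = ?a k l * Poly_Mapping.lookup (w l) m"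
        by (simp add: mult.assoc)
    qed
    also have "\<dots> = (\<Sum>l<rnk F 1. (\<Sum>k<rnk F 0. ?a k l) * Poly_Mapping.lookup (w l) m)"
      by (subst sum.swap) (simp add: sum_distrib_right)
    also have "\<dots> = 0" using col by simp
    finally show ?thesis .
  qed
  \<comment> \<open>The augmentation is onto, so some generator \<open>k0\<close>, necessarily of
    degree 0, has nonzero image. The monomial \<open>m\<close> placed at \<open>k0\<close> will be
    the cycle that is not in the span of the boundaries.\<close>
  have "\<exists>k<rnk F 0. aug F k \<noteq> 0"
  proof (rule ccontr)
    assume "\<not> ?thesis"
    then have "augment res_scale F v = 0" for v
      by (simp add: augment_def res_scale_def)
    moreover have "(1::'k) \<in> augment res_scale F ` chains homog F 0 0"
      unfolding augment_image by (simp add: res_field_def)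
    ultimately show False by auto
  qed
  then obtain k0 where k0: "k0 < rnk F 0" "aug F k0 \<noteq> 0" by blast
  have s0: "shift F 0 k0 = 0"
    using aug_res[OF k0(1)] k0(2) by (auto simp: res_field_def split: if_splits)
  \<comment> \<open>Monomial chains; those of the right degree form the finite spanning set that
    \<open>dim_less\<close> asks for.\<close>
  define e where "e l a = (\<lambda>k. if k = l then Poly_Mapping.single a (1::'k) else 0)"
    for l :: nat and a :: "'n \<Rightarrow>\<^sub>0 nat"
  define S where "S = (\<Union>l<rnk F 0. e l ` {a. int (mdeg a) = ?j - shift F 0 l})"
  have finS: "finite S"
    unfolding S_def
  proof (intro finite_UN_I finite_imageI)
    show "finite {a :: 'n \<Rightarrow>\<^sub>0 nat. int (mdeg a) = ?j - shift F 0 l}" for l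
      by (rule finite_subset[OF _ finite_mdeg_le[of "nat (?j - shift F 0 l)"]]) auto
  qed simp
  have cyc: "cycles (*) M F 0 ?j = ch F D 0 ?j" by (simp add: M_def chains_monomial_ideal)
  have span: "ch F D 0 ?j \<subseteq> vs.span S"
  proof
    fix v assume v: "v \<in> ch F D 0 ?j"
    have "v = (\<Sum>l<rnk F 0. \<Sum>a\<in>Poly_Mapping.keys (v l). (\<lambda>k. const (Poly_Mapping.lookup (v l) a) * e l a k))"
      (is "_ = ?r")
    proof (rule ext)
      fix k
      have sum_app: "sum f A k = (\<Sum>x\<in>A. f x k)" for f :: "'x \<Rightarrow> nat \<Rightarrow> ('n, 'k) mpoly" and A
        by (induction A rule: infinite_finite_induct) auto
      have "?r k = (\<Sum>l<rnk F 0. if l = k then v k else 0)"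
        unfolding sum_app
      proof (intro sum.cong refl)
        fix l
        show "(\<Sum>a\<in>Poly_Mapping.keys (v l). const (Poly_Mapping.lookup (v l) a) * e l a k) =
            (if l = k then v k else 0)"
          using mpoly_sum_monomials[of "v l", symmetric] by (auto simp: e_def const_def mult_single)
      qed
      also have "\<dots> = v k" using v by (auto simp: ch_def chains_def)
      finally show "v k = ?r k" by simp
    qed
    moreover have "?r \<in> vs.span S"
    proof (intro vs.span_sum vs.span_scale vs.span_base)
      fix l a assume la: "l \<in> {..<rnk F 0}" "a \<in> Poly_Mapping.keys (v l)"
      then have "int (mdeg a) = ?j - shift F 0 l"
        using v by (auto simp: ch_def chains_def homog_def)
      then show "e l a \<in> S" using la(1) by (auto simp: S_def)
    qed
    ultimately show "v \<in> vs.span S" by simp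
  qed
  have "e k0 m \<in> ch F D 0 ?j"
    using k0(1) s0 m by (auto simp: ch_def chains_def e_def homog_def)
  moreover have "e k0 m \<notin> vs.span (boundaries (*) M F 0 ?j)"
  proof
    assume "e k0 m \<in> vs.span (boundaries (*) M F 0 ?j)"
    then have "phi (e k0 m) = 0"
    proof (induction rule: vs.span_induct_alt)
      case base
      show ?case by (simp add: phi_def)
    next
      case (step c x y)
      then obtain w where w: "w \<in> ch F D (Suc 0) ?j" "x = bdry (*) F 0 w"
        unfolding boundaries_def M_def chains_monomial_ideal by blast
      have "phi x = 0" unfolding w(2) by (rule phi_bdry) (use w(1) in \<open>simp add: ch_def\<close>)
      have lc: "Poly_Mapping.lookup (const c * f) m = c * Poly_Mapping.lookup f m" for f :: "('n, 'k) mpoly"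
        using lookup_monom_mult[of 0 c f m] by (simp add: const_def)
      have "phi ((\<lambda>k. const c * x k) + y) = c * phi x + phi y"
        by (simp add: phi_def lookup_add lc distrib_left sum.distrib sum_distrib_left mult.left_commute)
      then have "phi ((\<lambda>k. const c * x k) + y) = 0" using step.IH \<open>phi x = 0\<close> by simp
      then show ?case .
    qed
    moreover have "phi (e k0 m) = (\<Sum>k<rnk F 0. if k = k0 then aug F k else 0)"
      unfolding phi_def e_def by (intro sum.cong) auto
    ultimately show False using k0 by simp
  qed
  ultimately show ?thesis
    unfolding dimK_def using vs.dim_less[OF finS span] sub unfolding cyc by blast
qed

end

section \<open>The regularity of the symbolic powers\<close>

theorem theorem1p1:
  fixes E :: "'n::finite set set" and s :: nat
  assumes "simple_graph E"
    and "co_chordal E"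
    and "E \<noteq> {}"
    and "1 \<le> s"
  shows "ideal_reg (symbolic_power E s :: ('n, 'k::field) mpoly set) = 2 * int s"
proof -
  define F where "F = (SOME F :: ('n, 'k, 'k) free_cx. graded_free_resolution res_scale res_field F)"
  interpret resolution F
    by unfold_locales (unfold F_def, rule someI_ex, rule residue_field_resolution_exists)
  define D where "D = clique_ideal (complement_graph E) UNIV s"
  define M where "M = (\<lambda>d. {f :: ('n, 'k) mpoly. Poly_Mapping.keys f \<subseteq> D} \<inter> homog d)"
  have "symbolic_power E s = {f :: ('n, 'k) mpoly. Poly_Mapping.keys f \<subseteq> D}"
    using symbolic_power_iff[OF assms(1)] by (auto simp: D_def)
  then have reg: "ideal_reg (symbolic_power E s :: ('n, 'k) mpoly set) = Max {j - int i |i j. betti (*) M i j \<noteq> 0}"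
    by (simp add: ideal_reg_def regularity_def M_def)
  have betti: "betti (*) M i j =
      vector_space.dim (\<lambda>(c::'k) (v::nat \<Rightarrow> ('n, 'k) mpoly) k. const c * v k) (cycles (*) M F i j)
      - vector_space.dim (\<lambda>(c::'k) (v::nat \<Rightarrow> ('n, 'k) mpoly) k. const c * v k) (boundaries (*) M F i j)" for i j
    by (simp add: betti_def tor_dim_def F_def Let_def)
  have up: "up_in D UNIV" unfolding D_def by (rule clique_ideal_up)
  have "reg_le F (2 * int s) D"
    unfolding D_def using assms(2) by (intro reg_le_clique_ideal) (simp_all add: co_chordal_def simple_complement_graph)
  then have high: "betti (*) M i j = 0" if "int i + 2 * int s < j" for i j
    unfolding betti using cycles_eq_boundaries[OF up] that by (simp add: reg_le_def M_def)
  have low: "betti (*) M i j = 0" if "j < int i" for i j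
    unfolding betti using cycles_eq_boundaries[OF up vanishing_low[OF up_in_UNIV_convex[OF up] that]]
    by (simp add: M_def)
  obtain e where e: "e \<in> E" using assms(3) by blast
  then obtain x y where xy: "e = {x, y}" "x \<noteq> y"
    using assms(1) by (auto simp: simple_graph_def card_2_iff)
  \<comment> \<open>Every clique of the complement misses \<open>x\<close> or \<open>y\<close>,
    which puts this monomial in the ideal. Neither exponent can drop, because \<open>{x}\<close> and
    \<open>{y}\<close> are themselves cliques.\<close>
  define m where "m = Poly_Mapping.single x s + Poly_Mapping.single y s"
  have mdeg_m: "mdeg m = 2 * s" by (simp add: m_def mdeg_add mdeg_single)
  have mD: "m \<in> D"
    unfolding D_def clique_ideal_def
  proof (intro CollectI allI impI)
    fix K assume "clique (complement_graph E) K \<and> K \<subseteq> UNIV"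
    then have "x \<notin> K \<or> y \<notin> K"
      using e xy by (auto simp: clique_def complement_graph_def)
    then obtain z where z: "z \<in> {x, y}" "z \<notin> K" by blast
    have "s \<le> Poly_Mapping.lookup m z" using z(1) by (auto simp: m_def lookup_add lookup_single)
    also have "\<dots> \<le> wt (UNIV - K) m"
      unfolding wt_def using z(2) by (intro member_le_sum) auto
    finally show "s \<le> wt (UNIV - K) m" .
  qed
  have mmin: "b = 0" if a: "a \<in> D" and mab: "m = b + a" for a b
  proof -
    have lk: "Poly_Mapping.lookup m z = Poly_Mapping.lookup b z + Poly_Mapping.lookup a z" for z
      unfolding mab by (simp add: lookup_add)
    have m0: "Poly_Mapping.lookup m z = 0" if "z \<notin> {x, y}" for z
      using that by (auto simp: m_def lookup_add lookup_single when_def)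
    have ms: "Poly_Mapping.lookup m z = s" if "z \<in> {x, y}" for z
      using that xy(2) by (auto simp: m_def lookup_add lookup_single when_def)
    have as: "s \<le> Poly_Mapping.lookup a z" if z: "{z, z'} = {x, y}" "z \<noteq> z'" for z z'
    proof -
      \<comment> \<open>A divisor of \<open>m\<close> has all its weight outside of
        \<open>z'\<close> at \<open>z\<close>, so the constraint of this clique bounds the exponent
        of \<open>z\<close> alone.\<close>
      have "clique (complement_graph E) {z'}" by (simp add: clique_def)
      then have "s \<le> wt (UNIV - {z'}) a" using a unfolding D_def clique_ideal_def by blast
      also have "wt (UNIV - {z'}) a = (\<Sum>i\<in>{z}. Poly_Mapping.lookup a i)"
        unfolding wt_def
      proof (rule sum.mono_neutral_right)
        show "\<forall>i\<in>UNIV - {z'} - {z}. Poly_Mapping.lookup a i = 0"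
          using lk m0 z(1) by (metis DiffD1 DiffD2 add_is_0 insert_iff singletonD)
      qed (use z in auto)
      finally show ?thesis by simp
    qed
    show ?thesis
    proof (rule poly_mapping_eqI)
      fix z
      consider "z = x" | "z = y" | "z \<notin> {x, y}" by blast
      then show "Poly_Mapping.lookup b z = Poly_Mapping.lookup 0 z"
      proof cases
        case 1 then show ?thesis using as[of x y] lk[of x] ms[of x] xy(2) by simp
      next
        case 2 then show ?thesis using as[of y x] lk[of y] ms[of y] xy(2) by (simp add: insert_commute)
      next
        case 3 then show ?thesis using lk[of z] m0[of z] by simp
      qed
    qed
  qed
  have sub: "boundaries (*) M F 0 j \<subseteq> cycles (*) M F 0 j" for j
  proof
    fix v assume "v \<in> boundaries (*) M F 0 j"
    then obtain w where w: "w \<in> ch F D (Suc 0) j" "v = bdry (*) F 0 w"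
      unfolding boundaries_def M_def chains_monomial_ideal by blast
    then have "v = bd F D 0 w" using bd_monomial_ideal[OF up] by metis
    then show "v \<in> cycles (*) M F 0 j" using w(1) bd_ch by (simp add: M_def chains_monomial_ideal)
  qed
  have "betti (*) M 0 (2 * int s) \<noteq> 0"
  proof -
    from sub have "boundaries (*) M F 0 (int (mdeg m)) \<subseteq> cycles (*) M F 0 (int (mdeg m))" .
    with mD mmin have "vector_space.dim (\<lambda>(c::'k) (v::nat \<Rightarrow> ('n, 'k) mpoly) k. const c * v k)
        (boundaries (*) M F 0 (int (mdeg m)))
      < vector_space.dim (\<lambda>(c::'k) (v::nat \<Rightarrow> ('n, 'k) mpoly) k. const c * v k)
        (cycles (*) M F 0 (int (mdeg m)))"
      unfolding M_def by (rule minimal_generator_homology)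
    then show ?thesis unfolding betti mdeg_m by simp
  qed
  then have mem: "2 * int s \<in> {j - int i |i j. betti (*) M i j \<noteq> 0}" by force
  \<comment> \<open>The lower end comes from \<open>low\<close> and serves only to make the set
    finite for \<open>Max\<close>.\<close>
  have ran: "{j - int i |i j. betti (*) M i j \<noteq> 0} \<subseteq> {0..2 * int s}"
    using high low by (force simp: not_less[symmetric])
  show ?thesis
    unfolding reg
  proof (rule Max_eqI[OF _ _ mem])
    show "finite {j - int i |i j. betti (*) M i j \<noteq> 0}"
      using ran by (rule finite_subset) simp
    show "d \<le> 2 * int s" if "d \<in> {j - int i |i j. betti (*) M i j \<noteq> 0}" for d
      using subsetD[OF ran that] by simp
  qed
qed

end
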